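(* Let $\mathbf{k}$ be a field of characteristic $p>0$, let $q$ be a power of $p$, and let $G$ be a finite group with a normal subgroup $H$ such that $p\nmid|H|$ and $G/H\cong C_q$ is cyclic of order $q$ with generator $\rho$. Let $A$ be a $\mathbf{k}G$-module algebra and $M$ an $(\mathbf{m},\mathbf{h})$-degenerated $A^eG$-module algebra. Then there is an isomorphism of graded algebras $$\mathrm{HH}^*(A,M)^G/W_M^G\;\cong\;\bar{\mathcal{A}}_M^G[x,D_{\mathbf{h}}]/\langle x^2-\bar{\mathbf{h}}\smile\bar{\mathbf{h}}\rangle .$$
   Context: All algebras are unital. A $\mathbf{k}G$-module algebra is an algebra with $G$ acting by algebra automorphisms. $A^e=A\otimes A^{\mathrm{op}}$ carries the diagonal $G$-action and $A^eG=A^e\#\mathbf{k}G$ is the skew group algebra; an $A^eG$-module is an $A$-bimodule with a compatible $G$-action. An $A^eG$-module algebra is an $A^eG$-module $M$ with a unital associative $\mathbf{k}$-algebra structure such that $G$ acts by algebra automorphisms and the multiplication is induced by an $A$-bimodule map $M\otimes_AM\to M$. $C^n(A,M)\cong\mathrm{Hom}_{\mathbf{k}}(A^{\otimes n},M)$ is the Hochschild cochain complex with $G$-action $({}^\alpha f)(a_1\otimes\cdots\otimes a_n)={}^\alpha\big(f({}^{\alpha^{-1}}a_1\otimes\cdots\otimes{}^{\alpha^{-1}}a_n)\big)$ and cup product $\smile$; $\mathrm{HH}^*(A,M)$ is its cohomology, a graded algebra with $G$-action. If $G$ acts on $V$, then $C_q=G/H$ acts on the $H$-invariants $V^H$. Put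 $\Delta_\rho=1-\rho\in\mathbf{k}C_q$ (so $\Delta_\rho^{q-1}=\sum_{i=0}^{q-1}\rho^i$). For $x\in M$, $\phi_x:A\to M$ is the inner derivation $\phi_x(a)=ax-xa$; $\mathrm{Der}(A,M)$ is the space of $\mathbf{k}$-linear derivations $A\to M$. $M$ is called $(\mathbf{m},\mathbf{h})$-degenerated if $\mathbf{m}\in M^H$ and $\mathbf{h}\in\mathrm{Der}(A,M)^H$ satisfy $\Delta_\rho^{q-1}\mathbf{m}=1_M$ and $\Delta_\rho\mathbf{h}+\phi_{\mathbf{m}}=0$. Then $\bar{\mathbf{h}}\in\mathrm{HH}^1(A,M)^G$ denotes the class of $\mathbf{h}$. $\Theta_M^G$ is the graded algebra homomorphism from the cohomology $\mathrm{HH}^*(A,M)^{G\uparrow}$ of the invariant complex $C(A,M)^G$ to $\mathrm{HH}^*(A,M)^G$ induced by the inclusion $C(A,M)^G\hookrightarrow C(A,M)$. Put $\mathcal{A}_M^G=\mathrm{Im}\,\Theta_M^G$, $W_M^G=\Delta_\rho^{q-1}\mathrm{HH}^*(A,M)^H$ (an ideal of $\mathrm{HH}^*(A,M)^G$ contained in $\mathcal{A}_M^G$) and $\bar{\mathcal{A}}_M^G=\mathcal{A}_M^G/W_M^G$. One has $\bar{\mathbf{h}}\smile\bar{\mathbf{h}}\in\mathcal{A}_M^G$, and the formula $D_{\mathbf{h}}(a)=\bar{\mathbf{h}}\smile a-(-1)^ia\smile\bar{\mathbf{h}}$ for $a\in(\mathcal{A}_M^G)_i$ defines a map $\mathcal{A}_M^G\to\mathcal{A}_M^G$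 preserving $W_M^G$; the induced graded derivation of $\bar{\mathcal{A}}_M^G$ is again denoted $D_{\mathbf{h}}$. In the displayed formula $\bar{\mathbf{h}}\smile\bar{\mathbf{h}}$ stands for its class in $\bar{\mathcal{A}}_M^G$. For a graded algebra $B$ and a graded derivation $D$ of $B$ (degree $1$, $D(ab)=D(a)b+(-1)^iaD(b)$ for $a\in B_i$), $B[x,D]$ is the graded algebra with underlying space $B[x]$, whose $n$-th component is spanned by $bx^i$ with $b\in B_{n-i}$, containing $B$ and $\mathbf{k}[x]$ as subalgebras, with $xb=(-1)^ibx+D(b)$ for $b\in B_i$. *)

theory Defs
  imports Complex_Main "HOL-Algebra.Module" "HOL-Algebra.QuotRing" "HOL-Algebra.Group_Action" "HOL-Algebra.Generated_Groups"
begin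

section \<open>Module algebras over a finite group\<close>

text \<open>
  Algebras live on whole types of sort \<open>{ring, monoid_mult}\<close>, i.e. unital associative rings in which
  \<open>0 = 1\<close> is not excluded (in contrast to \<open>ring_1\<close>).
\<close>

record ('k, 'g, 'a) module_algebra_data =
  scal :: "'k \<Rightarrow> 'a \<Rightarrow> 'a"
  act :: "'g \<Rightarrow> 'a \<Rightarrow> 'a"

record ('k, 'g, 'm, 'a) bimodule_data = "('k, 'g, 'm) module_algebra_data" +
  lact :: "'a \<Rightarrow> 'm \<Rightarrow> 'm"
  ract :: "'m \<Rightarrow> 'a \<Rightarrow> 'm"

definition unital_algebra :: "('k::field \<Rightarrow> 'a::{ring,monoid_mult} \<Rightarrow> 'a) \<Rightarrow> bool" where
  "unital_algebra s \<longleftrightarrow>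
     vector_space s \<and> (\<forall>c x y. s c x * y = s c (x * y) \<and> x * s c y = s c (x * y))"

definition kG_module_algebra ::
  "('g, 'u) monoid_scheme \<Rightarrow> ('k::field, 'g, 'a::{ring,monoid_mult}, 'v) module_algebra_data_scheme \<Rightarrow> bool"
where
  "kG_module_algebra G A \<longleftrightarrow>
     unital_algebra (scal A) \<and> group_action G UNIV (act A) \<and>
     (\<forall>g\<in>carrier G. Vector_Spaces.linear (scal A) (scal A) (act A g) \<and>
        act A g 1 = 1 \<and> (\<forall>x y. act A g (x * y) = act A g x * act A g y))"

text \<open>
  An \<open>A\<^sup>eG\<close>-module: an \<open>A\<close>-bimodule on which both actions of \<open>k\<close> agree (bilinearity below), with a
  \<open>G\<close>-action that is compatible with the bimodule structure.
\<close>

definition AeG_module ::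
  "('g, 'u) monoid_scheme \<Rightarrow> ('k::field, 'g, 'a::{ring,monoid_mult}, 'v) module_algebra_data_scheme \<Rightarrow>
   ('k, 'g, 'm::ab_group_add, 'a, 'w) bimodule_data_scheme \<Rightarrow> bool"
where
  "AeG_module G A M \<longleftrightarrow>
     vector_space (scal M) \<and>
     (\<forall>x. Vector_Spaces.linear (scal A) (scal M) (\<lambda>a. lact M a x)) \<and>
     (\<forall>x. Vector_Spaces.linear (scal A) (scal M) (\<lambda>a. ract M x a)) \<and>
     (\<forall>a. Vector_Spaces.linear (scal M) (scal M) (lact M a)) \<and>
     (\<forall>a. Vector_Spaces.linear (scal M) (scal M) (\<lambda>x. ract M x a)) \<and>
     (\<forall>x. lact M 1 x = x \<and> ract M x 1 = x) \<and>
     (\<forall>a b x. lact M (a * b) x = lact M a (lact M b x)) \<and>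
     (\<forall>a b x. ract M x (a * b) = ract M (ract M x a) b) \<and>
     (\<forall>a b x. ract M (lact M a x) b = lact M a (ract M x b)) \<and>
     group_action G UNIV (act M) \<and>
     (\<forall>g\<in>carrier G. Vector_Spaces.linear (scal M) (scal M) (act M g) \<and>
        (\<forall>a x. act M g (lact M a x) = lact M (act A g a) (act M g x)) \<and>
        (\<forall>a x. act M g (ract M x a) = ract M (act M g x) (act A g a)))"

text \<open>
  The last three equations say that the multiplication of \<open>M\<close> is \<open>A\<close>-balanced and a map of
  bimodules, i.e. induced by a bimodule map from the tensor square of \<open>M\<close> over \<open>A\<close>.
\<close>

definition AeG_module_algebra ::
  "('g, 'u) monoid_scheme \<Rightarrow> ('k::field, 'g, 'a::{ring,monoid_mult}, 'v) module_algebra_data_scheme \<Rightarrow>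
   ('k, 'g, 'm::{ring,monoid_mult}, 'a, 'w) bimodule_data_scheme \<Rightarrow> bool"
where
  "AeG_module_algebra G A M \<longleftrightarrow>
     AeG_module G A M \<and> kG_module_algebra G M \<and>
     (\<forall>x a y. ract M x a * y = x * lact M a y) \<and>
     (\<forall>a x y. lact M a x * y = lact M a (x * y)) \<and>
     (\<forall>x y a. x * ract M y a = ract M (x * y) a)"


section \<open>Group actions and the operator \<open>\<Delta>\<close>\<close>

definition fixed_pts :: "('g \<Rightarrow> 'v \<Rightarrow> 'v) \<Rightarrow> 'g set \<Rightarrow> 'v set \<Rightarrow> 'v set" where
  "fixed_pts \<alpha> K V = {v \<in> V. \<forall>g\<in>K. \<alpha> g v = v}"

text \<open>
  The action of a coset \<open>X \<in> G/H\<close> on an \<open>H\<close>-invariant vector \<open>v\<close>: the common value of \<open>\<alpha> g v\<close>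
  for \<open>g \<in> X\<close>. It is only meaningful on \<open>H\<close>-invariants.
\<close>

definition coset_act :: "('g \<Rightarrow> 'v \<Rightarrow> 'v) \<Rightarrow> 'g set \<Rightarrow> 'v \<Rightarrow> 'v" where
  "coset_act \<alpha> X v = the_elem ((\<lambda>g. \<alpha> g v) ` X)"

text \<open>
  \<open>\<Delta>\<^sub>\<rho> = 1 - \<rho>\<close> acting on \<open>H\<close>-invariants. The subtraction is a parameter because the operator is used
  on types and on carriers of records.
\<close>

definition Delta :: "('v \<Rightarrow> 'v \<Rightarrow> 'v) \<Rightarrow> ('g \<Rightarrow> 'v \<Rightarrow> 'v) \<Rightarrow> 'g set \<Rightarrow> 'v \<Rightarrow> 'v" where
  "Delta sub \<alpha> \<rho> v = sub v (coset_act \<alpha> \<rho> v)"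


section \<open>Degenerated module algebras\<close>

definition inner_derivation ::
  "('k, 'g, 'm::ab_group_add, 'a, 'w) bimodule_data_scheme \<Rightarrow> 'm \<Rightarrow> 'a \<Rightarrow> 'm" where
  "inner_derivation M x = (\<lambda>a. lact M a x - ract M x a)"

definition derivations ::
  "('k::field, 'g, 'a::{ring,monoid_mult}, 'v) module_algebra_data_scheme \<Rightarrow>
   ('k, 'g, 'm::ab_group_add, 'a, 'w) bimodule_data_scheme \<Rightarrow> ('a \<Rightarrow> 'm) set"
where
  "derivations A M =
     {f. Vector_Spaces.linear (scal A) (scal M) f \<and>
         (\<forall>a b. f (a * b) = lact M a (f b) + ract M (f a) b)}"

definition map_act ::
  "('g, 'u) monoid_scheme \<Rightarrow> ('k, 'g, 'a, 'v) module_algebra_data_scheme \<Rightarrow>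
   ('k, 'g, 'm, 'w) module_algebra_data_scheme \<Rightarrow> 'g \<Rightarrow> ('a \<Rightarrow> 'm) \<Rightarrow> 'a \<Rightarrow> 'm"
where
  "map_act G A M g f = (\<lambda>a. act M g (f (act A (inv\<^bsub>G\<^esub> g) a)))"

text \<open>In the last line, \<open>(-)\<close> is the pointwise difference of functions \<open>'a \<Rightarrow> 'm\<close>.\<close>

definition degenerated ::
  "('g, 'u) monoid_scheme \<Rightarrow> 'g set \<Rightarrow> 'g set \<Rightarrow> nat \<Rightarrow>
   ('k::field, 'g, 'a::{ring,monoid_mult}, 'v) module_algebra_data_scheme \<Rightarrow>
   ('k, 'g, 'm::{ring,monoid_mult}, 'a, 'w) bimodule_data_scheme \<Rightarrow> 'm \<Rightarrow> ('a \<Rightarrow> 'm) \<Rightarrow> bool"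
where
  "degenerated G H \<rho> q A M m h \<longleftrightarrow>
     m \<in> fixed_pts (act M) H UNIV \<and> h \<in> fixed_pts (map_act G A M) H (derivations A M) \<and>
     (Delta (-) (act M) \<rho> ^^ (q - 1)) m = 1 \<and>
     (\<forall>a. Delta (-) (map_act G A M) \<rho> h a + inner_derivation M m a = 0)"


section \<open>Graded algebras\<close>

text \<open>
  A graded algebra is given by its total algebra (a ring record together with scalars) and the
  family of its homogeneous components.
\<close>

record ('k, 'v) graded_algebra = "('k, 'v) module" +
  component :: "nat \<Rightarrow> 'v set"

definition graded_sub :: "('k, 'v) graded_algebra \<Rightarrow> 'v set \<Rightarrow> ('k, 'v) graded_algebra" where
  "graded_sub R S = R\<lparr>carrier := S, component := (\<lambda>n. component R n \<inter> S)\<rparr>"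

text \<open>The map on cosets of \<open>I\<close> induced by a map \<open>f\<close>, with values in cosets of \<open>J\<close> in \<open>S\<close>.\<close>

definition induced :: "('v, 'u) ring_scheme \<Rightarrow> 'v set \<Rightarrow> ('w \<Rightarrow> 'v) \<Rightarrow> 'w set \<Rightarrow> 'v set" where
  "induced S J f X = (\<Union>x\<in>X. J +>\<^bsub>S\<^esub> f x)"

definition graded_quot :: "('k, 'v) graded_algebra \<Rightarrow> 'v set \<Rightarrow> ('k, 'v set) graded_algebra" where
  "graded_quot R I =
     \<lparr>carrier = carrier (R Quot I), mult = mult (R Quot I), one = one (R Quot I),
      zero = zero (R Quot I), add = add (R Quot I),
      smult = (\<lambda>c. induced R I (smult R c)),
      component = (\<lambda>n. (\<lambda>x. I +>\<^bsub>R\<^esub> x) ` component R n)\<rparr>"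

definition graded_algebra_iso ::
  "('k, 'v) graded_algebra \<Rightarrow> ('k, 'w) graded_algebra \<Rightarrow> ('v \<Rightarrow> 'w) set" where
  "graded_algebra_iso R S =
     {f \<in> ring_iso R S.
        (\<forall>c. \<forall>x\<in>carrier R. f (c \<odot>\<^bsub>R\<^esub> x) = c \<odot>\<^bsub>S\<^esub> f x) \<and>
        (\<forall>n. f ` component R n = component S n)}"

definition homogeneous_part :: "('k, 'v) graded_algebra \<Rightarrow> 'v \<Rightarrow> nat \<Rightarrow> 'v" where
  "homogeneous_part R a =
     (THE d. (\<forall>n. d n \<in> component R n) \<and> finite {n. d n \<noteq> \<zero>\<^bsub>R\<^esub>} \<and>
             a = (\<Oplus>\<^bsub>R\<^esub>n\<in>{n. d n \<noteq> \<zero>\<^bsub>R\<^esub>}. d n))"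

text \<open>The linear map with \<open>b \<mapsto> (-1)\<^sup>i b\<close> for \<open>b\<close> homogeneous of degree \<open>i\<close>.\<close>

definition sign_map :: "('k::field, 'v) graded_algebra \<Rightarrow> 'v \<Rightarrow> 'v" where
  "sign_map R a =
     (\<Oplus>\<^bsub>R\<^esub>n\<in>{n. homogeneous_part R a n \<noteq> \<zero>\<^bsub>R\<^esub>}. (- 1) ^ n \<odot>\<^bsub>R\<^esub> homogeneous_part R a n)"


section \<open>Graded skew polynomial algebras\<close>

text \<open>
  An element \<open>\<Sum>b\<^sub>i x\<^sup>i\<close> of \<open>B[x,D]\<close> is the finitely supported sequence of its coefficients \<open>b\<^sub>i\<close>. The
  rule \<open>x b = (-1)\<^sup>i b x + D(b)\<close> determines left multiplication by \<open>x\<close> (\<open>skew_shift\<close>), and the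
  product is \<open>(\<Sum>b\<^sub>i x\<^sup>i) Q = \<Sum>b\<^sub>i (x\<^sup>i Q)\<close>.
\<close>

definition skew_shift ::
  "('k::field, 'v) graded_algebra \<Rightarrow> ('v \<Rightarrow> 'v) \<Rightarrow> (nat \<Rightarrow> 'v) \<Rightarrow> nat \<Rightarrow> 'v" where
  "skew_shift B D Q =
     (\<lambda>n. D (Q n) \<oplus>\<^bsub>B\<^esub> (if n = 0 then \<zero>\<^bsub>B\<^esub> else sign_map B (Q (n - 1))))"

definition skew_const :: "('k, 'v) graded_algebra \<Rightarrow> 'v \<Rightarrow> nat \<Rightarrow> 'v" where
  "skew_const B b = (\<lambda>n. if n = 0 then b else \<zero>\<^bsub>B\<^esub>)"

definition skew_var :: "('k, 'v) graded_algebra \<Rightarrow> nat \<Rightarrow> 'v" where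
  "skew_var B = (\<lambda>n. if n = 1 then \<one>\<^bsub>B\<^esub> else \<zero>\<^bsub>B\<^esub>)"

definition skew_poly ::
  "('k::field, 'v) graded_algebra \<Rightarrow> ('v \<Rightarrow> 'v) \<Rightarrow> ('k, nat \<Rightarrow> 'v) graded_algebra" where
  "skew_poly B D =
     \<lparr>carrier = {P. (\<forall>i. P i \<in> carrier B) \<and> finite {i. P i \<noteq> \<zero>\<^bsub>B\<^esub>}},
      mult = (\<lambda>P Q n. \<Oplus>\<^bsub>B\<^esub>i\<in>{i. P i \<noteq> \<zero>\<^bsub>B\<^esub>}. P i \<otimes>\<^bsub>B\<^esub> (skew_shift B D ^^ i) Q n),
      one = skew_const B \<one>\<^bsub>B\<^esub>,
      zero = skew_const B \<zero>\<^bsub>B\<^esub>,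
      add = (\<lambda>P Q n. P n \<oplus>\<^bsub>B\<^esub> Q n),
      smult = (\<lambda>c P n. c \<odot>\<^bsub>B\<^esub> P n),
      component = (\<lambda>n. {P. (\<forall>i\<le>n. P i \<in> component B (n - i)) \<and> (\<forall>i>n. P i = \<zero>\<^bsub>B\<^esub>)})\<rparr>"


section \<open>The Hochschild complex and its cohomology\<close>

text \<open>
  The total cochain space \<open>\<Oplus>\<^sub>n C\<^sup>n(A,M)\<close>: the degree \<open>n\<close> part of \<open>f\<close> is the restriction of \<open>f\<close> to
  lists of length \<open>n\<close>, a multilinear map in \<open>n\<close> arguments (that is, a linear map on the \<open>n\<close>-th tensor
  power of \<open>A\<close>), and almost all of these restrictions vanish.
\<close>

definition multilinear ::
  "('k::field \<Rightarrow> 'a::ab_group_add \<Rightarrow> 'a) \<Rightarrow> ('k \<Rightarrow> 'm::ab_group_add \<Rightarrow> 'm) \<Rightarrow> ('a list \<Rightarrow> 'm) \<Rightarrow> bool"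
where
  "multilinear s t f \<longleftrightarrow> (\<forall>us vs. Vector_Spaces.linear s t (\<lambda>a. f (us @ a # vs)))"

definition cochain_set ::
  "('k::field, 'g, 'a::{ring,monoid_mult}, 'v) module_algebra_data_scheme \<Rightarrow>
   ('k, 'g, 'm::{ring,monoid_mult}, 'a, 'w) bimodule_data_scheme \<Rightarrow> ('a list \<Rightarrow> 'm) set"
where
  "cochain_set A M =
     {f. multilinear (scal A) (scal M) f \<and> (\<exists>N. \<forall>xs. length xs > N \<longrightarrow> f xs = 0)}"

text \<open>
  The multiplication is the cup product
  \<open>(f \<smile> g)(a\<^sub>1,\<dots>,a\<^sub>i\<^sub>+\<^sub>j) = f(a\<^sub>1,\<dots>,a\<^sub>i) g(a\<^sub>i\<^sub>+\<^sub>1,\<dots>,a\<^sub>i\<^sub>+\<^sub>j)\<close> for \<open>f\<close> of degree \<open>i\<close> and \<open>g\<close> of degree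
  \<open>j\<close> (without sign), extended bilinearly.
\<close>

definition cochains ::
  "('k::field, 'g, 'a::{ring,monoid_mult}, 'v) module_algebra_data_scheme \<Rightarrow>
   ('k, 'g, 'm::{ring,monoid_mult}, 'a, 'w) bimodule_data_scheme \<Rightarrow> ('k, 'a list \<Rightarrow> 'm) graded_algebra"
where
  "cochains A M =
     \<lparr>carrier = cochain_set A M,
      mult = (\<lambda>f g xs. \<Sum>i\<le>length xs. f (take i xs) * g (drop i xs)),
      one = (\<lambda>xs. if xs = [] then 1 else 0),
      zero = (\<lambda>xs. 0),
      add = (\<lambda>f g xs. f xs + g xs),
      smult = (\<lambda>c f xs. scal M c (f xs)),
      component = (\<lambda>n. {f \<in> cochain_set A M. \<forall>xs. length xs \<noteq> n \<longrightarrow> f xs = 0})\<rparr>"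

text \<open>
  On \<open>xs = [a\<^sub>1,\<dots>,a\<^sub>n\<^sub>+\<^sub>1]\<close> this is
  \<open>a\<^sub>1 f(a\<^sub>2,\<dots>) + \<Sum>\<^sub>1\<^sub>\<le>\<^sub>i\<^sub>\<le>\<^sub>n (-1)\<^sup>i f(\<dots>,a\<^sub>i a\<^sub>i\<^sub>+\<^sub>1,\<dots>) + (-1)\<^sup>n\<^sup>+\<^sup>1 f(a\<^sub>1,\<dots>,a\<^sub>n) a\<^sub>n\<^sub>+\<^sub>1\<close>;
  list positions start at 0.
\<close>

definition hochschild_diff ::
  "('k::field, 'g, 'm::{ring,monoid_mult}, 'a::{ring,monoid_mult}, 'w) bimodule_data_scheme \<Rightarrow>
   ('a list \<Rightarrow> 'm) \<Rightarrow> 'a list \<Rightarrow> 'm"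
where
  "hochschild_diff M f xs =
     (if xs = [] then 0 else
        lact M (hd xs) (f (tl xs))
        + (\<Sum>i\<in>{1..<length xs}.
             scal M ((- 1) ^ i) (f (take (i - 1) xs @ (xs ! (i - 1) * xs ! i) # drop (i + 1) xs)))
        + scal M ((- 1) ^ length xs) (ract M (f (butlast xs)) (last xs)))"

definition cochain_act ::
  "('g, 'u) monoid_scheme \<Rightarrow> ('k, 'g, 'a, 'v) module_algebra_data_scheme \<Rightarrow>
   ('k, 'g, 'm, 'w) module_algebra_data_scheme \<Rightarrow> 'g \<Rightarrow> ('a list \<Rightarrow> 'm) \<Rightarrow> 'a list \<Rightarrow> 'm"
where
  "cochain_act G A M g f = (\<lambda>xs. act M g (f (map (act A (inv\<^bsub>G\<^esub> g)) xs)))"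

text \<open>The cochains of the complex \<open>C(A,M)\<^sup>G\<close>.\<close>

definition cochains_inv ::
  "('g, 'u) monoid_scheme \<Rightarrow> ('k::field, 'g, 'a::{ring,monoid_mult}, 'v) module_algebra_data_scheme \<Rightarrow>
   ('k, 'g, 'm::{ring,monoid_mult}, 'a, 'w) bimodule_data_scheme \<Rightarrow> ('k, 'a list \<Rightarrow> 'm) graded_algebra"
where
  "cochains_inv G A M =
     graded_sub (cochains A M) (fixed_pts (cochain_act G A M) (carrier G) (carrier (cochains A M)))"

definition cohomology ::
  "('k, 'v) graded_algebra \<Rightarrow> ('v \<Rightarrow> 'v) \<Rightarrow> ('k, 'v set) graded_algebra" where
  "cohomology C d = graded_quot (graded_sub C {f \<in> carrier C. d f = \<zero>\<^bsub>C\<^esub>}) (d ` carrier C)"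

definition HH ::
  "('k::field, 'g, 'a::{ring,monoid_mult}, 'v) module_algebra_data_scheme \<Rightarrow>
   ('k, 'g, 'm::{ring,monoid_mult}, 'a, 'w) bimodule_data_scheme \<Rightarrow>
   ('k, ('a list \<Rightarrow> 'm) set) graded_algebra"
where
  "HH A M = cohomology (cochains A M) (hochschild_diff M)"

text \<open>The class of a cocycle in \<open>HH A M\<close>.\<close>

definition HH_class ::
  "('k::field, 'g, 'a::{ring,monoid_mult}, 'v) module_algebra_data_scheme \<Rightarrow>
   ('k, 'g, 'm::{ring,monoid_mult}, 'a, 'w) bimodule_data_scheme \<Rightarrow>
   ('a list \<Rightarrow> 'm) \<Rightarrow> ('a list \<Rightarrow> 'm) set"
where
  "HH_class A M f = (hochschild_diff M ` carrier (cochains A M)) +>\<^bsub>cochains A M\<^esub> f"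

definition HH_act ::
  "('g, 'u) monoid_scheme \<Rightarrow> ('k, 'g, 'a, 'v) module_algebra_data_scheme \<Rightarrow>
   ('k, 'g, 'm, 'w) module_algebra_data_scheme \<Rightarrow> 'g \<Rightarrow> ('a list \<Rightarrow> 'm) set \<Rightarrow> ('a list \<Rightarrow> 'm) set"
where
  "HH_act G A M g X = cochain_act G A M g ` X"

text \<open>\<open>HH\<^sup>*(A,M)\<^sup>K\<close> for a subgroup \<open>K\<close> of \<open>G\<close>.\<close>

definition HH_inv ::
  "('g, 'u) monoid_scheme \<Rightarrow> 'g set \<Rightarrow> ('k::field, 'g, 'a::{ring,monoid_mult}, 'v) module_algebra_data_scheme \<Rightarrow>
   ('k, 'g, 'm::{ring,monoid_mult}, 'a, 'w) bimodule_data_scheme \<Rightarrow>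
   ('k, ('a list \<Rightarrow> 'm) set) graded_algebra"
where
  "HH_inv G K A M = graded_sub (HH A M) (fixed_pts (HH_act G A M) K (carrier (HH A M)))"

text \<open>\<open>HH\<^sup>*(A,M)\<^sup>G\<^sup>\<up>\<close>, the cohomology of the invariant complex.\<close>

definition HH_up ::
  "('g, 'u) monoid_scheme \<Rightarrow> ('k::field, 'g, 'a::{ring,monoid_mult}, 'v) module_algebra_data_scheme \<Rightarrow>
   ('k, 'g, 'm::{ring,monoid_mult}, 'a, 'w) bimodule_data_scheme \<Rightarrow>
   ('k, ('a list \<Rightarrow> 'm) set) graded_algebra"
where
  "HH_up G A M = cohomology (cochains_inv G A M) (hochschild_diff M)"

definition Theta ::
  "('k::field, 'g, 'a::{ring,monoid_mult}, 'v) module_algebra_data_scheme \<Rightarrow>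
   ('k, 'g, 'm::{ring,monoid_mult}, 'a, 'w) bimodule_data_scheme \<Rightarrow>
   ('a list \<Rightarrow> 'm) set \<Rightarrow> ('a list \<Rightarrow> 'm) set"
where
  "Theta A M = induced (cochains A M) (hochschild_diff M ` carrier (cochains A M)) (\<lambda>f. f)"

definition A_alg ::
  "('g, 'u) monoid_scheme \<Rightarrow> ('k::field, 'g, 'a::{ring,monoid_mult}, 'v) module_algebra_data_scheme \<Rightarrow>
   ('k, 'g, 'm::{ring,monoid_mult}, 'a, 'w) bimodule_data_scheme \<Rightarrow>
   ('k, ('a list \<Rightarrow> 'm) set) graded_algebra"
where
  "A_alg G A M = graded_sub (HH_inv G (carrier G) A M) (Theta A M ` carrier (HH_up G A M))"

definition W_ideal ::
  "('g, 'u) monoid_scheme \<Rightarrow> 'g set \<Rightarrow> 'g set \<Rightarrow> nat \<Rightarrow>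
   ('k::field, 'g, 'a::{ring,monoid_mult}, 'v) module_algebra_data_scheme \<Rightarrow>
   ('k, 'g, 'm::{ring,monoid_mult}, 'a, 'w) bimodule_data_scheme \<Rightarrow> ('a list \<Rightarrow> 'm) set set"
where
  "W_ideal G H \<rho> q A M =
     (Delta (a_minus (HH A M)) (HH_act G A M) \<rho> ^^ (q - 1)) ` carrier (HH_inv G H A M)"

definition A_bar ::
  "('g, 'u) monoid_scheme \<Rightarrow> 'g set \<Rightarrow> 'g set \<Rightarrow> nat \<Rightarrow>
   ('k::field, 'g, 'a::{ring,monoid_mult}, 'v) module_algebra_data_scheme \<Rightarrow>
   ('k, 'g, 'm::{ring,monoid_mult}, 'a, 'w) bimodule_data_scheme \<Rightarrow>
   ('k, ('a list \<Rightarrow> 'm) set set) graded_algebra"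
where
  "A_bar G H \<rho> q A M = graded_quot (A_alg G A M) (W_ideal G H \<rho> q A M)"

text \<open>The class in \<open>HH\<^sup>1(A,M)\<close> of a derivation, viewed as a cochain concentrated in degree 1.\<close>

definition deriv_class ::
  "('k::field, 'g, 'a::{ring,monoid_mult}, 'v) module_algebra_data_scheme \<Rightarrow>
   ('k, 'g, 'm::{ring,monoid_mult}, 'a, 'w) bimodule_data_scheme \<Rightarrow>
   ('a \<Rightarrow> 'm) \<Rightarrow> ('a list \<Rightarrow> 'm) set"
where
  "deriv_class A M h = HH_class A M (\<lambda>xs. if length xs = 1 then h (hd xs) else 0)"

text \<open>The linear extension of \<open>a \<mapsto> h \<smile> a - (-1)\<^sup>i a \<smile> h\<close> for \<open>a\<close> of degree \<open>i\<close>, on \<open>A_alg\<close>.\<close>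

definition D_map ::
  "('g, 'u) monoid_scheme \<Rightarrow> ('k::field, 'g, 'a::{ring,monoid_mult}, 'v) module_algebra_data_scheme \<Rightarrow>
   ('k, 'g, 'm::{ring,monoid_mult}, 'a, 'w) bimodule_data_scheme \<Rightarrow>
   ('a \<Rightarrow> 'm) \<Rightarrow> ('a list \<Rightarrow> 'm) set \<Rightarrow> ('a list \<Rightarrow> 'm) set"
where
  "D_map G A M h a =
     (deriv_class A M h \<otimes>\<^bsub>HH A M\<^esub> a)
     \<ominus>\<^bsub>HH A M\<^esub> (sign_map (A_alg G A M) a \<otimes>\<^bsub>HH A M\<^esub> deriv_class A M h)"

definition D_bar ::
  "('g, 'u) monoid_scheme \<Rightarrow> 'g set \<Rightarrow> 'g set \<Rightarrow> nat \<Rightarrow>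
   ('k::field, 'g, 'a::{ring,monoid_mult}, 'v) module_algebra_data_scheme \<Rightarrow>
   ('k, 'g, 'm::{ring,monoid_mult}, 'a, 'w) bimodule_data_scheme \<Rightarrow>
   ('a \<Rightarrow> 'm) \<Rightarrow> ('a list \<Rightarrow> 'm) set set \<Rightarrow> ('a list \<Rightarrow> 'm) set set"
where
  "D_bar G H \<rho> q A M h = induced (A_alg G A M) (W_ideal G H \<rho> q A M) (D_map G A M h)"

text \<open>The class of \<open>h \<smile> h\<close> in \<open>A_bar\<close>.\<close>

definition h_square ::
  "('g, 'u) monoid_scheme \<Rightarrow> 'g set \<Rightarrow> 'g set \<Rightarrow> nat \<Rightarrow>
   ('k::field, 'g, 'a::{ring,monoid_mult}, 'v) module_algebra_data_scheme \<Rightarrow>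
   ('k, 'g, 'm::{ring,monoid_mult}, 'a, 'w) bimodule_data_scheme \<Rightarrow>
   ('a \<Rightarrow> 'm) \<Rightarrow> ('a list \<Rightarrow> 'm) set set"
where
  "h_square G H \<rho> q A M h =
     W_ideal G H \<rho> q A M +>\<^bsub>A_alg G A M\<^esub> (deriv_class A M h \<otimes>\<^bsub>HH A M\<^esub> deriv_class A M h)"

definition skew_A ::
  "('g, 'u) monoid_scheme \<Rightarrow> 'g set \<Rightarrow> 'g set \<Rightarrow> nat \<Rightarrow>
   ('k::field, 'g, 'a::{ring,monoid_mult}, 'v) module_algebra_data_scheme \<Rightarrow>
   ('k, 'g, 'm::{ring,monoid_mult}, 'a, 'w) bimodule_data_scheme \<Rightarrow>
   ('a \<Rightarrow> 'm) \<Rightarrow> ('k, nat \<Rightarrow> ('a list \<Rightarrow> 'm) set set) graded_algebra"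
where
  "skew_A G H \<rho> q A M h = skew_poly (A_bar G H \<rho> q A M) (D_bar G H \<rho> q A M h)"

text \<open>The element \<open>x\<^sup>2 - h \<smile> h\<close> of \<open>skew_A\<close>.\<close>

definition skew_relation ::
  "('g, 'u) monoid_scheme \<Rightarrow> 'g set \<Rightarrow> 'g set \<Rightarrow> nat \<Rightarrow>
   ('k::field, 'g, 'a::{ring,monoid_mult}, 'v) module_algebra_data_scheme \<Rightarrow>
   ('k, 'g, 'm::{ring,monoid_mult}, 'a, 'w) bimodule_data_scheme \<Rightarrow>
   ('a \<Rightarrow> 'm) \<Rightarrow> nat \<Rightarrow> ('a list \<Rightarrow> 'm) set set"
where
  "skew_relation G H \<rho> q A M h =
     (skew_var (A_bar G H \<rho> q A M) \<otimes>\<^bsub>skew_A G H \<rho> q A M h\<^esub> skew_var (A_bar G H \<rho> q A M))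
     \<ominus>\<^bsub>skew_A G H \<rho> q A M h\<^esub> skew_const (A_bar G H \<rho> q A M) (h_square G H \<rho> q A M h)"

end

theory Submission
  imports Defs "HOL-Algebra.Multiplicative_Group" "HOL-Computational_Algebra.Primes"
    "HOL-Library.Function_Algebras"
begin

text \<open>
  Let \<open>C\<close> be the Hochschild cochain algebra with differential \<open>d\<close>, and let \<open>E\<close> be the algebra of its
  \<open>H\<close>-invariant elements. A representative of \<open>\<rho>\<close> acts on \<open>E\<close> by an automorphism \<open>\<sigma>\<close> with \<open>\<sigma>\<^sup>q = 1\<close>. Put
  \<open>\<Delta> = 1 - \<sigma>\<close>. In characteristic \<open>p\<close>, \<open>\<Delta>\<^sup>q = 0\<close> on \<open>E\<close> and \<open>N = \<Delta>\<^sup>q\<^sup>-\<^sup>1\<close> is the norm \<open>\<Sum> \<sigma>\<^sup>i\<close>. Viewed as cochains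
  of degrees \<open>0\<close> and \<open>1\<close>, the elements \<open>m\<close> and \<open>h\<close> satisfy \<open>N m = 1\<close>, \<open>d m = - \<Delta> h\<close> and \<open>d h = 0\<close>. As
  \<open>|H|\<close> is invertible, averaging identifies the \<open>H\<close>-invariant classes with the cohomology of \<open>E\<close>.

  Because \<open>N m = 1\<close>, multiplication by \<open>m\<close> makes \<open>E\<close> free over the group algebra of the cyclic
  quotient, so that the kernel of \<open>N\<close> is the image of \<open>\<Delta>\<close> (lemma \<open>\<Delta>_kernel\<close>). Take a cocycle \<open>c\<close> in \<open>E\<close>
  with \<open>G\<close>-invariant class, say \<open>\<Delta> c = d y\<close>. Then \<open>b = N y\<close> is an invariant cocycle, and
  \<open>N (y - b m) = 0\<close> gives \<open>y = b m + \<Delta> v\<close>. Inserting this and \<open>d m = - \<Delta> h\<close> shows that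
  \<open>c + sgn b \<cdot> h - d v\<close> is annihilated by \<open>\<Delta>\<close>: the class of \<open>c\<close> lies in \<open>\<A> + \<A> h\<close>, where \<open>\<A>\<close> consists of the
  classes of invariant cocycles (\<open>stable_decomposition\<close>). Running the computation backwards, a
  relation \<open>a + b h \<in> W\<close> exhibits \<open>b\<close> as a norm, and since \<open>W\<close> is an ideal both \<open>a\<close> and \<open>b\<close> lie in
  \<open>W\<close> (\<open>decomposition_unique_modulo_norms\<close>). A class lies in \<open>\<A>\<close> as soon as the element \<open>b\<close> above
  bounds in the invariant complex; this criterion (\<open>invariant_class\<close>) gives \<open>h a - sgn a \<cdot> h \<in> \<A>\<close> for \<open>a \<in> \<A>\<close>
  and \<open>h h \<in> \<A>\<close> (\<open>commutator_in_P\<close>, \<open>square_in_P\<close>).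

  Hence the ring \<open>T\<close> of \<open>G\<close>-invariant classes modulo \<open>W\<close> is \<open>B \<oplus> B y\<close> for the subring \<open>B = \<A>/W\<close> and the
  class \<open>y\<close> of \<open>h\<close>, with \<open>y b = sgn b \<cdot> y + D b\<close> and \<open>y\<^sup>2 = c \<in> B\<close>. For every such ring, comparing
  coefficients shows that \<open>D\<close> is a twisted derivation, so that \<open>B[x,D]\<close> is a ring; evaluation at \<open>y\<close> is a
  surjective homomorphism \<open>B[x,D] \<rightarrow> T\<close>, and division by the monic polynomial \<open>x\<^sup>2 - c\<close> identifies its
  kernel (\<open>quadratic_extension_iso\<close>).

  All algebras here are iterated subalgebras and quotients of \<open>C\<close>, with elements that are cosets of
  cosets. They are handled uniformly as quotients \<open>S/K\<close> with \<open>K \<subseteq> S \<subseteq> C\<close> (\<open>presents\<close>), so that all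
  computations take place with cochains.
\<close>

section \<open>Skew polynomial rings\<close>

text \<open>The identities for the sign map and for \<open>D\<close> that are assumed here are exactly what makes the rule
  \<open>x b = sgn b \<cdot> x + D b\<close> associative. All products below are built from the operator \<open>X\<close>, left
  multiplication by \<open>x\<close>.\<close>

locale graded_skew = ring B for B :: "('k::field, 'v) graded_algebra" (structure) +
  fixes D :: "'v \<Rightarrow> 'v"
  assumes D_closed [simp]: "a \<in> carrier B \<Longrightarrow> D a \<in> carrier B"
    and sgn_closed [simp]: "a \<in> carrier B \<Longrightarrow> sign_map B a \<in> carrier B"
    and D_add: "\<lbrakk>a \<in> carrier B; b \<in> carrier B\<rbrakk> \<Longrightarrow> D (a \<oplus> b) = D a \<oplus> D b"
    and sgn_add: "\<lbrakk>a \<in> carrier B; b \<in> carrier B\<rbrakk> \<Longrightarrow>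
      sign_map B (a \<oplus> b) = sign_map B a \<oplus> sign_map B b"
    and sgn_mult: "\<lbrakk>a \<in> carrier B; b \<in> carrier B\<rbrakk> \<Longrightarrow>
      sign_map B (a \<otimes> b) = sign_map B a \<otimes> sign_map B b"
    and sgn_one [simp]: "sign_map B \<one> = \<one>"
    and D_mult: "\<lbrakk>a \<in> carrier B; b \<in> carrier B\<rbrakk> \<Longrightarrow>
      D (a \<otimes> b) = D a \<otimes> b \<oplus> sign_map B a \<otimes> D b"
begin

abbreviation "X \<equiv> skew_shift B D"
abbreviation "S \<equiv> skew_poly B D"

definition coeffs :: "(nat \<Rightarrow> 'v) \<Rightarrow> bool" where "coeffs P \<longleftrightarrow> (\<forall>i. P i \<in> carrier B)"

definition plus_seq :: "(nat \<Rightarrow> 'v) \<Rightarrow> (nat \<Rightarrow> 'v) \<Rightarrow> nat \<Rightarrow> 'v" where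
  "plus_seq P Q = (\<lambda>n. P n \<oplus> Q n)"

definition lmul :: "'v \<Rightarrow> (nat \<Rightarrow> 'v) \<Rightarrow> nat \<Rightarrow> 'v" where
  "lmul b Q = (\<lambda>n. b \<otimes> Q n)"

definition partial_mult :: "nat \<Rightarrow> (nat \<Rightarrow> 'v) \<Rightarrow> (nat \<Rightarrow> 'v) \<Rightarrow> nat \<Rightarrow> 'v" where
  "partial_mult N P Q = (\<lambda>n. \<Oplus>i\<in>{..<N}. P i \<otimes> (X ^^ i) Q n)"

definition supported :: "nat \<Rightarrow> (nat \<Rightarrow> 'v) \<Rightarrow> bool" where
  "supported N P \<longleftrightarrow> coeffs P \<and> (\<forall>i\<ge>N. P i = \<zero>)"

lemma coeffsD [simp]: "coeffs P \<Longrightarrow> P i \<in> carrier B"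
  by (simp add: coeffs_def)

lemma D_zero [simp]: "D \<zero> = \<zero>"
  using D_add[of \<zero> \<zero>] by (metis D_closed add.l_cancel_one' l_zero zero_closed)

lemma sgn_zero [simp]: "sign_map B \<zero> = \<zero>"
  using sgn_add[of \<zero> \<zero>] by (metis sgn_closed add.l_cancel_one' l_zero zero_closed)

lemma D_one [simp]: "D \<one> = \<zero>"
  using D_mult[of \<one> \<one>] by (metis D_closed add.l_cancel_one' l_one r_one one_closed sgn_one)

lemma coeffs_shift [simp]: "coeffs Q \<Longrightarrow> coeffs (X Q)"
  by (auto simp: coeffs_def skew_shift_def)

lemma coeffs_shift_pow [simp]: "coeffs Q \<Longrightarrow> coeffs ((X ^^ i) Q)"
  by (induction i) auto

lemma coeffs_plus [simp]: "coeffs P \<Longrightarrow> coeffs Q \<Longrightarrow> coeffs (plus_seq P Q)"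
  by (auto simp: coeffs_def plus_seq_def)

lemma coeffs_lmul [simp]: "b \<in> carrier B \<Longrightarrow> coeffs Q \<Longrightarrow> coeffs (lmul b Q)"
  by (auto simp: coeffs_def lmul_def)

lemma supported_coeffs: "supported N P \<Longrightarrow> coeffs P"
  by (simp add: supported_def)

lemma supported_mono: "supported N P \<Longrightarrow> N \<le> N' \<Longrightarrow> supported N' P"
  by (auto simp: supported_def)

lemma supported_shift: "supported N Q \<Longrightarrow> supported (Suc N) (X Q)"
  by (auto simp: supported_def skew_shift_def coeffs_def)

lemma supported_shift_pow: "supported N Q \<Longrightarrow> supported (i + N) ((X ^^ i) Q)"
  by (induction i) (auto intro: supported_shift)

lemma supported_plus: "supported N P \<Longrightarrow> supported N Q \<Longrightarrow> supported N (plus_seq P Q)"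
  by (auto simp: supported_def plus_seq_def coeffs_def)

lemma supported_lmul: "b \<in> carrier B \<Longrightarrow> supported N Q \<Longrightarrow> supported N (lmul b Q)"
  by (auto simp: supported_def lmul_def coeffs_def)

lemma supported_const: "b \<in> carrier B \<Longrightarrow> supported 1 (skew_const B b)"
  by (auto simp: supported_def skew_const_def coeffs_def)

lemma carrier_skew: "P \<in> carrier S \<longleftrightarrow> (\<exists>N. supported N P)"
proof
  assume "P \<in> carrier S"
  then have P: "coeffs P" and fin: "finite {i. P i \<noteq> \<zero>}"
    by (auto simp: skew_poly_def coeffs_def)
  then obtain N where "\<forall>i\<in>{i. P i \<noteq> \<zero>}. i < N"
    unfolding finite_nat_set_iff_bounded by blast
  then have "supported N P" using P unfolding supported_def
    by (metis (mono_tags, lifting) mem_Collect_eq not_less)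
  then show "\<exists>N. supported N P" ..
next
  assume "\<exists>N. supported N P"
  then obtain N where N: "supported N P" ..
  then have "{i. P i \<noteq> \<zero>} \<subseteq> {..<N}"
    unfolding supported_def by (auto simp: not_less[symmetric])
  then have "finite {i. P i \<noteq> \<zero>}" by (rule finite_subset) simp
  then show "P \<in> carrier S" using N
    by (simp add: skew_poly_def supported_def coeffs_def)
qed

lemma skew_add: "P \<oplus>\<^bsub>S\<^esub> Q = plus_seq P Q"
  by (simp add: skew_poly_def plus_seq_def)

lemma skew_one: "\<one>\<^bsub>S\<^esub> = skew_const B \<one>" by (simp add: skew_poly_def)

lemma skew_zero: "\<zero>\<^bsub>S\<^esub> = (\<lambda>n. \<zero>)" by (simp add: skew_poly_def skew_const_def)

lemma skew_smult: "r \<odot>\<^bsub>S\<^esub> P = (\<lambda>n. r \<odot>\<^bsub>B\<^esub> P n)" by (simp add: skew_poly_def)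

lemma skew_component:
  "component S n = {P. (\<forall>i\<le>n. P i \<in> component B (n - i)) \<and> (\<forall>i>n. P i = \<zero>)}"
  by (simp add: skew_poly_def)

lemma finsum_lessThan_Suc:
  "f \<in> UNIV \<rightarrow> carrier B \<Longrightarrow> (\<Oplus>i\<in>{..<Suc N}. f i) = (\<Oplus>i\<in>{..<N}. f i) \<oplus> f N"
  by (simp add: lessThan_Suc finsum_insert Pi_def a_comm)

lemma partial_mult_0 [simp]: "partial_mult 0 P Q = (\<lambda>n. \<zero>)"
  by (simp add: partial_mult_def)

lemma partial_mult_Suc:
  "coeffs P \<Longrightarrow> coeffs Q \<Longrightarrow>
   partial_mult (Suc N) P Q = plus_seq (partial_mult N P Q) (lmul (P N) ((X ^^ N) Q))"
  unfolding partial_mult_def plus_seq_def lmul_def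
  by (rule ext, subst finsum_lessThan_Suc) auto

lemma coeffs_zero [simp]: "coeffs (\<lambda>n. \<zero>)"
  by (simp add: coeffs_def)

lemma coeffs_partial_mult [simp]: "coeffs P \<Longrightarrow> coeffs Q \<Longrightarrow> coeffs (partial_mult N P Q)"
  by (induction N) (auto simp: partial_mult_Suc)

lemma skew_mult_partial:
  assumes "supported N P" "coeffs Q"
  shows "P \<otimes>\<^bsub>S\<^esub> Q = partial_mult N P Q"
proof -
  have P: "coeffs P" and sub: "{i. P i \<noteq> \<zero>} \<subseteq> {..<N}"
    using assms(1) unfolding supported_def by (auto simp: not_less[symmetric])
  have "(\<Oplus>i\<in>{i. P i \<noteq> \<zero>}. P i \<otimes> (X ^^ i) Q n) = (\<Oplus>i\<in>{..<N}. P i \<otimes> (X ^^ i) Q n)" for n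
    by (rule add.finprod_mono_neutral_cong_left) (use P sub assms(2) in \<open>auto simp: Pi_def\<close>)
  then show ?thesis by (simp add: skew_poly_def partial_mult_def)
qed

lemma plus_seq_assoc:
  "coeffs P \<Longrightarrow> coeffs Q \<Longrightarrow> coeffs R \<Longrightarrow>
   plus_seq (plus_seq P Q) R = plus_seq P (plus_seq Q R)"
  by (simp add: plus_seq_def a_assoc)

lemma plus_seq_comm: "coeffs P \<Longrightarrow> coeffs Q \<Longrightarrow> plus_seq P Q = plus_seq Q P"
  by (simp add: plus_seq_def a_comm)

lemma plus_seq_left_comm:
  "coeffs P \<Longrightarrow> coeffs Q \<Longrightarrow> coeffs R \<Longrightarrow>
   plus_seq P (plus_seq Q R) = plus_seq Q (plus_seq P R)"
  by (simp add: plus_seq_def a_lcomm)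

lemmas plus_seq_ac = plus_seq_assoc plus_seq_comm plus_seq_left_comm

lemma plus_seq_zero [simp]: "coeffs P \<Longrightarrow> plus_seq P (\<lambda>n. \<zero>) = P"
    "coeffs P \<Longrightarrow> plus_seq (\<lambda>n. \<zero>) P = P"
  by (simp_all add: plus_seq_def)

lemma lmul_plus:
  "b \<in> carrier B \<Longrightarrow> coeffs P \<Longrightarrow> coeffs Q \<Longrightarrow>
   lmul b (plus_seq P Q) = plus_seq (lmul b P) (lmul b Q)"
  by (simp add: plus_seq_def lmul_def r_distr)

lemma lmul_add:
  "b \<in> carrier B \<Longrightarrow> c \<in> carrier B \<Longrightarrow> coeffs P \<Longrightarrow>
   lmul (b \<oplus> c) P = plus_seq (lmul b P) (lmul c P)"
  by (simp add: plus_seq_def lmul_def l_distr)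

lemma lmul_lmul:
  "b \<in> carrier B \<Longrightarrow> c \<in> carrier B \<Longrightarrow> coeffs P \<Longrightarrow> lmul b (lmul c P) = lmul (b \<otimes> c) P"
  by (simp add: lmul_def m_assoc)

lemma lmul_simps [simp]:
  "b \<in> carrier B \<Longrightarrow> lmul b (\<lambda>n. \<zero>) = (\<lambda>n. \<zero>)"
  "coeffs P \<Longrightarrow> lmul \<zero> P = (\<lambda>n. \<zero>)"
  "coeffs P \<Longrightarrow> lmul \<one> P = P"
  by (simp_all add: lmul_def)

lemma shift_plus:
  "coeffs P \<Longrightarrow> coeffs Q \<Longrightarrow> X (plus_seq P Q) = plus_seq (X P) (X Q)"
  by (rule ext) (simp add: skew_shift_def plus_seq_def D_add sgn_add a_ac)

lemma shift_pow_plus: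
  "coeffs P \<Longrightarrow> coeffs Q \<Longrightarrow> (X ^^ i) (plus_seq P Q) = plus_seq ((X ^^ i) P) ((X ^^ i) Q)"
  by (induction i) (auto simp: shift_plus)

lemma shift_zero [simp]: "X (\<lambda>n. \<zero>) = (\<lambda>n. \<zero>)"
  by (rule ext) (simp add: skew_shift_def)

text \<open>This is the rule \<open>x b = (-1)\<^sup>i b x + D(b)\<close>, read as an identity of operators on sequences.\<close>

lemma shift_lmul:
  "b \<in> carrier B \<Longrightarrow> coeffs Q \<Longrightarrow>
   X (lmul b Q) = plus_seq (lmul (D b) Q) (lmul (sign_map B b) (X Q))"
  by (rule ext) (simp add: skew_shift_def plus_seq_def lmul_def D_mult sgn_mult r_distr a_assoc)

text \<open>Left multiplication by \<open>x\<close> raises the degree by one, so \<open>X P\<close> has to be truncated one step later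
  than \<open>P\<close>. The extra term in \<open>D (P N)\<close> vanishes once \<open>N\<close> exceeds the degree of \<open>P\<close>.\<close>

lemma partial_mult_shift:
  assumes "coeffs P" "coeffs Q"
  shows "partial_mult (Suc N) (X P) Q
    = plus_seq (X (partial_mult N P Q)) (lmul (D (P N)) ((X ^^ N) Q))"
proof (induction N)
  case 0
  then show ?case using assms
    by (simp add: partial_mult_Suc) (simp add: skew_shift_def lmul_def plus_seq_def)
next
  case (Suc N)
  have XP: "X P (Suc N) = D (P (Suc N)) \<oplus> sign_map B (P N)"
    by (simp add: skew_shift_def)
  show ?case
    using assms
    by (simp add: partial_mult_Suc[of "X P" Q "Suc N"] Suc XP partial_mult_Suc[of P Q N]
        shift_plus shift_lmul lmul_add plus_seq_ac)
qed

lemma supported_carrier: "supported N P \<Longrightarrow> P \<in> carrier S"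
  using carrier_skew by blast

lemma carrier_coeffs [simp]: "P \<in> carrier S \<Longrightarrow> coeffs P"
  using carrier_skew supported_coeffs by blast

lemma skew_mult_coeffs [simp]: "P \<in> carrier S \<Longrightarrow> coeffs Q \<Longrightarrow> coeffs (P \<otimes>\<^bsub>S\<^esub> Q)"
  using carrier_skew by (metis carrier_coeffs coeffs_partial_mult skew_mult_partial)

lemma carrier_shift [simp]: "P \<in> carrier S \<Longrightarrow> X P \<in> carrier S"
  using carrier_skew supported_shift by blast

lemma carrier_shift_pow [simp]: "P \<in> carrier S \<Longrightarrow> (X ^^ i) P \<in> carrier S"
  by (induction i) auto

lemma carrier_lmul [simp]: "b \<in> carrier B \<Longrightarrow> P \<in> carrier S \<Longrightarrow> lmul b P \<in> carrier S"
  using carrier_skew supported_lmul by blast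

lemma common_support:
  assumes "P \<in> carrier S" "Q \<in> carrier S"
  obtains N where "supported N P" "supported N Q"
proof -
  obtain i j where "supported i P" "supported j Q" using assms carrier_skew by blast
  then show thesis by (intro that[of "max i j"]) (auto intro: supported_mono)
qed

lemma carrier_plus [simp]: "P \<in> carrier S \<Longrightarrow> Q \<in> carrier S \<Longrightarrow> plus_seq P Q \<in> carrier S"
  by (meson carrier_skew common_support supported_plus)

lemma carrier_zero [simp]: "(\<lambda>n. \<zero>) \<in> carrier S"
  unfolding carrier_skew by (auto simp: supported_def)

lemma carrier_const [simp]: "b \<in> carrier B \<Longrightarrow> skew_const B b \<in> carrier S"
  unfolding carrier_skew using supported_const by blast

lemma carrier_partial_mult:
  "coeffs P \<Longrightarrow> Q \<in> carrier S \<Longrightarrow> partial_mult N P Q \<in> carrier S"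
  by (induction N) (auto simp: partial_mult_Suc)

lemma carrier_mult [simp]: "P \<in> carrier S \<Longrightarrow> Q \<in> carrier S \<Longrightarrow> P \<otimes>\<^bsub>S\<^esub> Q \<in> carrier S"
  by (metis carrier_coeffs carrier_partial_mult carrier_skew skew_mult_partial)

lemma skew_mult_shift:
  assumes "P \<in> carrier S" "coeffs Q"
  shows "X P \<otimes>\<^bsub>S\<^esub> Q = X (P \<otimes>\<^bsub>S\<^esub> Q)"
proof -
  obtain N where N: "supported N P" using assms carrier_skew by blast
  then have "P N = \<zero>" by (simp add: supported_def)
  then show ?thesis
    using N assms partial_mult_shift[of P Q N]
    by (simp add: skew_mult_partial[OF N] skew_mult_partial[OF supported_shift[OF N]])
qed

lemma skew_mult_shift_pow:
  "P \<in> carrier S \<Longrightarrow> coeffs Q \<Longrightarrow> (X ^^ i) P \<otimes>\<^bsub>S\<^esub> Q = (X ^^ i) (P \<otimes>\<^bsub>S\<^esub> Q)"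
  by (induction i) (auto simp: skew_mult_shift)

lemma partial_mult_plus:
  "coeffs P \<Longrightarrow> coeffs P' \<Longrightarrow> coeffs Q \<Longrightarrow>
   partial_mult N (plus_seq P P') Q = plus_seq (partial_mult N P Q) (partial_mult N P' Q)"
proof (induction N)
  case (Suc N)
  have "plus_seq P P' N = P N \<oplus> P' N" by (simp add: plus_seq_def)
  then show ?case using Suc by (simp add: partial_mult_Suc plus_seq_ac lmul_add)
qed simp

lemma partial_mult_lmul:
  "b \<in> carrier B \<Longrightarrow> coeffs P \<Longrightarrow> coeffs Q \<Longrightarrow>
   partial_mult N (lmul b P) Q = lmul b (partial_mult N P Q)"
proof (induction N)
  case (Suc N)
  have "lmul b P N = b \<otimes> P N" by (simp add: lmul_def)
  then show ?case using Suc by (simp add: partial_mult_Suc lmul_plus lmul_lmul)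
qed simp

lemma partial_mult_plus_right:
  "coeffs P \<Longrightarrow> coeffs Q \<Longrightarrow> coeffs Q' \<Longrightarrow>
   partial_mult N P (plus_seq Q Q') = plus_seq (partial_mult N P Q) (partial_mult N P Q')"
  by (induction N) (simp_all add: partial_mult_Suc shift_pow_plus lmul_plus plus_seq_ac)

lemma skew_mult_plus:
  assumes "P \<in> carrier S" "P' \<in> carrier S" "coeffs Q"
  shows "plus_seq P P' \<otimes>\<^bsub>S\<^esub> Q = plus_seq (P \<otimes>\<^bsub>S\<^esub> Q) (P' \<otimes>\<^bsub>S\<^esub> Q)"
proof -
  obtain N where "supported N P" "supported N P'" using assms common_support by metis
  then show ?thesis
    using assms by (simp add: skew_mult_partial[of N] supported_plus partial_mult_plus)
qed

lemma skew_mult_lmul: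
  assumes "P \<in> carrier S" "coeffs Q" "b \<in> carrier B"
  shows "lmul b P \<otimes>\<^bsub>S\<^esub> Q = lmul b (P \<otimes>\<^bsub>S\<^esub> Q)"
proof -
  obtain N where "supported N P" using assms carrier_skew by metis
  then show ?thesis
    using assms by (simp add: skew_mult_partial[of N] supported_lmul partial_mult_lmul)
qed

lemma skew_mult_plus_right:
  assumes "P \<in> carrier S" "coeffs Q" "coeffs Q'"
  shows "P \<otimes>\<^bsub>S\<^esub> plus_seq Q Q' = plus_seq (P \<otimes>\<^bsub>S\<^esub> Q) (P \<otimes>\<^bsub>S\<^esub> Q')"
proof -
  obtain N where "supported N P" using assms carrier_skew by metis
  then show ?thesis
    using assms by (simp add: skew_mult_partial partial_mult_plus_right)
qed

lemma zero_mult: "coeffs Q \<Longrightarrow> (\<lambda>n. \<zero>) \<otimes>\<^bsub>S\<^esub> Q = (\<lambda>n. \<zero>)"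
  using skew_mult_partial[of 0 "\<lambda>n. \<zero>" Q] by (simp add: supported_def)

text \<open>Both sides are additive in \<open>P\<close> and compatible with multiplying \<open>P\<close> from the left by
  elements of \<open>B\<close> and by \<open>x\<close>, and these operations generate all skew polynomials.\<close>

lemma skew_mult_assoc:
  assumes P: "P \<in> carrier S" and Q: "Q \<in> carrier S" and R: "coeffs R"
  shows "(P \<otimes>\<^bsub>S\<^esub> Q) \<otimes>\<^bsub>S\<^esub> R = P \<otimes>\<^bsub>S\<^esub> (Q \<otimes>\<^bsub>S\<^esub> R)"
proof -
  have "partial_mult N P Q \<otimes>\<^bsub>S\<^esub> R = partial_mult N P (Q \<otimes>\<^bsub>S\<^esub> R)" for N
    using assms
    by (induction N)
      (simp_all add: zero_mult partial_mult_Suc skew_mult_plus skew_mult_lmul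
        skew_mult_shift_pow carrier_partial_mult)
  moreover obtain N where "supported N P" using P carrier_skew by blast
  ultimately show ?thesis using assms by (simp add: skew_mult_partial)
qed

lemma const_mult: "b \<in> carrier B \<Longrightarrow> coeffs Q \<Longrightarrow> skew_const B b \<otimes>\<^bsub>S\<^esub> Q = lmul b Q"
proof -
  assume b: "b \<in> carrier B" and Q: "coeffs Q"
  have "skew_const B b 0 = b" by (simp add: skew_const_def)
  then show ?thesis
    using skew_mult_partial[OF supported_const[OF b] Q] partial_mult_Suc[of "skew_const B b" Q 0] b Q
    by simp
qed

lemma shift_pow_one: "(X ^^ i) (skew_const B \<one>) = (\<lambda>n. if n = i then \<one> else \<zero>)"
  by (induction i) (auto simp: skew_const_def skew_shift_def fun_eq_iff)

lemma mult_one: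
  assumes "P \<in> carrier S"
  shows "P \<otimes>\<^bsub>S\<^esub> skew_const B \<one> = P"
proof -
  obtain N where N: "supported N P" using assms carrier_skew by blast
  have "partial_mult N P (skew_const B \<one>) = (\<lambda>n. if n < N then P n else \<zero>)" for N
    using assms
    by (induction N) (auto simp: partial_mult_Suc shift_pow_one plus_seq_def lmul_def fun_eq_iff less_Suc_eq)
  then show ?thesis using N by (auto simp: skew_mult_partial supported_def fun_eq_iff)
qed

theorem skew_ring: "ring S"
proof (rule ringI)
  show "abelian_group S"
  proof (rule abelian_groupI)
    fix P assume P: "P \<in> carrier S"
    have "(\<lambda>n. \<ominus> P n) \<in> carrier S"
      using P unfolding carrier_skew by (auto simp: supported_def coeffs_def)
    moreover have "(\<lambda>n. \<ominus> P n) \<oplus>\<^bsub>S\<^esub> P = \<zero>\<^bsub>S\<^esub>"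
      using P by (simp add: skew_add plus_seq_def skew_zero l_neg)
    ultimately show "\<exists>Q\<in>carrier S. Q \<oplus>\<^bsub>S\<^esub> P = \<zero>\<^bsub>S\<^esub>" by blast
  qed (auto simp: skew_add skew_zero plus_seq_ac)
  show "Group.monoid S"
    by (rule monoidI) (auto simp: skew_one const_mult mult_one skew_mult_assoc)
qed (auto simp: skew_add skew_mult_plus skew_mult_plus_right)

end

section \<open>Adjoining an element with a monic quadratic relation\<close>

lemma graded_quot_smult:
  "r \<odot>\<^bsub>graded_quot R I\<^esub> Y = (\<Union>x\<in>Y. I +>\<^bsub>R\<^esub> (r \<odot>\<^bsub>R\<^esub> x))"
  by (simp add: graded_quot_def induced_def)

lemma graded_quot_component:
  "component (graded_quot R I) n = (\<lambda>x. I +>\<^bsub>R\<^esub> x) ` component R n"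
  by (simp add: graded_quot_def)

text \<open>The ring \<open>T\<close> contains \<open>B\<close> (as a graded algebra with the same operations) and is free as a left
  \<open>B\<close>-module on \<open>1\<close> and \<open>y\<close>. The assumptions on components say that this decomposition is
  compatible with the grading, \<open>y\<close> being of degree \<open>1\<close>.\<close>

locale quadratic_extension = ring T for T :: "('k::field, 'v) graded_algebra" (structure) +
  fixes B :: "('k, 'v) graded_algebra" and y c :: 'v and D :: "'v \<Rightarrow> 'v"
  assumes same_ops: "monoid.mult B = monoid.mult T" "ring.add B = ring.add T" "monoid.one B = monoid.one T"
      "ring.zero B = ring.zero T"
      "smult B = smult T"
    and ring_B: "ring B" and sub: "carrier B \<subseteq> carrier T"
    and y_closed [simp]: "y \<in> carrier T" and c_closed: "c \<in> carrier B"
    and sign_closed: "a \<in> carrier B \<Longrightarrow> sign_map B a \<in> carrier B"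
    and deriv_closed: "a \<in> carrier B \<Longrightarrow> D a \<in> carrier B"
    and commutation: "a \<in> carrier B \<Longrightarrow> y \<otimes> a = sign_map B a \<otimes> y \<oplus> D a"
    and square: "y \<otimes> y = c"
    and span: "t \<in> carrier T \<Longrightarrow> \<exists>a\<in>carrier B. \<exists>b\<in>carrier B. t = a \<oplus> b \<otimes> y"
    and free: "\<lbrakk>a \<in> carrier B; b \<in> carrier B; a \<oplus> b \<otimes> y = \<zero>\<rbrakk> \<Longrightarrow> a = \<zero> \<and> b = \<zero>"
    and smult_closed [simp]: "x \<in> carrier T \<Longrightarrow> r \<odot>\<^bsub>T\<^esub> x \<in> carrier T"
    and smult_closed_B: "x \<in> carrier B \<Longrightarrow> r \<odot>\<^bsub>T\<^esub> x \<in> carrier B"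
    and smult_add: "\<lbrakk>x \<in> carrier T; x' \<in> carrier T\<rbrakk> \<Longrightarrow>
      r \<odot>\<^bsub>T\<^esub> (x \<oplus> x') = r \<odot>\<^bsub>T\<^esub> x \<oplus> r \<odot>\<^bsub>T\<^esub> x'"
    and smult_mult: "\<lbrakk>x \<in> carrier T; x' \<in> carrier T\<rbrakk> \<Longrightarrow>
      r \<odot>\<^bsub>T\<^esub> (x \<otimes> x') = (r \<odot>\<^bsub>T\<^esub> x) \<otimes> x'"
    and comp_carrier: "component T n \<subseteq> carrier T"
    and comp_B: "component B n \<subseteq> component T n \<inter> carrier B"
    and comp_zero: "\<zero> \<in> component B n"
    and comp_add: "\<lbrakk>x \<in> component T n; x' \<in> component T n\<rbrakk> \<Longrightarrow> x \<oplus> x' \<in> component T n"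
    and comp_y: "x \<in> component T n \<Longrightarrow> x \<otimes> y \<in> component T (Suc n)"
    and comp_span: "x \<in> component T n \<Longrightarrow> \<exists>a\<in>component B n. \<exists>b.
      x = a \<oplus> b \<otimes> y \<and> (case n of 0 \<Rightarrow> b = \<zero> | Suc k \<Rightarrow> b \<in> component B k)"
begin

abbreviation "sg \<equiv> sign_map B"

lemma in_T [simp]: "a \<in> carrier B \<Longrightarrow> a \<in> carrier T"
  using sub by blast

lemma B_closed [simp]:
  "a \<in> carrier B \<Longrightarrow> b \<in> carrier B \<Longrightarrow> a \<otimes> b \<in> carrier B"
  "a \<in> carrier B \<Longrightarrow> b \<in> carrier B \<Longrightarrow> a \<oplus> b \<in> carrier B"
  "\<one> \<in> carrier B" "\<zero> \<in> carrier B"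
  using ring.ring_simprules(1,5,6)[OF ring_B] ring.ring_simprules(2)[OF ring_B]
  by (simp_all add: same_ops)

lemma B_inv [simp]: "a \<in> carrier B \<Longrightarrow> \<ominus> a \<in> carrier B"
proof -
  assume a: "a \<in> carrier B"
  then have "(\<ominus>\<^bsub>B\<^esub> a) \<oplus> a = \<zero>" and "\<ominus>\<^bsub>B\<^esub> a \<in> carrier B"
    using ring.ring_simprules(9,3)[OF ring_B, of a] by (simp_all add: same_ops)
  then show ?thesis using a by (metis in_T minus_equality)
qed

lemma decomposition_unique:
  assumes "a \<in> carrier B" "b \<in> carrier B" "a' \<in> carrier B" "b' \<in> carrier B"
    and "a \<oplus> b \<otimes> y = a' \<oplus> b' \<otimes> y"
  shows "a = a'" "b = b'"
proof -
  have "(a \<oplus> \<ominus> a') \<oplus> (b \<oplus> \<ominus> b') \<otimes> y = (a \<oplus> b \<otimes> y) \<oplus> \<ominus> (a' \<oplus> b' \<otimes> y)"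
    using assms(1-4) by (simp add: l_distr l_minus minus_add a_ac)
  also have "\<dots> = \<zero>" using assms by (simp add: r_neg)
  finally have "a \<oplus> \<ominus> a' = \<zero> \<and> b \<oplus> \<ominus> b' = \<zero>"
    using assms(1-4) by (intro free) auto
  then show "a = a'" "b = b'"
    using assms(1-4) minus_equality[of a "\<ominus> a'"] minus_equality[of b "\<ominus> b'"]
    by (simp_all add: minus_minus)
qed

text \<open>Multiplying \<open>y\<close> by sums and products in \<open>B\<close> and comparing coefficients shows that the
  two coefficient maps of \<open>y a = sg a y + D a\<close> have the properties that make
  \<open>B[x,D]\<close> associative.\<close>

sublocale B: graded_skew B D
proof -
  interpret B: ring B by (rule ring_B)
  note [simp] = sign_closed deriv_closed
  have sum: "sg (a \<oplus> b) = sg a \<oplus> sg b" "D (a \<oplus> b) = D a \<oplus> D b"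
    if ab: "a \<in> carrier B" "b \<in> carrier B" for a b
  proof -
    have "D (a \<oplus> b) \<oplus> sg (a \<oplus> b) \<otimes> y = y \<otimes> (a \<oplus> b)"
      using ab by (simp add: commutation a_comm)
    also have "\<dots> = (D a \<oplus> D b) \<oplus> (sg a \<oplus> sg b) \<otimes> y"
      using ab by (simp add: r_distr l_distr commutation a_ac)
    finally show "sg (a \<oplus> b) = sg a \<oplus> sg b" "D (a \<oplus> b) = D a \<oplus> D b"
      using ab decomposition_unique[of "D (a \<oplus> b)" "sg (a \<oplus> b)" "D a \<oplus> D b" "sg a \<oplus> sg b"]
      by auto
  qed
  have prod: "sg (a \<otimes> b) = sg a \<otimes> sg b" "D (a \<otimes> b) = D a \<otimes> b \<oplus> sg a \<otimes> D b"
    if ab: "a \<in> carrier B" "b \<in> carrier B" for a b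
  proof -
    have "D (a \<otimes> b) \<oplus> sg (a \<otimes> b) \<otimes> y = y \<otimes> (a \<otimes> b)"
      using ab by (simp add: commutation a_comm)
    also have "\<dots> = (y \<otimes> a) \<otimes> b" using ab by (simp add: m_assoc)
    also have "\<dots> = sg a \<otimes> (y \<otimes> b) \<oplus> D a \<otimes> b"
      using ab by (simp add: commutation[of a] l_distr m_assoc)
    also have "\<dots> = (D a \<otimes> b \<oplus> sg a \<otimes> D b) \<oplus> (sg a \<otimes> sg b) \<otimes> y"
      using ab by (simp add: commutation[of b] r_distr m_assoc a_ac)
    finally show "sg (a \<otimes> b) = sg a \<otimes> sg b" "D (a \<otimes> b) = D a \<otimes> b \<oplus> sg a \<otimes> D b"
      using ab decomposition_unique[of "D (a \<otimes> b)" "sg (a \<otimes> b)"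
          "D a \<otimes> b \<oplus> sg a \<otimes> D b" "sg a \<otimes> sg b"]
      by auto
  qed
  have "D \<one> \<oplus> sg \<one> \<otimes> y = \<zero> \<oplus> \<one> \<otimes> y"
    using commutation[of \<one>] by (simp add: a_comm)
  then have "sg \<one> = \<one>"
    using decomposition_unique[of "D \<one>" "sg \<one>" \<zero> \<one>] by auto
  then show "graded_skew B D"
    by unfold_locales (simp_all add: same_ops sum prod)
qed

definition ev :: "(nat \<Rightarrow> 'v) \<Rightarrow> 'v" where
  "ev P = (\<Oplus>i\<in>{i. P i \<noteq> \<zero>}. P i \<otimes> y [^] i)"

definition partial_ev :: "nat \<Rightarrow> (nat \<Rightarrow> 'v) \<Rightarrow> 'v" where
  "partial_ev N P = (\<Oplus>i\<in>{..<N}. P i \<otimes> y [^] i)"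

lemma partial_ev_0 [simp]: "partial_ev 0 P = \<zero>"
  by (simp add: partial_ev_def)

lemma partial_ev_Suc: "B.coeffs P \<Longrightarrow> partial_ev (Suc N) P = partial_ev N P \<oplus> P N \<otimes> y [^] N"
  by (simp add: partial_ev_def lessThan_Suc finsum_insert Pi_def a_comm)

lemma partial_ev_closed [simp]: "B.coeffs P \<Longrightarrow> partial_ev N P \<in> carrier T"
  by (induction N) (simp_all add: partial_ev_Suc)

lemma ev_partial:
  assumes "B.supported N P" shows "ev P = partial_ev N P"
proof -
  have P: "B.coeffs P" and sub: "{i. P i \<noteq> \<zero>} \<subseteq> {..<N}"
    using assms(1) unfolding B.supported_def by (auto simp: not_less[symmetric] same_ops)
  show ?thesis unfolding ev_def partial_ev_def
    by (rule add.finprod_mono_neutral_cong_left) (use P sub in \<open>auto simp: Pi_def\<close>)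
qed

lemma ev_closed [simp]: "P \<in> carrier B.S \<Longrightarrow> ev P \<in> carrier T"
  by (metis B.carrier_coeffs B.carrier_skew ev_partial partial_ev_closed)

lemma ev_plus:
  assumes "P \<in> carrier B.S" "Q \<in> carrier B.S"
  shows "ev (B.plus_seq P Q) = ev P \<oplus> ev Q"
proof -
  obtain N where N: "B.supported N P" "B.supported N Q"
    using assms B.common_support by metis
  have "partial_ev N (B.plus_seq P Q) = partial_ev N P \<oplus> partial_ev N Q" for N
  proof (induction N)
    case (Suc N)
    have "B.plus_seq P Q N = P N \<oplus> Q N" by (simp add: B.plus_seq_def same_ops)
    then show ?case using Suc assms by (simp add: partial_ev_Suc l_distr a_ac)
  qed simp
  then show ?thesis using N by (simp add: ev_partial[of N] B.supported_plus)
qed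

lemma ev_lmul:
  assumes "P \<in> carrier B.S" "b \<in> carrier B"
  shows "ev (B.lmul b P) = b \<otimes> ev P"
proof -
  obtain N where N: "B.supported N P" using assms B.carrier_skew by metis
  have "partial_ev N (B.lmul b P) = b \<otimes> partial_ev N P" for N
  proof (induction N)
    case (Suc N)
    have "B.lmul b P N = b \<otimes> P N" by (simp add: B.lmul_def same_ops)
    then show ?case using Suc assms by (simp add: partial_ev_Suc r_distr m_assoc)
  qed (use assms in simp)
  then show ?thesis using N assms by (simp add: ev_partial[of N] B.supported_lmul)
qed

lemma y_pow_Suc: "y \<otimes> y [^] (n::nat) = y [^] Suc n"
  by (simp add: nat_pow_Suc2[symmetric] del: nat_pow_Suc)

lemma ev_shift:
  assumes "P \<in> carrier B.S"
  shows "ev (B.X P) = y \<otimes> ev P"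
proof -
  obtain N where N: "B.supported N P" using assms B.carrier_skew by metis
  have c [simp]: "B.coeffs P" using assms by simp
  have "partial_ev (Suc N) (B.X P) = y \<otimes> partial_ev N P \<oplus> D (P N) \<otimes> y [^] N" for N
  proof (induction N)
    case 0
    show ?case by (simp add: partial_ev_Suc) (simp add: skew_shift_def same_ops)
  next
    case (Suc N)
    have X: "B.X P (Suc N) = D (P (Suc N)) \<oplus> sg (P N)"
      by (simp add: skew_shift_def same_ops)
    have "y \<otimes> (P N \<otimes> y [^] N) = sg (P N) \<otimes> y [^] Suc N \<oplus> D (P N) \<otimes> y [^] N"
      by (simp add: m_assoc[symmetric] commutation l_distr del: nat_pow_Suc)
        (simp add: m_assoc y_pow_Suc del: nat_pow_Suc)
    then show ?case
      by (simp add: partial_ev_Suc[of "B.X P" "Suc N"] Suc X partial_ev_Suc[of P N]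
          l_distr r_distr a_ac del: nat_pow_Suc)
  qed
  moreover have "P N = \<zero>" using N by (simp add: B.supported_def same_ops)
  ultimately show ?thesis
    using N B.D_zero by (simp add: ev_partial[of N] ev_partial[of "Suc N"] B.supported_shift same_ops)
qed

lemma ev_shift_pow:
  "P \<in> carrier B.S \<Longrightarrow> ev ((B.X ^^ i) P) = y [^] i \<otimes> ev P"
proof (induction i)
  case (Suc i)
  then have "ev ((B.X ^^ Suc i) P) = (y \<otimes> y [^] i) \<otimes> ev P"
    by (simp add: ev_shift m_assoc)
  then show ?case by (simp add: y_pow_Suc)
qed simp

text \<open>Evaluation at \<open>y\<close> turns \<open>X\<close> into multiplication by \<open>y\<close>, and the product of skew polynomials is
  determined by \<open>X\<close> and multiplication with coefficients.\<close>

lemma ev_mult: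
  assumes "P \<in> carrier B.S" "Q \<in> carrier B.S"
  shows "ev (P \<otimes>\<^bsub>B.S\<^esub> Q) = ev P \<otimes> ev Q"
proof -
  have "ev (\<lambda>n. \<zero>) = \<zero>" by (simp add: ev_def)
  then have "ev (B.partial_mult N P Q) = partial_ev N P \<otimes> ev Q" for N
    using assms
    by (induction N)
      (simp_all add: same_ops B.partial_mult_Suc ev_plus ev_lmul ev_shift_pow
        B.carrier_partial_mult partial_ev_Suc l_distr m_assoc)
  moreover obtain N where "B.supported N P" using assms B.carrier_skew by blast
  ultimately show ?thesis using assms by (simp add: B.skew_mult_partial ev_partial)
qed

lemma ev_const: "b \<in> carrier B \<Longrightarrow> ev (skew_const B b) = b"
  using ev_partial[OF B.supported_const, of b]
  by (simp add: partial_ev_Suc) (simp add: skew_const_def)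

lemma ev_smult:
  assumes "P \<in> carrier B.S"
  shows "ev (r \<odot>\<^bsub>B.S\<^esub> P) = r \<odot>\<^bsub>T\<^esub> ev P"
proof -
  have rzero: "r \<odot>\<^bsub>T\<^esub> \<zero> = \<zero>"
    using smult_mult[of \<zero> \<zero> r] by simp
  obtain N where N: "B.supported N P" using assms B.carrier_skew by metis
  have eq: "r \<odot>\<^bsub>B.S\<^esub> P = (\<lambda>n. r \<odot>\<^bsub>T\<^esub> P n)" by (simp add: B.skew_smult same_ops)
  have supp: "B.supported N (\<lambda>n. r \<odot>\<^bsub>T\<^esub> P n)"
    using N by (auto simp: B.supported_def same_ops rzero B.coeffs_def smult_closed_B)
  have "partial_ev N (\<lambda>n. r \<odot>\<^bsub>T\<^esub> P n) = r \<odot>\<^bsub>T\<^esub> partial_ev N P" for N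
    using assms B.supported_coeffs[OF supp]
    by (induction N) (simp_all add: rzero partial_ev_Suc smult_add smult_mult)
  then show ?thesis using N supp by (simp add: eq ev_partial[of N])
qed

lemma ev_ring_hom: "ring_hom_ring B.S T ev"
proof (rule ring_hom_ringI2)
  show "ring B.S" by (rule B.skew_ring)
  show "ring T" by (rule ring_axioms)
  show "ev \<in> ring_hom B.S T"
    using ev_const[of \<one>]
    by (auto simp: ring_hom_def B.skew_add ev_plus ev_mult B.skew_one same_ops)
qed

definition relation :: "nat \<Rightarrow> 'v" where
  "relation = (skew_var B \<otimes>\<^bsub>B.S\<^esub> skew_var B) \<ominus>\<^bsub>B.S\<^esub> skew_const B c"

lemma skew_var_eq: "skew_var B = B.X (skew_const B \<one>)"
  using B.shift_pow_one[of 1] by (simp add: skew_var_def same_ops)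

lemma skew_var_square: "skew_var B \<otimes>\<^bsub>B.S\<^esub> skew_var B = (B.X ^^ 2) (skew_const B \<one>)"
  using B.const_mult[OF B.one_closed, of "B.X (skew_const B \<one>)"]
    B.skew_mult_shift[of "skew_const B \<one>" "B.X (skew_const B \<one>)"]
    B.lmul_simps(3)[of "B.X (skew_const B \<one>)"]
  by (simp add: skew_var_eq numeral_2_eq_2 same_ops)

lemma relation_closed: "relation \<in> carrier B.S"
proof -
  interpret S: ring B.S by (rule B.skew_ring)
  show ?thesis unfolding relation_def
    by (intro S.minus_closed) (simp_all add: skew_var_eq c_closed)
qed

lemma relation_plus:
  "(B.X ^^ 2) (skew_const B \<one>\<^bsub>B\<^esub>) = B.plus_seq relation (skew_const B c)"
proof -
  interpret S: ring B.S by (rule B.skew_ring)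
  let ?Y = "(B.X ^^ 2) (skew_const B \<one>\<^bsub>B\<^esub>)" and ?c = "skew_const B c"
  have "?Y \<in> carrier B.S" "?c \<in> carrier B.S"
    using c_closed by (simp_all add: B.carrier_shift_pow)
  then have "(?Y \<ominus>\<^bsub>B.S\<^esub> ?c) \<oplus>\<^bsub>B.S\<^esub> ?c = ?Y"
    by (simp add: a_minus_def S.a_assoc S.l_neg)
  then show ?thesis by (simp add: relation_def skew_var_square B.skew_add same_ops)
qed

lemma ev_relation: "ev relation = \<zero>"
proof -
  interpret ev: ring_hom_ring B.S T ev by (rule ev_ring_hom)
  show ?thesis
    unfolding relation_def a_minus_def
    by (simp add: c_closed skew_var_eq ev_shift ev_const ev_mult square r_neg)
qed

text \<open>This is division with remainder by the monic polynomial \<open>x\<^sup>2 - c\<close>; the leading term \<open>b x\<^sup>k\<^sup>+\<^sup>2\<close> is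
  removed by subtracting \<open>b x\<^sup>k (x\<^sup>2 - c)\<close>, whose other terms have degree at most \<open>k\<close>, as \<open>X\<close> raises
  the degree by at most one.\<close>

lemma reduce_modulo_relation:
  assumes I: "ideal I B.S" and rel: "relation \<in> I"
  shows "B.supported N P \<Longrightarrow> \<exists>V R. V \<in> I \<and> B.supported 2 R \<and> P = B.plus_seq V R"
proof (induction N arbitrary: P)
  case 0
  interpret I: ideal I B.S by (rule I)
  have "B.supported 2 P" "B.coeffs P"
    using 0 B.supported_mono[of 0 P 2] B.supported_coeffs by auto
  moreover have "(\<lambda>n. \<zero>\<^bsub>B\<^esub>) \<in> I" unfolding B.skew_zero[symmetric] by simp
  ultimately show ?case by (metis B.plus_seq_zero(2))
next
  case (Suc N)
  interpret I: ideal I B.S by (rule I)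
  have P: "B.coeffs P" using Suc.prems B.supported_coeffs by blast
  show ?case
  proof (cases "N < 2")
    case True
    then have "B.supported 2 P" using Suc.prems B.supported_mono[of "Suc N" P 2] by simp
    moreover have "(\<lambda>n. \<zero>\<^bsub>B\<^esub>) \<in> I" unfolding B.skew_zero[symmetric] by simp
    ultimately show ?thesis using P by (metis B.plus_seq_zero(2))
  next
    case False
    then obtain k where k: "N = k + 2" by (metis add.commute le_Suc_ex not_less)
    define b where "b = P N"
    have b: "b \<in> carrier B" using P by (simp add: b_def)
    \<comment> \<open>\<open>P = P' + b x\<^sup>k\<^sup>+\<^sup>2\<close>, and \<open>b x\<^sup>k\<^sup>+\<^sup>2 = U + C\<close> with \<open>U\<close> in the ideal and \<open>C\<close> of degree at most \<open>k\<close>\<close>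
    define U where "U = B.lmul b ((B.X ^^ k) relation)"
    define C where "C = B.lmul b ((B.X ^^ k) (skew_const B c))"
    define P' where "P' = (\<lambda>n. if n < N then P n else \<zero>)"
    have U_I: "U \<in> I"
    proof -
      have "U = skew_const B b \<otimes>\<^bsub>B.S\<^esub> ((B.X ^^ k) \<one>\<^bsub>B.S\<^esub> \<otimes>\<^bsub>B.S\<^esub> relation)"
        using b relation_closed unfolding U_def
        by (simp add: B.const_mult B.skew_mult_shift_pow)
      also have "\<dots> \<in> I" using b
        by (intro I.I_l_closed rel) auto
      finally show ?thesis .
    qed
    have U: "B.coeffs U" using U_I I.Icarr B.carrier_coeffs by blast
    have C: "B.supported N C"
      using B.supported_lmul[OF b B.supported_shift_pow[OF B.supported_const[OF c_closed], of k]]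
      by (auto simp: C_def k intro: B.supported_mono)
    have P': "B.supported N P'" using Suc.prems by (auto simp: P'_def B.supported_def B.coeffs_def same_ops)
    have cs: "B.coeffs C" "B.coeffs P'" using C P' B.supported_coeffs by auto
    have "B.lmul b ((B.X ^^ N) (skew_const B \<one>\<^bsub>B\<^esub>)) = B.plus_seq U C"
    proof -
      have "(B.X ^^ N) (skew_const B \<one>\<^bsub>B\<^esub>) = (B.X ^^ k) (B.plus_seq relation (skew_const B c))"
        by (simp only: k funpow_add comp_apply relation_plus)
      also have "\<dots> = B.plus_seq ((B.X ^^ k) relation) ((B.X ^^ k) (skew_const B c))"
        using relation_closed c_closed by (simp add: B.shift_pow_plus)
      finally show ?thesis
        using relation_closed c_closed b by (simp add: B.lmul_plus U_def C_def)
    qed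
    moreover have "P = B.plus_seq P' (B.lmul b ((B.X ^^ N) (skew_const B \<one>\<^bsub>B\<^esub>)))"
    proof (rule ext)
      fix n
      have "P n = \<zero>" if "n > N"
        using Suc.prems that unfolding B.supported_def by (simp add: same_ops)
      then show "P n = B.plus_seq P' (B.lmul b ((B.X ^^ N) (skew_const B \<one>\<^bsub>B\<^esub>))) n"
        unfolding B.shift_pow_one using P b
        by (cases n N rule: linorder_cases)
          (simp_all add: B.plus_seq_def B.lmul_def P'_def same_ops b_def)
    qed
    ultimately have P_eq: "P = B.plus_seq P' (B.plus_seq U C)" by simp
    obtain V R where VR: "V \<in> I" "B.supported 2 R" "B.plus_seq P' C = B.plus_seq V R"
      using Suc.IH[OF B.supported_plus[OF P' C]] by blast
    have cs': "B.coeffs V" "B.coeffs R"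
      using VR I.Icarr B.carrier_coeffs B.supported_coeffs by blast+
    have "P = B.plus_seq U (B.plus_seq P' C)"
      using cs U P_eq by (metis B.plus_seq_left_comm)
    also have "\<dots> = B.plus_seq (B.plus_seq U V) R"
      using U cs' VR(3) by (simp add: B.plus_seq_assoc)
    finally have "P = B.plus_seq (B.plus_seq U V) R" .
    moreover have "B.plus_seq U V \<in> I"
      using additive_subgroup.a_closed[OF I.additive_subgroup_axioms U_I VR(1)] by (simp add: B.skew_add)
    ultimately show ?thesis using VR(2) by blast
  qed
qed

text \<open>The remainder \<open>a + b x\<close> of a polynomial in the kernel evaluates to \<open>a + b y = 0\<close>, hence vanishes
  because \<open>1\<close> and \<open>y\<close> are independent over \<open>B\<close>.\<close>

lemma kernel_ev: "a_kernel B.S T ev = Idl\<^bsub>B.S\<^esub> {relation}"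
proof -
  interpret S: ring B.S by (rule B.skew_ring)
  interpret ev: ring_hom_ring B.S T ev by (rule ev_ring_hom)
  let ?J = "Idl\<^bsub>B.S\<^esub> {relation}"
  have J: "ideal ?J B.S" using relation_closed by (intro S.genideal_ideal) auto
  have rel: "relation \<in> ?J" using relation_closed by (rule S.genideal_self')
  have "?J \<subseteq> a_kernel B.S T ev"
  proof (rule S.genideal_minimal[OF ev.kernel_is_ideal])
    show "{relation} \<subseteq> a_kernel B.S T ev"
      unfolding a_kernel_def' using relation_closed ev_relation by blast
  qed
  moreover have "P \<in> ?J" if P: "P \<in> carrier B.S" "ev P = \<zero>" for P
  proof -
    interpret J: ideal ?J B.S by (rule J)
    obtain N where "B.supported N P" using P B.carrier_skew by blast
    then obtain V R where VR: "V \<in> ?J" "B.supported 2 R" "P = B.plus_seq V R"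
      using reduce_modulo_relation[OF J rel] by blast
    have R: "R \<in> carrier B.S" and V: "V \<in> carrier B.S"
      using VR B.supported_carrier J.Icarr by auto
    have cR: "R i \<in> carrier B" for i using R by simp
    have "ev V = \<zero>"
      using VR(1) \<open>?J \<subseteq> _\<close> unfolding a_kernel_def' by blast
    then have "ev R = \<zero>" using P VR(3) R V by (simp add: ev_plus)
    moreover have "ev R = R 0 \<oplus> R 1 \<otimes> y"
      using ev_partial[OF VR(2)] R by (simp add: numeral_2_eq_2 partial_ev_Suc)
    ultimately have "R 0 = \<zero> \<and> R 1 = \<zero>" using free[of "R 0" "R 1"] cR by simp
    then have "R i = \<zero>" for i
      using VR(2) by (cases "i = 0 \<or> i = 1") (auto simp: B.supported_def same_ops)
    then have "R = (\<lambda>n. \<zero>\<^bsub>B\<^esub>)" by (auto simp: same_ops)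
    then have "P = V" using VR(3) V by (simp add: B.plus_seq_zero(1))
    then show ?thesis using VR(1) by simp
  qed
  ultimately show ?thesis unfolding a_kernel_def' by blast
qed

lemma ev_binomial:
  assumes "a \<in> carrier B" "b \<in> carrier B"
  shows "ev (\<lambda>i. if i = 0 then a else if i = 1 then b else \<zero>) = a \<oplus> b \<otimes> y"
    and "(\<lambda>i. if i = 0 then a else if i = 1 then b else \<zero>) \<in> carrier B.S"
proof -
  have s: "B.supported 2 (\<lambda>i. if i = 0 then a else if i = 1 then b else \<zero>)"
    using assms by (auto simp: B.supported_def B.coeffs_def same_ops)
  show "ev (\<lambda>i. if i = 0 then a else if i = 1 then b else \<zero>) = a \<oplus> b \<otimes> y"
    using ev_partial[OF s] B.supported_coeffs[OF s] assms
    by (simp add: numeral_2_eq_2 partial_ev_Suc)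
  show "(\<lambda>i. if i = 0 then a else if i = 1 then b else \<zero>) \<in> carrier B.S"
    using s by (rule B.supported_carrier)
qed

text \<open>Homogeneous elements of \<open>T\<close> are values of polynomials of degree at most one with homogeneous
  coefficients, so the isomorphism induced by evaluation is graded.\<close>

lemma ev_component: "ev ` component B.S n = component T n"
proof (rule subset_antisym; rule subsetI)
  fix t assume "t \<in> ev ` component B.S n"
  then obtain P where P: "P \<in> component B.S n" and t: "t = ev P" by blast
  have comp: "P i \<in> component B (n - i)" if "i \<le> n" for i
    using P that by (simp add: B.skew_component)
  have zero: "P i = \<zero>" if "i > n" for i
    using P that by (simp add: B.skew_component same_ops)
  have cP: "B.coeffs P" unfolding B.coeffs_def
  proof
    fix i show "P i \<in> carrier B"
      using comp[of i] zero[of i] comp_B by (cases "i \<le> n") auto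
  qed
  have supp: "B.supported (Suc n) P" using cP zero by (auto simp: B.supported_def same_ops)
  have pow: "x \<otimes> y [^] i \<in> component T (k + i)" if "x \<in> component T k" for x i k
    using that comp_carrier[of k]
    by (induction i) (auto simp: m_assoc[symmetric] intro!: comp_y)
  have "partial_ev N P \<in> component T n" if "N \<le> Suc n" for N
    using that
  proof (induction N)
    case 0 show ?case using comp_zero comp_B by auto
  next
    case (Suc N)
    have "P N \<otimes> y [^] N \<in> component T ((n - N) + N)"
      using comp[of N] comp_B Suc.prems by (intro pow) auto
    then show ?case using Suc cP by (auto simp: partial_ev_Suc intro!: comp_add)
  qed
  then show "t \<in> component T n" using supp by (simp add: t ev_partial)
next
  fix t assume t: "t \<in> component T n"
  then obtain a b where ab: "a \<in> component B n" "t = a \<oplus> b \<otimes> y"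
    "case n of 0 \<Rightarrow> b = \<zero> | Suc k \<Rightarrow> b \<in> component B k"
    using comp_span by blast
  have b: "b \<in> carrier B" using ab(3) comp_B by (auto split: nat.splits)
  have 1: "(\<lambda>i. if i = 0 then a else if i = 1 then b else \<zero>) \<in> component B.S n"
    using ab comp_zero by (auto simp: B.skew_component same_ops split: nat.splits)
  have 2: "ev (\<lambda>i. if i = 0 then a else if i = 1 then b else \<zero>) = t"
    using ab comp_B b by (subst ev_binomial) auto
  show "t \<in> ev ` component B.S n" using imageI[OF 1, of ev] unfolding 2 .
qed

lemma ev_surj: "ev ` carrier B.S = carrier T"
proof (rule subset_antisym; rule subsetI)
  fix t assume "t \<in> carrier T"
  then obtain a b where ab: "a \<in> carrier B" "b \<in> carrier B" and t: "t = a \<oplus> b \<otimes> y"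
    using span by blast
  show "t \<in> ev ` carrier B.S"
    unfolding t ev_binomial(1)[OF ab, symmetric] by (rule imageI[OF ev_binomial(2)[OF ab]])
qed auto

lemma skew_smult_closed:
  assumes "P \<in> carrier B.S"
  shows "r \<odot>\<^bsub>B.S\<^esub> P \<in> carrier B.S"
proof -
  obtain N where N: "B.supported N P" using assms B.carrier_skew by blast
  have "r \<odot>\<^bsub>T\<^esub> \<zero> = \<zero>" using smult_mult[of \<zero> \<zero> r] by simp
  then have "B.supported N (r \<odot>\<^bsub>B.S\<^esub> P)"
    using N by (auto simp: B.skew_smult B.supported_def B.coeffs_def same_ops smult_closed_B)
  then show ?thesis by (rule B.supported_carrier)
qed

lemma skew_component_closed: "component B.S n \<subseteq> carrier B.S"
proof
  fix P assume "P \<in> component B.S n"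
  then have "P i \<in> carrier B \<and> (i > n \<longrightarrow> P i = \<zero>)" for i
    using comp_B by (cases "i \<le> n") (auto simp: B.skew_component same_ops)
  then have "B.supported (Suc n) P" by (auto simp: B.supported_def B.coeffs_def same_ops)
  then show "P \<in> carrier B.S" by (rule B.supported_carrier)
qed

theorem quadratic_extension_iso:
  "\<exists>f. f \<in> graded_algebra_iso T (graded_quot B.S (Idl\<^bsub>B.S\<^esub> {relation}))"
proof -
  interpret ev: ring_hom_ring B.S T ev by (rule ev_ring_hom)
  let ?J = "Idl\<^bsub>B.S\<^esub> {relation}"
  let ?Q = "graded_quot B.S ?J"
  let ?g = "\<lambda>Y. the_elem (ev ` Y)"
  let ?cl = "\<lambda>P. ?J +>\<^bsub>B.S\<^esub> P"
  interpret J: ideal ?J B.S using ev.kernel_is_ideal by (simp add: kernel_ev)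
  have g_cl: "?g (?cl P) = ev P" if "P \<in> carrier B.S" for P
    using ev.the_elem_simp[OF that] by (simp add: kernel_ev)
  have Q: "carrier ?Q = carrier (B.S Quot ?J)" "monoid.mult ?Q = monoid.mult (B.S Quot ?J)"
    "monoid.one ?Q = monoid.one (B.S Quot ?J)" "ring.add ?Q = ring.add (B.S Quot ?J)"
    by (simp_all add: graded_quot_def)
  have carrier_Q: "carrier ?Q = ?cl ` carrier B.S"
    by (auto simp: Q FactRing_simps)
  have iso: "?g \<in> ring_iso (B.S Quot ?J) T"
    using ev.FactRing_iso_set[OF ev_surj] by (simp add: kernel_ev)
  define f where "f = inv_into (carrier (B.S Quot ?J)) ?g"
  have inj: "inj_on ?g (carrier ?Q)" using iso by (simp add: ring_iso_def bij_betw_def Q)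
  have f_iso: "f \<in> ring_iso T (B.S Quot ?J)"
    unfolding f_def by (rule ring_iso_set_sym[OF J.quotient_is_ring iso])
  then have "f \<in> ring_iso T ?Q" by (auto simp: ring_iso_def ring_hom_def Q)
  moreover have f_ev: "f (ev P) = ?cl P" if P: "P \<in> carrier B.S" for P
  proof -
    have "?cl P \<in> carrier ?Q" unfolding carrier_Q using P by (rule imageI)
    from inv_into_f_f[OF inj this] show ?thesis
      unfolding f_def Q(1)[symmetric] g_cl[OF P] .
  qed
  have smult_Q: "r \<odot>\<^bsub>?Q\<^esub> ?cl P = ?cl (r \<odot>\<^bsub>B.S\<^esub> P)" and rP: "r \<odot>\<^bsub>B.S\<^esub> P \<in> carrier B.S"
    if P: "P \<in> carrier B.S" for r P
  proof -
    note closed = skew_smult_closed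
    show "r \<odot>\<^bsub>B.S\<^esub> P \<in> carrier B.S" using P by (rule closed)
    have same: "?cl (r \<odot>\<^bsub>B.S\<^esub> P') = ?cl (r \<odot>\<^bsub>B.S\<^esub> P)" if P': "P' \<in> ?cl P" for P'
    proof -
      have P'c: "P' \<in> carrier B.S" by (rule J.a_elemrcos_carrier[OF P P'])
      have "?cl P = ?cl P'" by (rule J.a_repr_independence'[OF P' P])
      then have "ev P' = ev P" using g_cl[OF P] g_cl[OF P'c] by metis
      then have "ev (r \<odot>\<^bsub>B.S\<^esub> P') = ev (r \<odot>\<^bsub>B.S\<^esub> P)" using P P'c by (simp add: ev_smult)
      then have "f (ev (r \<odot>\<^bsub>B.S\<^esub> P')) = f (ev (r \<odot>\<^bsub>B.S\<^esub> P))" by (rule arg_cong)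
      then show ?thesis unfolding f_ev[OF closed[OF P]] f_ev[OF closed[OF P'c]] .
    qed
    have "P \<in> ?cl P" using P by (rule J.a_rcos_self)
    then show "r \<odot>\<^bsub>?Q\<^esub> ?cl P = ?cl (r \<odot>\<^bsub>B.S\<^esub> P)"
      unfolding graded_quot_smult by (intro SUP_eq_const same) blast+
  qed
  have "f (r \<odot>\<^bsub>T\<^esub> t) = r \<odot>\<^bsub>?Q\<^esub> f t" if "t \<in> carrier T" for r t
  proof -
    have "t \<in> ev ` carrier B.S" unfolding ev_surj by (rule that)
    then obtain P where P: "P \<in> carrier B.S" "t = ev P" by (rule imageE)
    have "f (r \<odot>\<^bsub>T\<^esub> t) = f (ev (r \<odot>\<^bsub>B.S\<^esub> P))" unfolding P(2) ev_smult[OF P(1)] ..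
    then show ?thesis unfolding P(2) f_ev[OF rP[OF P(1)]] f_ev[OF P(1)] smult_Q[OF P(1)] .
  qed
  moreover have "f ` component T n = component ?Q n" for n
  proof -
    have "f ` component T n = (\<lambda>P. f (ev P)) ` component B.S n"
      unfolding ev_component[symmetric] image_image ..
    also have "\<dots> = ?cl ` component B.S n"
      by (rule image_cong[OF refl]) (use f_ev skew_component_closed in blast)
    finally show ?thesis unfolding graded_quot_component .
  qed
  ultimately show ?thesis unfolding graded_algebra_iso_def by blast
qed

end

section \<open>Cyclic operators in prime characteristic\<close>

text \<open>Modulo \<open>p\<close>, the row \<open>q\<close> of Pascal's triangle vanishes in its interior, so the signs in the
  row above it alternate.\<close>

lemma alternating_binomial_char:
  assumes p: "prime p" "CHAR('k::field) = p" and q: "q = p ^ r"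
  shows "i < q \<Longrightarrow> (- 1) ^ i * of_nat (q - 1 choose i) = (1::'k)"
proof (induction i)
  case (Suc i)
  have "p dvd (q choose Suc i)"
  proof (rule ccontr)
    assume "\<not> p dvd (q choose Suc i)"
    then have "coprime q (q choose Suc i)"
      using p(1) q by (simp add: prime_imp_coprime)
    moreover have "Suc i * (q choose Suc i) = q * (q - 1 choose i)"
      using Suc_times_binomial_eq[of "q - 1" i] Suc.prems by (simp add: mult.commute)
    then have "q dvd Suc i * (q choose Suc i)" by (metis dvd_triv_left)
    ultimately have "q dvd Suc i" using coprime_dvd_mult_left_iff by blast
    then show False using Suc.prems dvd_imp_le by fastforce
  qed
  then have "of_nat (q choose Suc i) = (0::'k)"
    using p(2) by (simp add: of_nat_eq_0_iff_char_dvd)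
  moreover have "q choose Suc i = (q - 1 choose i) + (q - 1 choose Suc i)"
    using Suc.prems binomial_Suc_Suc[of "q - 1" i] by simp
  ultimately have "of_nat (q - 1 choose Suc i) = - (of_nat (q - 1 choose i) :: 'k)"
    by (simp add: eq_neg_iff_add_eq_0 add.commute)
  then show ?case using Suc by simp
qed simp

text \<open>In characteristic \<open>p\<close>, the binomial coefficients in the powers of \<open>\<Delta> = 1 - \<sigma>\<close> with exponents
  \<open>q - 1\<close> and \<open>q\<close> disappear: these powers are \<open>\<Sum> \<sigma>\<^sup>i\<close> and \<open>1 - \<sigma>\<^sup>q\<close>.\<close>

locale char_p_operator = vector_space scl for scl :: "'k::field \<Rightarrow> 'r::ab_group_add \<Rightarrow> 'r" +
  fixes \<sigma> :: "'r \<Rightarrow> 'r"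
  assumes \<sigma>_add: "\<sigma> (x + y) = \<sigma> x + \<sigma> y" and \<sigma>_scl: "\<sigma> (scl c x) = scl c (\<sigma> x)"
begin

definition \<Delta> :: "'r \<Rightarrow> 'r" where "\<Delta> x = x - \<sigma> x"

sublocale \<sigma>: additive \<sigma>
  by unfold_locales (rule \<sigma>_add)

sublocale \<Delta>: additive \<Delta>
  by unfold_locales (simp add: \<Delta>_def \<sigma>_add)

sublocale \<Delta>_pow: additive "\<Delta> ^^ n" for n
proof
  show "(\<Delta> ^^ n) (x + y) = (\<Delta> ^^ n) x + (\<Delta> ^^ n) y" for x y
    by (induction n) (simp_all add: \<Delta>.add)
qed

declare \<sigma>.zero [simp] \<Delta>.zero [simp] \<Delta>_pow.zero [simp]

lemma \<Delta>_power_binomial: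
  "(\<Delta> ^^ n) x = (\<Sum>i\<le>n. scl ((- 1) ^ i * of_nat (n choose i)) ((\<sigma> ^^ i) x))"
proof (induction n)
  case (Suc n)
  define f where "f n i = scl ((- 1) ^ i * of_nat (n choose i)) ((\<sigma> ^^ i) x)" for n i
  have \<sigma>_f: "f (Suc n) (Suc i) = f n (Suc i) - \<sigma> (f n i)" for i
    by (simp add: f_def \<sigma>_scl algebra_simps scale_left_distrib scale_minus_left)
  have "(\<Sum>i\<le>Suc n. f (Suc n) i) = f (Suc n) 0 + (\<Sum>i\<le>n. f n (Suc i)) - (\<Sum>i\<le>n. \<sigma> (f n i))"
    by (simp add: sum.atMost_Suc_shift \<sigma>_f sum_subtractf del: sum.atMost_Suc)
  also have "f (Suc n) 0 + (\<Sum>i\<le>n. f n (Suc i)) = (\<Sum>i\<le>Suc n. f n i)"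
    by (simp only: sum.atMost_Suc_shift) (simp add: f_def)
  also have "\<dots> = (\<Sum>i\<le>n. f n i)" by (simp add: f_def binomial_eq_0)
  finally show ?case using Suc by (simp add: f_def[symmetric] \<Delta>_def \<sigma>.sum del: sum.atMost_Suc)
qed simp

lemma \<Delta>_power_norm:
  assumes "prime p" "CHAR('k) = p" "q = p ^ r"
  shows "(\<Delta> ^^ (q - 1)) x = (\<Sum>i<q. (\<sigma> ^^ i) x)"
proof -
  have q: "q > 0" using assms prime_gt_0_nat by simp
  then have set: "{..q - 1} = {..<q}" by auto
  show ?thesis
    unfolding \<Delta>_power_binomial set
    by (rule sum.cong) (use alternating_binomial_char[OF assms] in auto)
qed

lemma \<Delta>_power_char:
  assumes "prime p" "CHAR('k) = p" "q = p ^ r"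
  shows "(\<Delta> ^^ q) x = x - (\<sigma> ^^ q) x"
proof -
  have "q > 0" using assms prime_gt_0_nat by simp
  then have "(\<Delta> ^^ q) x = \<Delta> ((\<Delta> ^^ (q - 1)) x)" by (cases q) auto
  also have "\<dots> = (\<Sum>i<q. (\<sigma> ^^ i) x) - (\<Sum>i<q. (\<sigma> ^^ Suc i) x)"
    unfolding \<Delta>_power_norm[OF assms] by (simp add: \<Delta>_def \<sigma>.sum)
  also have "\<dots> = x - (\<sigma> ^^ q) x"
    using sum_lessThan_telescope'[of "\<lambda>i. (\<sigma> ^^ i) x" q] by (simp add: sum_subtractf)
  finally show ?thesis .
qed

end

section \<open>Cyclic quotients of finite groups\<close>

text \<open>A representative of a generator of the quotient generates \<open>G\<close> together with \<open>H\<close>. This reduces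
  invariance under \<open>G\<close> to invariance under \<open>H\<close> and a single element.\<close>

lemma cyclic_quotient_decomposition:
  fixes G (structure)
  assumes "group G" "finite (carrier G)" "H \<lhd> G"
    and "\<rho> \<in> carrier (G Mod H)" "generate (G Mod H) {\<rho>} = carrier (G Mod H)"
    and g0: "g0 \<in> \<rho>"
  shows "g0 \<in> carrier G" "\<rho> = H #> g0" "g0 [^] order (G Mod H) \<in> H"
    "g \<in> carrier G \<Longrightarrow> \<exists>i::nat. \<exists>x\<in>H. g = x \<otimes> g0 [^] i"
proof -
  interpret group G by fact
  interpret H: normal H G by fact
  interpret Q: group "G Mod H" by (rule H.factorgroup_is_group)
  have fin: "finite (carrier (G Mod H))"
    using assms(2) by (simp add: FactGroup_def RCOSETS_def)
  obtain a where a: "a \<in> carrier G" "\<rho> = H #> a"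
    using assms(4) by (auto simp: FactGroup_def RCOSETS_def)
  show g0G: "g0 \<in> carrier G"
    using g0 a H.elemrcos_carrier[OF is_group a(1)] by auto
  show rho: "\<rho> = H #> g0"
    using repr_independence[OF _ a(1) H.subgroup_axioms] g0 a by simp
  have pow: "\<rho> [^]\<^bsub>G Mod H\<^esub> i = H #> (g0 [^] i)" for i :: nat
  proof (induction i)
    case 0
    then show ?case by (simp add: coset_mult_one[OF H.subset])
  next
    case (Suc i)
    then show ?case using g0G by (simp add: rho H.rcos_sum)
  qed
  have "H #> (g0 [^] order (G Mod H)) = H"
    using Q.pow_order_eq_1[OF assms(4)] by (simp add: pow)
  then show "g0 [^] order (G Mod H) \<in> H"
    using rcos_self[OF nat_pow_closed[OF g0G] H.subgroup_axioms] by metis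
  show "\<exists>i::nat. \<exists>x\<in>H. g = x \<otimes> g0 [^] i" if g: "g \<in> carrier G"
  proof -
    have "H #> g \<in> generate (G Mod H) {\<rho>}"
      unfolding assms(5) using g by (auto simp: FactGroup_def RCOSETS_def)
    then obtain i :: nat where "H #> g = H #> (g0 [^] i)"
      using Q.generate_pow_on_finite_carrier[OF fin assms(4)] pow by auto
    then have "g \<in> H #> (g0 [^] i)"
      using rcos_self[OF g H.subgroup_axioms] by simp
    then show ?thesis by (auto simp: r_coset_def)
  qed
qed

section \<open>Degenerated differential graded algebras\<close>

text \<open>A differential graded algebra on a subspace \<open>C\<close> of a type. Elements need not be homogeneous: the
  grading is given by the projections \<open>pr n\<close> to the homogeneous parts, and the map \<open>s\<close> with
  \<open>s a = (-1)\<^sup>i a\<close> in degree \<open>i\<close> supplies the signs. The product is an explicit operation since the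
  elements will be functions, for which \<open>*\<close> is the pointwise product.\<close>

locale dg_algebra = vector_space scl for scl :: "'k::field \<Rightarrow> 'r::ab_group_add \<Rightarrow> 'r" +
  fixes mul :: "'r \<Rightarrow> 'r \<Rightarrow> 'r" (infixl "\<star>" 70) and u :: 'r and C :: "'r set"
    and d s :: "'r \<Rightarrow> 'r" and pr :: "nat \<Rightarrow> 'r \<Rightarrow> 'r"
  assumes mul_assoc: "(x \<star> y) \<star> z = x \<star> (y \<star> z)"
    and mul_add_left: "(x + y) \<star> z = x \<star> z + y \<star> z"
    and mul_add_right: "x \<star> (y + z) = x \<star> y + x \<star> z"
    and one_mul [simp]: "u \<star> x = x" and mul_one [simp]: "x \<star> u = x"
    and scl_mul_left: "scl c x \<star> y = scl c (x \<star> y)"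
    and scl_mul_right: "x \<star> scl c y = scl c (x \<star> y)"
    and C_add [simp]: "\<lbrakk>x \<in> C; y \<in> C\<rbrakk> \<Longrightarrow> x + y \<in> C"
    and C_mul [simp]: "\<lbrakk>x \<in> C; y \<in> C\<rbrakk> \<Longrightarrow> x \<star> y \<in> C"
    and C_one [simp]: "u \<in> C"
    and C_scl [simp]: "x \<in> C \<Longrightarrow> scl c x \<in> C"
    and C_d [simp]: "x \<in> C \<Longrightarrow> d x \<in> C"
    and C_s [simp]: "x \<in> C \<Longrightarrow> s x \<in> C"
    and C_pr [simp]: "x \<in> C \<Longrightarrow> pr n x \<in> C"
    and d_add: "d (x + y) = d x + d y"
    and d_scl: "d (scl c x) = scl c (d x)"
    and d_d [simp]: "d (d x) = 0"
    and d_mul: "d (x \<star> y) = d x \<star> y + s x \<star> d y"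
    and s_add: "s (x + y) = s x + s y"
    and s_scl: "s (scl c x) = scl c (s x)"
    and s_s [simp]: "s (s x) = x"
    and s_mul: "s (x \<star> y) = s x \<star> s y"
    and d_s: "d (s x) = - s (d x)"
    and pr_add: "pr n (x + y) = pr n x + pr n y"
    and pr_scl: "pr n (scl c x) = scl c (pr n x)"
    and pr_d_Suc: "pr (Suc n) (d x) = d (pr n x)" and pr_d_0: "pr 0 (d x) = 0"
    and pr_one: "pr n u \<in> {0, u}"
    and pr_pr: "pr i (pr j x) = (if i = j then pr j x else 0)"
    and pr_finite: "x \<in> C \<Longrightarrow> \<exists>N. (\<forall>n\<ge>N. pr n x = 0) \<and> x = (\<Sum>n<N. pr n x)"
    and s_pr: "s (pr n x) = scl ((- 1) ^ n) (pr n x)"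
begin

sublocale mul_left: additive "\<lambda>x. x \<star> y" for y
  by unfold_locales (rule mul_add_left)

sublocale mul_right: additive "\<lambda>y. x \<star> y" for x
  by unfold_locales (rule mul_add_right)

sublocale d: additive d
  by unfold_locales (rule d_add)

sublocale s: additive s
  by unfold_locales (rule s_add)

sublocale pr: additive "pr n" for n
  by unfold_locales (rule pr_add)

declare mul_left.zero [simp] mul_right.zero [simp] d.zero [simp] s.zero [simp] pr.zero [simp]

lemma C_zero [simp]: "0 \<in> C"
  using C_scl[OF C_one, of 0] by simp

lemma C_minus [simp]: "x \<in> C \<Longrightarrow> - x \<in> C"
  using C_scl[of x "- 1"] by simp

lemma C_diff [simp]: "\<lbrakk>x \<in> C; y \<in> C\<rbrakk> \<Longrightarrow> x - y \<in> C"
  using C_add[of x "- y"] by simp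

lemmas mul_distribs = mul_add_left mul_add_right mul_left.diff mul_right.diff
  mul_left.minus mul_right.minus

lemma s_one [simp]: "s u = u"
  using s_mul[of u "s u"] by simp

lemma d_one [simp]: "d u = 0"
  using d_mul[of u u] by simp

definition "cocycles = {x \<in> C. d x = 0}"
definition "boundaries = d ` C"

definition graded_subalgebra :: "'r set \<Rightarrow> bool" where
  "graded_subalgebra S \<longleftrightarrow> S \<subseteq> C \<and> u \<in> S \<and> (\<forall>x\<in>S. \<forall>y\<in>S. x + y \<in> S \<and> x \<star> y \<in> S) \<and>
    (\<forall>x\<in>S. (\<forall>c. scl c x \<in> S) \<and> (\<forall>n. pr n x \<in> S))"

definition graded_ideal :: "'r set \<Rightarrow> 'r set \<Rightarrow> bool" where
  "graded_ideal K S \<longleftrightarrow> K \<subseteq> S \<and> 0 \<in> K \<and> (\<forall>x\<in>K. \<forall>y\<in>K. x + y \<in> K) \<and>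
    (\<forall>x\<in>K. \<forall>y\<in>S. x \<star> y \<in> K \<and> y \<star> x \<in> K) \<and>
    (\<forall>x\<in>K. (\<forall>c. scl c x \<in> K) \<and> (\<forall>n. pr n x \<in> K))"

lemma graded_subalgebra_I:
  assumes "S \<subseteq> C" "u \<in> S"
    "\<And>x y. x \<in> S \<Longrightarrow> y \<in> S \<Longrightarrow> x \<star> y \<in> S" "\<And>x y. x \<in> S \<Longrightarrow> y \<in> S \<Longrightarrow> x + y \<in> S"
    "\<And>x c. x \<in> S \<Longrightarrow> scl c x \<in> S" "\<And>x n. x \<in> S \<Longrightarrow> pr n x \<in> S"
  shows "graded_subalgebra S"
  using assms by (simp add: graded_subalgebra_def)

lemma graded_ideal_I:
  assumes "K \<subseteq> S" "0 \<in> K"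
    "\<And>x y. x \<in> K \<Longrightarrow> y \<in> S \<Longrightarrow> x \<star> y \<in> K \<and> y \<star> x \<in> K"
    "\<And>x y. x \<in> K \<Longrightarrow> y \<in> K \<Longrightarrow> x + y \<in> K"
    "\<And>x c n. x \<in> K \<Longrightarrow> scl c x \<in> K \<and> pr n x \<in> K"
  shows "graded_ideal K S"
  using assms by (simp add: graded_ideal_def)

lemma graded_subalgebra_closed:
  assumes "graded_subalgebra S"
  shows "x \<in> S \<Longrightarrow> x \<in> C" "u \<in> S" "0 \<in> S" "x \<in> S \<Longrightarrow> y \<in> S \<Longrightarrow> x + y \<in> S"
    "x \<in> S \<Longrightarrow> y \<in> S \<Longrightarrow> x \<star> y \<in> S" "x \<in> S \<Longrightarrow> scl c x \<in> S" "x \<in> S \<Longrightarrow> pr n x \<in> S"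
    "x \<in> S \<Longrightarrow> - x \<in> S" "x \<in> S \<Longrightarrow> y \<in> S \<Longrightarrow> x - y \<in> S"
proof -
  have closed: "S \<subseteq> C" "u \<in> S" "\<And>x y. x \<in> S \<Longrightarrow> y \<in> S \<Longrightarrow> x + y \<in> S \<and> x \<star> y \<in> S"
    "\<And>x c n. x \<in> S \<Longrightarrow> scl c x \<in> S \<and> pr n x \<in> S"
    using assms unfolding graded_subalgebra_def by blast+
  have minus: "- x \<in> S" if "x \<in> S" for x using closed(4)[OF that, of "- 1"] by simp
  then show "x \<in> S \<Longrightarrow> - x \<in> S" .
  show "0 \<in> S" using closed(4)[OF closed(2), of 0] by simp
  show "x - y \<in> S" if "x \<in> S" "y \<in> S" using closed(3)[OF that(1) minus[OF that(2)]] by simp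
qed (use assms[unfolded graded_subalgebra_def] in blast)+

lemma graded_ideal_closed:
  assumes "graded_ideal K S"
  shows "x \<in> K \<Longrightarrow> x \<in> S" "0 \<in> K" "x \<in> K \<Longrightarrow> y \<in> K \<Longrightarrow> x + y \<in> K"
    "x \<in> K \<Longrightarrow> y \<in> S \<Longrightarrow> x \<star> y \<in> K" "x \<in> K \<Longrightarrow> y \<in> S \<Longrightarrow> y \<star> x \<in> K"
    "x \<in> K \<Longrightarrow> scl c x \<in> K" "x \<in> K \<Longrightarrow> pr n x \<in> K"
    "x \<in> K \<Longrightarrow> - x \<in> K" "x \<in> K \<Longrightarrow> y \<in> K \<Longrightarrow> x - y \<in> K"
proof -
  have closed: "K \<subseteq> S" "0 \<in> K" "\<And>x y. x \<in> K \<Longrightarrow> y \<in> K \<Longrightarrow> x + y \<in> K"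
    "\<And>x y. x \<in> K \<Longrightarrow> y \<in> S \<Longrightarrow> x \<star> y \<in> K \<and> y \<star> x \<in> K"
    "\<And>x c n. x \<in> K \<Longrightarrow> scl c x \<in> K \<and> pr n x \<in> K"
    using assms unfolding graded_ideal_def by blast+
  have minus: "- x \<in> K" if "x \<in> K" for x using closed(5)[OF that, of "- 1"] by simp
  then show "x \<in> K \<Longrightarrow> - x \<in> K" .
  show "x - y \<in> K" if "x \<in> K" "y \<in> K" using closed(3)[OF that(1) minus[OF that(2)]] by simp
qed (use assms[unfolded graded_ideal_def] in blast)+

lemma graded_ideal_subset: "graded_ideal K S \<Longrightarrow> K \<subseteq> S' \<Longrightarrow> S' \<subseteq> S \<Longrightarrow> graded_ideal K S'"
  unfolding graded_ideal_def by (meson subset_iff)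

lemma mem_boundaries: "y \<in> C \<Longrightarrow> d y \<in> boundaries"
  by (simp add: boundaries_def)

lemma boundaries_closed [simp]:
  "0 \<in> boundaries"
  "x \<in> boundaries \<Longrightarrow> y \<in> boundaries \<Longrightarrow> x + y \<in> boundaries"
  "x \<in> boundaries \<Longrightarrow> y \<in> boundaries \<Longrightarrow> x - y \<in> boundaries"
  "x \<in> boundaries \<Longrightarrow> - x \<in> boundaries"
  "x \<in> boundaries \<Longrightarrow> scl c x \<in> boundaries"
  "x \<in> boundaries \<Longrightarrow> pr n x \<in> boundaries"
  "x \<in> boundaries \<Longrightarrow> s x \<in> boundaries"
proof -
  show "0 \<in> boundaries" using mem_boundaries[OF C_zero] by simp
  show "x + y \<in> boundaries" if "x \<in> boundaries" "y \<in> boundaries"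
    using that unfolding boundaries_def by (auto simp: d_add[symmetric])
  show "x - y \<in> boundaries" if "x \<in> boundaries" "y \<in> boundaries"
    using that unfolding boundaries_def by (auto simp: d.diff[symmetric])
  show "- x \<in> boundaries" if "x \<in> boundaries"
    using that unfolding boundaries_def by (auto simp: d.minus[symmetric])
  show "scl c x \<in> boundaries" if "x \<in> boundaries"
    using that unfolding boundaries_def by (auto simp: d_scl[symmetric])
  show "pr n x \<in> boundaries" if "x \<in> boundaries"
    using that mem_boundaries[OF C_zero] unfolding boundaries_def
    by (cases n) (auto simp: pr_d_0 pr_d_Suc)
  show "s x \<in> boundaries" if x: "x \<in> boundaries"
  proof -
    obtain y where y: "y \<in> C" "x = d y" using x by (auto simp: boundaries_def)
    then have "s x = d (- s y)" by (simp add: d.minus d_s)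
    then show ?thesis using y mem_boundaries[of "- s y"] by simp
  qed
qed

lemma boundaries_mul:
  assumes "x \<in> boundaries" "y \<in> cocycles"
  shows "x \<star> y \<in> boundaries" "y \<star> x \<in> boundaries"
proof -
  obtain z where z: "z \<in> C" "x = d z" using assms(1) by (auto simp: boundaries_def)
  have y: "y \<in> C" "d y = 0" "d (s y) = 0" using assms(2) by (auto simp: cocycles_def d_s)
  have "x \<star> y = d (z \<star> y)" "y \<star> x = d (s y \<star> z)" using y z by (simp_all add: d_mul)
  then show "x \<star> y \<in> boundaries" "y \<star> x \<in> boundaries"
    using y z mem_boundaries[of "z \<star> y"] mem_boundaries[of "s y \<star> z"] by simp_all
qed

lemma boundaries_cocycles: "boundaries \<subseteq> cocycles"
  by (auto simp: boundaries_def cocycles_def)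

lemma cocycles_closed [simp]:
  "0 \<in> cocycles" "u \<in> cocycles"
  "x \<in> cocycles \<Longrightarrow> y \<in> cocycles \<Longrightarrow> x + y \<in> cocycles"
  "x \<in> cocycles \<Longrightarrow> y \<in> cocycles \<Longrightarrow> x - y \<in> cocycles"
  "x \<in> cocycles \<Longrightarrow> y \<in> cocycles \<Longrightarrow> x \<star> y \<in> cocycles"
  "x \<in> cocycles \<Longrightarrow> - x \<in> cocycles"
  "x \<in> cocycles \<Longrightarrow> scl c x \<in> cocycles"
  "x \<in> cocycles \<Longrightarrow> pr n x \<in> cocycles"
  "x \<in> cocycles \<Longrightarrow> s x \<in> cocycles"
  using pr_d_Suc[of n x]
  by (simp_all add: cocycles_def d_add d.diff d_mul d.minus d_scl d_s s.minus)

lemma graded_subalgebra_cocycles: "graded_subalgebra cocycles"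
  by (auto simp: graded_subalgebra_def) (simp add: cocycles_def)

lemma graded_ideal_boundaries: "graded_ideal boundaries cocycles"
  using boundaries_cocycles by (auto simp: graded_ideal_def boundaries_mul)

end

text \<open>The group \<open>G\<close> is generated by \<open>H\<close> and \<open>g0\<close>, and \<open>m\<close> and \<open>h\<close> are of degrees \<open>0\<close> and \<open>1\<close>, the former of
  norm one, with \<open>\<Delta> h + d m = 0\<close>.\<close>

locale degenerate_dg_algebra = dg_algebra +
  fixes G :: "('g, 'u) monoid_scheme" and H :: "'g set" and g0 :: 'g and p q r :: nat
    and act :: "'g \<Rightarrow> 'b \<Rightarrow> 'b" and m h :: 'b
  assumes group_G: "group G" and finite_G: "finite (carrier G)" and normal_H: "H \<lhd> G"
    and prime_p: "prime p" and char_p: "CHAR('a) = p" and q_def: "q = p ^ r"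
    and p_H: "\<not> p dvd card H"
    and g0: "g0 \<in> carrier G" and g0_q: "g0 [^]\<^bsub>G\<^esub> q \<in> H"
    and decompose_G: "g \<in> carrier G \<Longrightarrow> \<exists>i::nat. \<exists>x\<in>H. g = x \<otimes>\<^bsub>G\<^esub> g0 [^]\<^bsub>G\<^esub> i"
    and act_id: "act \<one>\<^bsub>G\<^esub> x = x"
    and act_act: "\<lbrakk>a \<in> carrier G; b \<in> carrier G\<rbrakk> \<Longrightarrow> act (a \<otimes>\<^bsub>G\<^esub> b) x = act a (act b x)"
    and act_C [simp]: "\<lbrakk>a \<in> carrier G; x \<in> C\<rbrakk> \<Longrightarrow> act a x \<in> C"
    and act_add: "a \<in> carrier G \<Longrightarrow> act a (x + y) = act a x + act a y"
    and act_mul: "a \<in> carrier G \<Longrightarrow> act a (x \<star> y) = act a x \<star> act a y"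
    and act_one: "a \<in> carrier G \<Longrightarrow> act a u = u"
    and act_scl: "a \<in> carrier G \<Longrightarrow> act a (scl c x) = scl c (act a x)"
    and act_d: "a \<in> carrier G \<Longrightarrow> act a (d x) = d (act a x)"
    and act_s: "a \<in> carrier G \<Longrightarrow> act a (s x) = s (act a x)"
    and act_pr: "a \<in> carrier G \<Longrightarrow> act a (pr n x) = pr n (act a x)"
    and m_C [simp]: "m \<in> C" and m_H: "a \<in> H \<Longrightarrow> act a m = m"
    and h_C [simp]: "h \<in> C" and h_H: "a \<in> H \<Longrightarrow> act a h = h"
    and h_cocycle [simp]: "d h = 0"
    and norm_m: "((\<lambda>x. x - act g0 x) ^^ (q - 1)) m = u"
    and h_m: "h - act g0 h + d m = 0"
    and s_m [simp]: "s m = m" and s_h: "s h = - h"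
    and pr_h_Suc: "pr (Suc n) (x \<star> h) = pr n x \<star> h" and pr_h_0: "pr 0 (x \<star> h) = 0"
begin

lemma H_sub: "a \<in> H \<Longrightarrow> a \<in> carrier G"
  using normal_H by (meson normal.axioms(1) subgroup.mem_carrier)

abbreviation \<sigma> :: "'b \<Rightarrow> 'b" where "\<sigma> \<equiv> act g0"

sublocale char_p_operator scl \<sigma>
  by unfold_locales (simp_all add: act_add act_scl g0)

definition E :: "'b set" where "E = {x \<in> C. \<forall>a\<in>H. act a x = x}"
definition invariants :: "'b set" where "invariants = {x \<in> C. \<forall>a\<in>carrier G. act a x = x}"
definition N :: "'b \<Rightarrow> 'b" where "N = \<Delta> ^^ (q - 1)"

lemma act_zero: "a \<in> carrier G \<Longrightarrow> act a 0 = 0"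
  using act_add[of a 0 0] by simp

lemma act_minus: "a \<in> carrier G \<Longrightarrow> act a (- x) = - act a x"
  using act_add[of a x "- x"] by (simp add: act_zero eq_neg_iff_add_eq_0 add.commute)

lemma act_diff: "a \<in> carrier G \<Longrightarrow> act a (x - y) = act a x - act a y"
  using act_add[of a x "- y"] by (simp add: act_minus)

lemma act_sum: "a \<in> carrier G \<Longrightarrow> act a (sum f A) = (\<Sum>i\<in>A. act a (f i))"
  by (induction A rule: infinite_finite_induct) (simp_all add: act_add act_zero)

lemma E_C: "x \<in> E \<Longrightarrow> x \<in> C" by (simp add: E_def)

lemma E_closed [simp]:
  "0 \<in> E" "u \<in> E" "m \<in> E" "h \<in> E"
  "x \<in> E \<Longrightarrow> y \<in> E \<Longrightarrow> x + y \<in> E"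
  "x \<in> E \<Longrightarrow> y \<in> E \<Longrightarrow> x - y \<in> E"
  "x \<in> E \<Longrightarrow> y \<in> E \<Longrightarrow> x \<star> y \<in> E"
  "x \<in> E \<Longrightarrow> - x \<in> E" "x \<in> E \<Longrightarrow> scl c x \<in> E" "x \<in> E \<Longrightarrow> d x \<in> E" "x \<in> E \<Longrightarrow> s x \<in> E"
  by (auto simp: E_def H_sub act_zero act_one act_add act_diff act_mul act_minus act_scl
      act_d act_s m_H h_H)

lemma E_pr: "x \<in> E \<Longrightarrow> pr n x \<in> E"
  by (auto simp: E_def H_sub act_pr)

lemma \<sigma>_E [simp]:
  assumes x: "x \<in> E" shows "\<sigma> x \<in> E"
proof -
  interpret G: group G by (rule group_G)
  interpret H: normal H G by (rule normal_H)
  have "act a (\<sigma> x) = \<sigma> x" if a: "a \<in> H" for a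
  proof -
    have aG: "a \<in> carrier G" using a by (rule H_sub)
    have b: "inv\<^bsub>G\<^esub> g0 \<otimes>\<^bsub>G\<^esub> a \<otimes>\<^bsub>G\<^esub> g0 \<in> H" by (rule H.inv_op_closed1[OF g0 a])
    have "act a (\<sigma> x) = act (a \<otimes>\<^bsub>G\<^esub> g0) x" using aG g0 by (simp add: act_act)
    also have "a \<otimes>\<^bsub>G\<^esub> g0 = g0 \<otimes>\<^bsub>G\<^esub> (inv\<^bsub>G\<^esub> g0 \<otimes>\<^bsub>G\<^esub> a \<otimes>\<^bsub>G\<^esub> g0)"
      using aG g0 by (simp add: G.m_assoc[symmetric])
    also have "act \<dots> x = \<sigma> (act (inv\<^bsub>G\<^esub> g0 \<otimes>\<^bsub>G\<^esub> a \<otimes>\<^bsub>G\<^esub> g0) x)"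
      using aG g0 by (simp add: act_act)
    also have "\<dots> = \<sigma> x" using b x by (simp add: E_def)
    finally show ?thesis .
  qed
  then show ?thesis using x g0 by (simp add: E_def)
qed

lemma \<Delta>_E [simp]: "x \<in> E \<Longrightarrow> \<Delta> x \<in> E"
  by (simp add: \<Delta>_def)

lemma \<Delta>_pow_E [simp]: "x \<in> E \<Longrightarrow> (\<Delta> ^^ n) x \<in> E"
  by (induction n) simp_all

lemma N_E [simp]: "x \<in> E \<Longrightarrow> N x \<in> E"
  by (simp add: N_def)

lemma act_g0_pow: "act (g0 [^]\<^bsub>G\<^esub> (i::nat)) x = (\<sigma> ^^ i) x"
proof (induction i arbitrary: x)
  case (Suc i)
  interpret G: group G by (rule group_G)
  show ?case using g0 by (simp add: act_act Suc funpow_swap1)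
next
  case 0
  interpret G: group G by (rule group_G)
  show ?case by (simp add: act_id)
qed

lemma \<sigma>_q: "x \<in> E \<Longrightarrow> (\<sigma> ^^ q) x = x"
  using g0_q by (simp add: act_g0_pow[symmetric] E_def)

lemma \<Delta>_q: "x \<in> E \<Longrightarrow> (\<Delta> ^^ q) x = 0"
  using \<Delta>_power_char[OF prime_p char_p q_def, of x] by (simp add: \<sigma>_q)

lemma q_pos: "q > 0"
  using prime_p q_def prime_gt_0_nat by simp

lemma \<Delta>_N: "x \<in> E \<Longrightarrow> \<Delta> (N x) = 0"
  using \<Delta>_q[of x] q_pos unfolding N_def by (cases q) auto

lemma N_\<Delta>: "x \<in> E \<Longrightarrow> N (\<Delta> x) = 0"
  using \<Delta>_q[of x] q_pos unfolding N_def by (cases q) (auto simp: funpow_swap1)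

lemma N_norm: "N x = (\<Sum>i<q. (\<sigma> ^^ i) x)"
  unfolding N_def by (rule \<Delta>_power_norm[OF prime_p char_p q_def])

text \<open>On \<open>H\<close>-invariant elements the whole group acts through powers of \<open>\<sigma>\<close>.\<close>

lemma invariants_iff: "x \<in> invariants \<longleftrightarrow> x \<in> E \<and> \<Delta> x = 0"
proof
  assume "x \<in> invariants"
  then show "x \<in> E \<and> \<Delta> x = 0"
    using g0 by (auto simp: invariants_def E_def \<Delta>_def H_sub)
next
  assume x: "x \<in> E \<and> \<Delta> x = 0"
  interpret G: group G by (rule group_G)
  have pow: "(\<sigma> ^^ i) x = x" for i
    using x by (induction i) (auto simp: \<Delta>_def)
  have "act a x = x" if "a \<in> carrier G" for a
  proof -
    obtain i :: nat and b where b: "b \<in> H" "a = b \<otimes>\<^bsub>G\<^esub> g0 [^]\<^bsub>G\<^esub> i"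
      using decompose_G \<open>a \<in> carrier G\<close> by blast
    then show ?thesis
      using x g0 H_sub by (simp add: act_act act_g0_pow pow) (simp add: E_def)
  qed
  then show "x \<in> invariants" using x by (simp add: invariants_def E_def)
qed

lemma invariants_closed [simp]:
  "x \<in> invariants \<Longrightarrow> y \<in> invariants \<Longrightarrow> x + y \<in> invariants"
  "x \<in> invariants \<Longrightarrow> y \<in> invariants \<Longrightarrow> x - y \<in> invariants"
  "x \<in> invariants \<Longrightarrow> y \<in> invariants \<Longrightarrow> x \<star> y \<in> invariants"
  "x \<in> invariants \<Longrightarrow> - x \<in> invariants" "x \<in> invariants \<Longrightarrow> scl c x \<in> invariants"
  "x \<in> invariants \<Longrightarrow> d x \<in> invariants" "x \<in> invariants \<Longrightarrow> s x \<in> invariants"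
  "x \<in> invariants \<Longrightarrow> pr n x \<in> invariants"
  "0 \<in> invariants" "u \<in> invariants"
  by (auto simp: invariants_def act_zero act_one act_add act_diff act_mul act_minus act_scl
      act_d act_s act_pr)

lemma invariants_E [simp]: "x \<in> invariants \<Longrightarrow> x \<in> E"
  by (simp add: invariants_iff)

lemma invariants_\<sigma>: "x \<in> invariants \<Longrightarrow> \<sigma> x = x"
  using g0 by (simp add: invariants_def)

lemma N_invariants [simp]: "x \<in> E \<Longrightarrow> N x \<in> invariants"
  by (simp add: invariants_iff \<Delta>_N)

lemma \<Delta>_d: "\<Delta> (d x) = d (\<Delta> x)"
  by (simp add: \<Delta>_def act_d g0 d.diff)

lemma \<Delta>_s: "\<Delta> (s x) = s (\<Delta> x)"
  by (simp add: \<Delta>_def act_s g0 s.diff)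

lemma \<Delta>_pr: "\<Delta> (pr n x) = pr n (\<Delta> x)"
  by (simp add: \<Delta>_def act_pr g0 pr.diff)

lemma \<Delta>_scl: "\<Delta> (scl c x) = scl c (\<Delta> x)"
  by (simp add: \<Delta>_def act_scl g0 scale_right_diff_distrib)

lemma \<Delta>_mul: "\<Delta> (x \<star> y) = \<Delta> x \<star> y + \<sigma> x \<star> \<Delta> y"
  by (simp add: \<Delta>_def act_mul g0 mul_distribs)

lemma N_d: "N (d x) = d (N x)"
proof -
  have "(\<Delta> ^^ n) (d x) = d ((\<Delta> ^^ n) x)" for n by (induction n) (simp_all add: \<Delta>_d)
  then show ?thesis by (simp add: N_def)
qed

lemma N_s: "N (s x) = s (N x)"
proof -
  have "(\<Delta> ^^ n) (s x) = s ((\<Delta> ^^ n) x)" for n by (induction n) (simp_all add: \<Delta>_s)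
  then show ?thesis by (simp add: N_def)
qed

lemma N_pr: "N (pr k x) = pr k (N x)"
proof -
  have "(\<Delta> ^^ n) (pr k x) = pr k ((\<Delta> ^^ n) x)" for n by (induction n) (simp_all add: \<Delta>_pr)
  then show ?thesis by (simp add: N_def)
qed

lemma N_scl: "N (scl c x) = scl c (N x)"
proof -
  have "(\<Delta> ^^ n) (scl c x) = scl c ((\<Delta> ^^ n) x)" for n by (induction n) (simp_all add: \<Delta>_scl)
  then show ?thesis by (simp add: N_def)
qed

lemma N_add: "N (x + y) = N x + N y" by (simp add: N_def \<Delta>_pow.add)
lemma N_diff: "N (x - y) = N x - N y" by (simp add: N_def \<Delta>_pow.diff)

lemma \<Delta>_pow_mul_invariant:
  assumes "y \<in> invariants"
  shows "(\<Delta> ^^ n) (x \<star> y) = (\<Delta> ^^ n) x \<star> y" "(\<Delta> ^^ n) (y \<star> x) = y \<star> (\<Delta> ^^ n) x"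
proof -
  have "\<Delta> y = 0" "\<sigma> y = y" using assms by (simp_all add: invariants_iff invariants_\<sigma>)
  then show "(\<Delta> ^^ n) (x \<star> y) = (\<Delta> ^^ n) x \<star> y" "(\<Delta> ^^ n) (y \<star> x) = y \<star> (\<Delta> ^^ n) x"
    by (induction n) (simp_all add: \<Delta>_mul)
qed

lemma N_m: "N m = u"
proof -
  have "\<Delta> = (\<lambda>x. x - \<sigma> x)" by (auto simp: \<Delta>_def)
  then show ?thesis using norm_m by (simp add: N_def)
qed

lemma N_m_mul: "y \<in> invariants \<Longrightarrow> N (m \<star> y) = y" "y \<in> invariants \<Longrightarrow> N (y \<star> m) = y"
  using N_m unfolding N_def by (simp_all add: \<Delta>_pow_mul_invariant)

lemma d_m: "d m = - \<Delta> h"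
  using h_m by (simp add: \<Delta>_def algebra_simps)

text \<open>\<open>E\<close> is a free module over the group algebra of the cyclic quotient, because \<open>m\<close> has norm
  one: a fixed vector \<open>y\<close> is the norm of \<open>m y\<close>. Hence kernels and images of powers of \<open>\<Delta>\<close> match.\<close>

lemma \<Delta>_kernel:
  "x \<in> E \<Longrightarrow> j \<le> q \<Longrightarrow> (\<Delta> ^^ j) x = 0 \<Longrightarrow> \<exists>w\<in>E. x = (\<Delta> ^^ (q - j)) w"
proof (induction j arbitrary: x)
  case 0
  then show ?case using E_closed(1) by (intro bexI[of _ 0]) simp_all
next
  case (Suc j)
  define y where "y = (\<Delta> ^^ j) x"
  have y: "y \<in> invariants" using Suc.prems by (simp add: invariants_iff y_def)
  define k where "k = q - Suc j"
  have k: "q - 1 = j + k" "q - j = Suc k" using Suc.prems(2) by (simp_all add: k_def)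
  have "(\<Delta> ^^ j) ((\<Delta> ^^ k) (m \<star> y)) = y"
    using N_m_mul(1)[OF y] unfolding N_def k(1) funpow_add by simp
  then have "(\<Delta> ^^ j) (x - (\<Delta> ^^ k) (m \<star> y)) = 0"
    by (simp add: \<Delta>_pow.diff y_def)
  moreover have "x - (\<Delta> ^^ k) (m \<star> y) \<in> E" using y Suc.prems(1) by simp
  ultimately obtain w where w: "w \<in> E" "x - (\<Delta> ^^ k) (m \<star> y) = (\<Delta> ^^ (q - j)) w"
    using Suc.IH Suc.prems(2) by (metis Suc_leD)
  then have "x = (\<Delta> ^^ k) (\<Delta> w + m \<star> y)"
    by (simp add: k(2) \<Delta>_pow.add funpow_swap1 algebra_simps)
  then show ?case using w y unfolding k_def by (intro bexI[of _ "\<Delta> w + m \<star> y"]) simp_all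
qed

lemma N_kernel:
  assumes "x \<in> E" "N x = 0" shows "\<exists>w\<in>E. x = \<Delta> w"
  using \<Delta>_kernel[of x "q - 1"] assms q_pos unfolding N_def by simp

definition average :: "'b \<Rightarrow> 'b" where
  "average x = scl (inverse (of_nat (card H))) (\<Sum>a\<in>H. act a x)"

lemma finite_H: "finite H"
  using finite_G H_sub by (meson finite_subset subsetI)

lemma card_H: "of_nat (card H) \<noteq> (0::'a)"
  using p_H char_p by (simp add: of_nat_eq_0_iff_char_dvd)

lemma average_const: "scl (inverse (of_nat (card H))) (\<Sum>a\<in>H. x) = x"
proof -
  have "(\<Sum>a\<in>A. x) = scl (of_nat (card A)) x" if "finite A" for A :: "'g set"
    using that by (induction A) (simp_all add: scale_left_distrib)
  then show ?thesis using card_H by (simp add: finite_H)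
qed

lemma average_E [simp]:
  assumes x: "x \<in> C" shows "average x \<in> E"
proof -
  interpret G: group G by (rule group_G)
  interpret H: subgroup H G using normal_H by (rule normal_imp_subgroup)
  have sumC: "(\<Sum>a\<in>A. act a x) \<in> C" if "A \<subseteq> H" for A
    using finite_subset[OF that finite_H] that x
    by (induction A) (auto simp: H_sub)
  have "act b (average x) = average x" if b: "b \<in> H" for b
  proof -
    have "act b (\<Sum>a\<in>H. act a x) = (\<Sum>a\<in>H. act (b \<otimes>\<^bsub>G\<^esub> a) x)"
      using b by (simp add: act_sum act_act H_sub)
    also have "\<dots> = (\<Sum>a\<in>H. act a x)"
    proof (rule sum.reindex_bij_witness[of _ "\<lambda>a. inv\<^bsub>G\<^esub> b \<otimes>\<^bsub>G\<^esub> a" "\<lambda>a. b \<otimes>\<^bsub>G\<^esub> a"])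
    qed (use b in \<open>auto simp: G.m_assoc[symmetric] H_sub\<close>)
    finally show ?thesis using b by (simp add: average_def act_scl H_sub)
  qed
  then show ?thesis using sumC[of H] by (simp add: E_def average_def)
qed

lemma d_average: "d (average x) = average (d x)"
  by (simp add: average_def d_scl d.sum act_d H_sub cong: sum.cong)

lemma average_fixed: "x \<in> E \<Longrightarrow> average x = x"
  by (simp add: average_def E_def average_const)

text \<open>Averaging over \<open>H\<close> commutes with \<open>d\<close>, so \<open>H\<close>-invariant boundaries bound \<open>H\<close>-invariantly.\<close>

lemma boundaries_E:
  assumes "x \<in> boundaries" "x \<in> E" shows "\<exists>y\<in>E. x = d y"
proof -
  obtain y where y: "y \<in> C" "x = d y" using assms(1) by (auto simp: boundaries_def)
  then have "x = d (average y)" using assms(2) by (simp add: d_average average_fixed)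
  then show ?thesis using y by (intro bexI[of _ "average y"]) simp_all
qed

text \<open>The cocycles with cohomology class fixed by \<open>B\<close>.\<close>

definition stable_cocycles :: "'g set \<Rightarrow> 'b set" where
  "stable_cocycles B = {x \<in> cocycles. \<forall>a\<in>B. act a x - x \<in> boundaries}"

abbreviation "F \<equiv> stable_cocycles (carrier G)"

lemma average_class:
  assumes x: "x \<in> stable_cocycles H"
  shows "average x \<in> cocycles \<inter> E" "average x - x \<in> boundaries"
proof -
  have xC: "x \<in> C" "d x = 0" using x by (auto simp: stable_cocycles_def cocycles_def)
  have "d (average x) = 0" using xC by (simp add: d_average) (simp add: average_def act_zero H_sub)
  then show "average x \<in> cocycles \<inter> E" using xC average_E[OF xC(1)] by (simp add: cocycles_def E_C)
  have "(\<Sum>a\<in>A. act a x - x) \<in> boundaries" if "A \<subseteq> H" for A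
    using finite_subset[OF that finite_H] that x
    by (induction A) (auto simp: stable_cocycles_def)
  then have "scl (inverse (of_nat (card H))) (\<Sum>a\<in>H. act a x - x) \<in> boundaries" by simp
  then show "average x - x \<in> boundaries"
    by (simp add: average_def sum_subtractf scale_right_diff_distrib average_const del: sum_constant)
qed

lemma F_H: "x \<in> F \<Longrightarrow> x \<in> stable_cocycles H"
  using H_sub by (auto simp: stable_cocycles_def)

lemma boundaries_act: "a \<in> carrier G \<Longrightarrow> x \<in> boundaries \<Longrightarrow> act a x \<in> boundaries"
  unfolding boundaries_def by (auto simp: act_d)

lemma F_\<Delta>:
  assumes "x \<in> F" "x \<in> E"
  shows "\<exists>y\<in>E. \<Delta> x = d y"
proof -
  have "\<sigma> x - x \<in> boundaries" using assms(1) g0 by (simp add: stable_cocycles_def)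
  then have "\<Delta> x \<in> boundaries" using boundaries_closed(4)[of "\<sigma> x - x"] by (simp add: \<Delta>_def)
  then show ?thesis using boundaries_E assms(2) by simp
qed

lemma F_boundaries_add:
  assumes x: "x \<in> F" and b: "b \<in> boundaries"
  shows "x + b \<in> F"
proof -
  have "act a (x + b) - (x + b) \<in> boundaries" if "a \<in> carrier G" for a
  proof -
    have "act a (x + b) - (x + b) = (act a x - x) + (act a b - b)"
      using that by (simp add: act_add algebra_simps)
    also have "\<dots> \<in> boundaries"
      using that x b boundaries_act[OF that b]
      by (intro boundaries_closed(2)) (simp_all add: stable_cocycles_def)
    finally show ?thesis .
  qed
  then show ?thesis using x b boundaries_cocycles by (auto simp: stable_cocycles_def)
qed

definition "invariant_cocycles = cocycles \<inter> invariants"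

text \<open>\<open>P\<close> and \<open>K\<close> consist of the cocycles with class in \<open>\<A>\<close> and in \<open>W\<close>. Then \<open>boundaries \<subseteq> K \<subseteq> P \<subseteq> F\<close>, and
  \<open>P/K\<close> and \<open>F/K\<close> are the two algebras to be compared.\<close>

definition "P = {x. \<exists>a\<in>invariant_cocycles. x - a \<in> boundaries}"
definition "norms = N ` (cocycles \<inter> E)"
definition "K = {x. \<exists>a\<in>norms. x - a \<in> boundaries}"

lemma invariant_cocycles_closed [simp]:
  "x \<in> invariant_cocycles \<Longrightarrow> y \<in> invariant_cocycles \<Longrightarrow> x + y \<in> invariant_cocycles"
  "x \<in> invariant_cocycles \<Longrightarrow> y \<in> invariant_cocycles \<Longrightarrow> x - y \<in> invariant_cocycles"
  "x \<in> invariant_cocycles \<Longrightarrow> y \<in> invariant_cocycles \<Longrightarrow> x \<star> y \<in> invariant_cocycles"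
  "x \<in> invariant_cocycles \<Longrightarrow> - x \<in> invariant_cocycles"
  "x \<in> invariant_cocycles \<Longrightarrow> scl c x \<in> invariant_cocycles"
  "x \<in> invariant_cocycles \<Longrightarrow> s x \<in> invariant_cocycles"
  "x \<in> invariant_cocycles \<Longrightarrow> pr n x \<in> invariant_cocycles"
  "u \<in> invariant_cocycles" "0 \<in> invariant_cocycles"
  by (simp_all add: invariant_cocycles_def)

lemma cocycles_\<sigma> [simp]: "x \<in> cocycles \<Longrightarrow> act g0 x \<in> cocycles"
  by (simp add: cocycles_def g0 act_d[symmetric] act_zero)

lemma cocycles_act: "a \<in> carrier G \<Longrightarrow> x \<in> cocycles \<Longrightarrow> act a x \<in> cocycles"
  by (simp add: cocycles_def act_d[symmetric] act_zero)

lemma cocycles_\<Delta> [simp]: "x \<in> cocycles \<Longrightarrow> \<Delta> x \<in> cocycles"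
  by (simp add: \<Delta>_def)

lemma cocycles_\<Delta>_pow [simp]: "x \<in> cocycles \<Longrightarrow> (\<Delta> ^^ n) x \<in> cocycles"
  by (induction n) simp_all

lemma boundaries_\<Delta> [simp]: "x \<in> boundaries \<Longrightarrow> \<Delta> x \<in> boundaries"
  by (simp add: \<Delta>_def boundaries_act g0)

lemma boundary_cocycle [simp]: "x \<in> boundaries \<Longrightarrow> x \<in> cocycles"
  using boundaries_cocycles by blast

lemma invariant_cocycles_I: "x \<in> E \<Longrightarrow> \<Delta> x = 0 \<Longrightarrow> d x = 0 \<Longrightarrow> x \<in> invariant_cocycles"
  by (simp add: invariant_cocycles_def cocycles_def invariants_iff E_C)

lemma invariant_cocycles_D [simp]:
  "x \<in> invariant_cocycles \<Longrightarrow> x \<in> cocycles" "x \<in> invariant_cocycles \<Longrightarrow> x \<in> invariants"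
  "x \<in> invariant_cocycles \<Longrightarrow> d x = 0" "x \<in> invariant_cocycles \<Longrightarrow> \<Delta> x = 0"
  by (simp_all add: invariant_cocycles_def cocycles_def invariants_iff)

lemma cocycles_I: "x \<in> C \<Longrightarrow> d x = 0 \<Longrightarrow> x \<in> cocycles"
  by (simp add: cocycles_def)

lemma stable_I:
  "x \<in> cocycles \<Longrightarrow> (\<And>a. a \<in> carrier G \<Longrightarrow> act a x - x \<in> boundaries) \<Longrightarrow> x \<in> F"
  by (simp add: stable_cocycles_def)

lemma stable_D: "x \<in> F \<Longrightarrow> a \<in> carrier G \<Longrightarrow> act a x - x \<in> boundaries"
  by (simp add: stable_cocycles_def)

lemma h_cocycles [simp]: "h \<in> cocycles"
  by (simp add: cocycles_def)

lemma cocycles_d [simp]: "x \<in> cocycles \<Longrightarrow> d x = 0"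
  unfolding cocycles_def by blast

lemma cocycles_C [simp]: "x \<in> cocycles \<Longrightarrow> x \<in> C"
  unfolding cocycles_def by blast

lemma F_cocycles [simp]: "x \<in> F \<Longrightarrow> x \<in> cocycles"
  by (simp add: stable_cocycles_def)

lemma P_cocycles [simp]: "x \<in> P \<Longrightarrow> x \<in> cocycles"
proof -
  assume "x \<in> P"
  then obtain a where "a \<in> invariant_cocycles" "x - a \<in> boundaries" by (auto simp: P_def)
  then show ?thesis using cocycles_closed(3)[of "x - a" a] by simp
qed

lemma P_I: "a \<in> invariant_cocycles \<Longrightarrow> x - a \<in> boundaries \<Longrightarrow> x \<in> P"
  by (auto simp: P_def)

lemma K_I: "z \<in> cocycles \<Longrightarrow> z \<in> E \<Longrightarrow> x - N z \<in> boundaries \<Longrightarrow> x \<in> K"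
  by (auto simp: K_def norms_def)

lemma K_E: "x \<in> K \<Longrightarrow> \<exists>z\<in>cocycles \<inter> E. x - N z \<in> boundaries"
  by (auto simp: K_def norms_def)

text \<open>If \<open>N y = d S\<close>, then \<open>y - d (S m)\<close> has norm zero because \<open>N (S m) = S\<close>. Hence it equals \<open>\<Delta> v\<close> for some
  \<open>v\<close>, and \<open>x - d v\<close> is invariant.\<close>

lemma invariant_class:
  assumes x: "x \<in> cocycles" "x \<in> E" and y: "y \<in> E" "\<Delta> x = d y"
    and S: "S \<in> invariants" "N y = d S"
  shows "x \<in> P"
proof -
  have "N (y - d (S \<star> m)) = 0"
    using N_m_mul(2)[OF S(1)] by (simp add: N_diff N_d S(2))
  then obtain v where v: "v \<in> E" "y - d (S \<star> m) = \<Delta> v"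
    using N_kernel[of "y - d (S \<star> m)"] y S by auto
  have "d y = d (y - d (S \<star> m))" by (simp add: d.diff)
  then have "\<Delta> (x - d v) = 0" by (simp add: v \<Delta>.diff y(2) \<Delta>_d)
  then have "x - d v \<in> invariant_cocycles"
    using x v by (intro invariant_cocycles_I) (simp_all add: d.diff)
  moreover have "x - (x - d v) \<in> boundaries"
    using v by (simp add: algebra_simps mem_boundaries E_C)
  ultimately show ?thesis by (rule P_I)
qed

text \<open>Invariance of \<open>a\<close> gives \<open>\<Delta> (h a - s a \<cdot> h) = d (a m - m a)\<close>, and \<open>a m - m a\<close> has norm \<open>a - a = 0\<close>.\<close>

lemma commutator_in_P:
  assumes a: "a \<in> invariant_cocycles"
  shows "h \<star> a - s a \<star> h \<in> P"
proof (rule invariant_class)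
  have sa: "s a \<in> invariant_cocycles" using a by simp
  have "\<sigma> (s a) = s a" using sa by (simp add: invariants_\<sigma>)
  then have "\<Delta> (h \<star> a - s a \<star> h) = \<Delta> h \<star> a - s a \<star> \<Delta> h"
    using a sa by (simp add: \<Delta>.diff \<Delta>_mul)
  then show "\<Delta> (h \<star> a - s a \<star> h) = d (a \<star> m - m \<star> a)"
    using a by (simp add: d.diff d_mul d_m mul_distribs)
  show "N (a \<star> m - m \<star> a) = d 0" using a by (simp add: N_diff N_m_mul)
qed (use a in simp_all)

text \<open>Here the stability of \<open>h \<star> h\<close> is witnessed by a cochain whose norm telescopes: with
  \<open>t\<^sub>i = \<sigma>\<^sup>i m\<close>, it is the boundary of \<open>\<Sum>\<^sub>j\<^sub><\<^sub>i t\<^sub>j t\<^sub>i\<close>, and this sum is invariant because \<open>\<Sum> t\<^sub>i = 1\<close>.\<close>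

lemma square_in_P: "h \<star> h \<in> P"
proof (rule invariant_class)
  define t where "t i = (\<sigma> ^^ i) m" for i
  define M where "M i = (\<Sum>j<i. t j)" for i
  define y where "y = h \<star> m - m \<star> h - m \<star> d m"
  define S where "S = (\<Sum>i<q. M i \<star> t i)"
  have tE: "t i \<in> E" for i by (induction i) (simp_all add: t_def)
  have ME: "M i \<in> E" for i by (induction i) (simp_all add: M_def tE)
  have \<sigma>t: "\<sigma> (t i) = t (Suc i)" for i by (simp add: t_def)
  have Mq: "M q = u" using N_m by (simp add: M_def t_def N_norm)
  have tq: "t q = t 0" by (simp add: t_def \<sigma>_q)
  have M0: "M 0 = 0" and MS: "M (Suc i) = M i + t i" for i by (simp_all add: M_def)
  have \<sigma>h: "\<sigma> h = h + d m" by (simp add: d_m \<Delta>_def)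
  \<comment> \<open>\<open>M i\<close> is a partial norm, so that \<open>\<sigma>\<^sup>i h = h + d (M i)\<close>\<close>
  have \<sigma>M: "\<sigma> (M i) = M (Suc i) - t 0" for i
    by (induction i) (simp_all add: MS M0 \<sigma>_add \<sigma>t)
  have \<sigma>ih: "(\<sigma> ^^ i) h = h + d (M i)" for i
  proof (induction i)
    case (Suc i)
    have "\<sigma> (d (M i)) = d (M (Suc i)) - d m"
      by (simp add: act_d g0 \<sigma>M d.diff t_def[of 0])
    then show ?case using Suc by (simp add: \<sigma>_add \<sigma>h)
  qed (simp add: M0)
  have \<sigma>mul: "(\<sigma> ^^ i) (a \<star> b) = (\<sigma> ^^ i) a \<star> (\<sigma> ^^ i) b" for i a b
    by (induction i) (simp_all add: act_mul g0)
  have \<sigma>d: "(\<sigma> ^^ i) (d a) = d ((\<sigma> ^^ i) a)" for i a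
    by (induction i) (simp_all add: act_d g0)
  have \<sigma>diff: "(\<sigma> ^^ i) (a - b) = (\<sigma> ^^ i) a - (\<sigma> ^^ i) b" for i a b
    by (induction i) (simp_all add: \<sigma>.diff)
  have st: "s (t i) = t i" for i
    by (induction i) (simp_all add: t_def act_s[symmetric] g0)
  have sM: "s (M i) = M i" for i
    by (induction i) (simp_all add: M0 MS s_add st)
  have sum_t: "(\<Sum>i<q. t i) = u" using Mq by (simp add: M_def)
  have "\<Delta> (h \<star> h) = h \<star> h - (h + d m) \<star> (h + d m)"
    by (simp add: \<Delta>_def act_mul g0 \<sigma>h)
  then show "\<Delta> (h \<star> h) = d y"
    by (simp add: y_def d.diff d_mul s_h mul_distribs)
  have "(\<sigma> ^^ i) y = (h \<star> t i - t i \<star> h) + (d (M i) \<star> t i - t i \<star> d (M (Suc i)))" for i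
    by (simp add: y_def \<sigma>diff \<sigma>mul \<sigma>d \<sigma>ih t_def[symmetric] mul_distribs MS d_add)
  then have "N y = (h \<star> u - u \<star> h) + (\<Sum>i<q. d (M i) \<star> t i - t i \<star> d (M (Suc i)))"
    by (simp only: N_norm sum.distrib sum_subtractf mul_left.sum[symmetric]
        mul_right.sum[symmetric] sum_t)
  also have "\<dots> = (\<Sum>i<q. d (M i \<star> t i)) - (\<Sum>i<q. M i \<star> d (t i) + t i \<star> d (M (Suc i)))"
    by (simp add: d_mul sM sum_subtractf[symmetric] algebra_simps)
  also have "(\<Sum>i<q. M i \<star> d (t i) + t i \<star> d (M (Suc i)))
      = (\<Sum>i<q. M (Suc i) \<star> d (M (Suc i)) - M i \<star> d (M i))"
    by (simp add: MS d_add mul_distribs algebra_simps)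
  also have "\<dots> = 0"
    using sum_lessThan_telescope[of "\<lambda>i. M i \<star> d (M i)" q] by (simp add: Mq M0)
  finally show "N y = d S" by (simp add: S_def d.sum)
  have "\<sigma> S = (\<Sum>i<q. (M (Suc i) - t 0) \<star> t (Suc i))"
    by (simp add: S_def \<sigma>.sum act_mul g0 \<sigma>M \<sigma>t)
  also have "\<dots> = (\<Sum>i<q. (M i - t 0) \<star> t i) + ((M q - t 0) \<star> t q - (M 0 - t 0) \<star> t 0)"
    using sum_lessThan_telescope[of "\<lambda>i. (M i - t 0) \<star> t i" q]
    by (simp add: sum_subtractf algebra_simps)
  also have "\<dots> = S"
    by (simp add: S_def mul_left.diff sum_subtractf mul_right.sum[symmetric] sum_t Mq tq M0
        mul_left.minus)
  finally have "\<sigma> S = S" .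
  moreover have "S \<in> E"
  proof -
    have "(\<Sum>i<k. M i \<star> t i) \<in> E" for k by (induction k) (simp_all add: ME tE)
    then show ?thesis by (simp add: S_def)
  qed
  ultimately show "S \<in> invariants" by (simp add: invariants_iff \<Delta>_def)
  show "y \<in> E" by (simp add: y_def)
qed simp_all

lemma F_I:
  assumes x: "x \<in> cocycles" "x \<in> E" "\<Delta> x \<in> boundaries"
  shows "x \<in> F"
proof -
  interpret G: group G by (rule group_G)
  have pow: "(\<sigma> ^^ i) x - x \<in> boundaries" for i
  proof (induction i)
    case (Suc i)
    have "\<sigma> ((\<sigma> ^^ i) x - x) - \<Delta> x \<in> boundaries"
      using Suc x(3) boundaries_act[OF g0 Suc] by simp
    then show ?case by (simp add: \<sigma>.diff \<Delta>_def)
  qed simp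
  have "act a x - x \<in> boundaries" if a: "a \<in> carrier G" for a
  proof -
    obtain i :: nat and b where b: "b \<in> H" "a = b \<otimes>\<^bsub>G\<^esub> g0 [^]\<^bsub>G\<^esub> i"
      using decompose_G[OF a] by blast
    have "(\<sigma> ^^ i) x \<in> E" using x(2) by (induction i) simp_all
    then have "act b ((\<sigma> ^^ i) x) = (\<sigma> ^^ i) x" using b(1) unfolding E_def by blast
    then have "act a x = (\<sigma> ^^ i) x"
      using H_sub[OF b(1)] g0 by (simp add: b(2) act_act act_g0_pow)
    then show ?thesis using pow by simp
  qed
  then show ?thesis using x(1) by (intro stable_I)
qed

lemma h_F [simp]: "h \<in> F"
proof (rule F_I)
  have "\<Delta> h = d (- m)" by (simp add: d.minus d_m)
  then show "\<Delta> h \<in> boundaries" by (simp add: mem_boundaries)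
qed simp_all

lemma invariant_cocycles_F [simp]: "x \<in> invariant_cocycles \<Longrightarrow> x \<in> F"
  by (rule F_I) simp_all

lemma K_subset_P: "K \<subseteq> P"
proof
  fix x assume "x \<in> K"
  then obtain z where z: "z \<in> cocycles" "z \<in> E" "x - N z \<in> boundaries" using K_E by blast
  then have "N z \<in> invariant_cocycles"
    by (intro invariant_cocycles_I) (simp_all add: \<Delta>_N N_d[symmetric], simp add: N_def)
  then show "x \<in> P" using z(3) by (rule P_I)
qed

lemma P_subset_F: "P \<subseteq> F"
proof
  fix x assume "x \<in> P"
  then obtain a where "a \<in> invariant_cocycles" "x - a \<in> boundaries" by (auto simp: P_def)
  then show "x \<in> F" using F_boundaries_add[of a "x - a"] by simp
qed

lemma boundaries_subset_K: "boundaries \<subseteq> K"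
proof
  fix x assume "x \<in> boundaries"
  then show "x \<in> K" using K_I[of 0 x] by (simp add: N_def)
qed

lemma graded_subalgebra_F: "graded_subalgebra F"
proof -
  have mul: "x \<star> y \<in> F" if x: "x \<in> F" and y: "y \<in> F" for x y
  proof -
    have "act a (x \<star> y) - x \<star> y \<in> boundaries" if a: "a \<in> carrier G" for a
    proof -
      have eq: "act a (x \<star> y) - x \<star> y = (act a x - x) \<star> act a y + x \<star> (act a y - y)"
        using a by (simp add: act_mul mul_distribs)
      have "act a y \<in> cocycles" using a y by (simp add: cocycles_act)
      then show ?thesis
        unfolding eq using x y a
        by (intro boundaries_closed(2) boundaries_mul) (simp_all add: stable_D)
    qed
    then show ?thesis using x y by (intro stable_I) simp_all
  qed
  have add: "x + y \<in> F" if x: "x \<in> F" and y: "y \<in> F" for x y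
  proof -
    have "act a (x + y) - (x + y) \<in> boundaries" if a: "a \<in> carrier G" for a
    proof -
      have eq: "act a (x + y) - (x + y) = (act a x - x) + (act a y - y)"
        using a by (simp add: act_add)
      show ?thesis
        unfolding eq using x y a
        by (intro boundaries_closed(2)) (simp_all add: stable_D)
    qed
    then show ?thesis using x y by (intro stable_I) simp_all
  qed
  have scl: "scl c x \<in> F" if x: "x \<in> F" for x c
    using x
    by (intro stable_I) (simp_all add: stable_D act_scl scale_right_diff_distrib[symmetric])
  have pr: "pr n x \<in> F" if x: "x \<in> F" for x n
    using x by (intro stable_I) (simp_all add: stable_D act_pr pr.diff[symmetric])
  have "F \<subseteq> C" by (auto intro: cocycles_C F_cocycles)
  moreover have "u \<in> F" by (rule invariant_cocycles_F) simp
  ultimately show ?thesis using mul add scl pr by (rule graded_subalgebra_I)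
qed

lemma graded_subalgebra_P: "graded_subalgebra P"
proof -
  have 1: "x \<star> y \<in> P" "x + y \<in> P" if x: "x \<in> P" and y: "y \<in> P" for x y
  proof -
    obtain a b where a: "a \<in> invariant_cocycles" "x - a \<in> boundaries"
      and b: "b \<in> invariant_cocycles" "y - b \<in> boundaries"
      using x y unfolding P_def by blast
    have "x \<star> y - a \<star> b = (x - a) \<star> y + a \<star> (y - b)" by (simp add: mul_distribs)
    also have "\<dots> \<in> boundaries" using a b x y by (intro boundaries_closed(2) boundaries_mul) simp_all
    finally show "x \<star> y \<in> P" using a b by (intro P_I[of "a \<star> b"]) simp_all
    have "x + y - (a + b) = (x - a) + (y - b)" by simp
    then have "x + y - (a + b) \<in> boundaries" using a b by (metis boundaries_closed(2))
    then show "x + y \<in> P" using a b by (intro P_I[of "a + b"]) simp_all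
  qed
  have 2: "scl c x \<in> P" "pr n x \<in> P" if x: "x \<in> P" for x c n
  proof -
    obtain a where a: "a \<in> invariant_cocycles" "x - a \<in> boundaries"
      using x unfolding P_def by blast
    then have "scl c x - scl c a \<in> boundaries" "pr n x - pr n a \<in> boundaries"
      by (simp_all add: scale_right_diff_distrib[symmetric] pr.diff[symmetric])
    then show "scl c x \<in> P" "pr n x \<in> P"
      using a P_I[of "scl c a"] P_I[of "pr n a"] by simp_all
  qed
  have "P \<subseteq> C" by (auto intro: cocycles_C P_cocycles)
  moreover have "u \<in> P" by (rule P_I[of u]) simp_all
  ultimately show ?thesis using 1 2 by (rule graded_subalgebra_I)
qed

text \<open>By the twisted Leibniz rule, each application of \<open>\<Delta>\<close> to \<open>z e\<close> or \<open>e z\<close> adds a term with the factor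
  \<open>\<Delta> e\<close>, which is a boundary.\<close>

lemma N_mul_stable:
  assumes z: "z \<in> cocycles" and e: "e \<in> cocycles" "\<Delta> e \<in> boundaries"
  shows "N z \<star> e - N (z \<star> e) \<in> boundaries" "e \<star> N z - N (e \<star> z) \<in> boundaries"
proof -
  have "(\<Delta> ^^ n) (z \<star> e) - (\<Delta> ^^ n) z \<star> e \<in> boundaries" for n
  proof (induction n)
    case (Suc n)
    have eq: "(\<Delta> ^^ Suc n) (z \<star> e) - (\<Delta> ^^ Suc n) z \<star> e
        = \<Delta> ((\<Delta> ^^ n) (z \<star> e) - (\<Delta> ^^ n) z \<star> e) + \<sigma> ((\<Delta> ^^ n) z) \<star> \<Delta> e"
      by (simp add: \<Delta>.diff \<Delta>_mul)
    show ?case unfolding eq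
      using Suc z e by (intro boundaries_closed(2) boundaries_mul) simp_all
  qed simp
  from boundaries_closed(4)[OF this[of "q - 1"]]
  show "N z \<star> e - N (z \<star> e) \<in> boundaries" by (simp add: N_def)
  have "(\<Delta> ^^ n) (e \<star> z) - e \<star> (\<Delta> ^^ n) z \<in> boundaries" for n
  proof (induction n)
    case (Suc n)
    have \<sigma>e: "\<sigma> e = e - \<Delta> e" by (simp add: \<Delta>_def)
    have eq: "(\<Delta> ^^ Suc n) (e \<star> z) - e \<star> (\<Delta> ^^ Suc n) z
        = \<Delta> ((\<Delta> ^^ n) (e \<star> z) - e \<star> (\<Delta> ^^ n) z) + (\<Delta> e \<star> (\<Delta> ^^ n) z - \<Delta> e \<star> (\<Delta> ^^ Suc n) z)"
      by (simp add: \<Delta>.diff \<Delta>_mul \<sigma>e mul_distribs)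
    show ?case unfolding eq
      using Suc z e
      by (intro boundaries_closed(2,3) boundaries_mul) (simp_all del: funpow.simps)
  qed simp
  from boundaries_closed(4)[OF this[of "q - 1"]]
  show "e \<star> N z - N (e \<star> z) \<in> boundaries" by (simp add: N_def)
qed

lemma F_representative:
  assumes "x \<in> F"
  shows "\<exists>e\<in>F \<inter> E. x - e \<in> boundaries \<and> \<Delta> e \<in> boundaries"
proof -
  have e: "average x \<in> cocycles \<inter> E" "average x - x \<in> boundaries"
    using average_class[OF F_H[OF assms]] by auto
  then have "average x \<in> F" using F_boundaries_add[OF assms e(2)] by simp
  moreover have "\<Delta> (average x) \<in> boundaries"
    using F_\<Delta>[OF \<open>average x \<in> F\<close>] e by (auto simp: mem_boundaries E_C)
  moreover have "x - average x \<in> boundaries" using boundaries_closed(4)[OF e(2)] by simp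
  ultimately show ?thesis using e(1) by (intro bexI[of _ "average x"]) auto
qed

text \<open>Replace a stable class by an \<open>H\<close>-invariant representative \<open>e\<close>; then \<open>N z \<cdot> e\<close> agrees with \<open>N (z e)\<close> up
  to boundaries.\<close>

lemma graded_ideal_K: "graded_ideal K F"
proof -
  have mul: "x \<star> y \<in> K \<and> y \<star> x \<in> K" if x: "x \<in> K" and y: "y \<in> F" for x y
  proof -
    obtain z where z: "z \<in> cocycles" "z \<in> E" "x - N z \<in> boundaries" using K_E[OF x] by blast
    obtain e where e: "e \<in> F" "e \<in> E" "y - e \<in> boundaries" "\<Delta> e \<in> boundaries"
      using F_representative[OF y] by blast
    have Nz: "N z \<in> cocycles" using z by (simp add: N_def)
    have "x \<star> y - N (z \<star> e) = (x - N z) \<star> y + N z \<star> (y - e) + (N z \<star> e - N (z \<star> e))"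
      by (simp add: mul_distribs)
    also have "\<dots> \<in> boundaries"
      using z e y Nz by (intro boundaries_closed(2) boundaries_mul N_mul_stable) simp_all
    finally have 1: "x \<star> y \<in> K" using z e by (intro K_I[of "z \<star> e"]) simp_all
    have "y \<star> x - N (e \<star> z) = y \<star> (x - N z) + (y - e) \<star> N z + (e \<star> N z - N (e \<star> z))"
      by (simp add: mul_distribs)
    also have "\<dots> \<in> boundaries"
      using z e y Nz by (intro boundaries_closed(2) boundaries_mul N_mul_stable) simp_all
    finally have "y \<star> x \<in> K" using z e by (intro K_I[of "e \<star> z"]) simp_all
    then show ?thesis using 1 by simp
  qed
  have add: "x + y \<in> K" if x: "x \<in> K" and y: "y \<in> K" for x y
  proof -
    obtain z z' where z: "z \<in> cocycles" "z \<in> E" "x - N z \<in> boundaries"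
      and z': "z' \<in> cocycles" "z' \<in> E" "y - N z' \<in> boundaries"
      using K_E[OF x] K_E[OF y] by blast
    have "x + y - N (z + z') = (x - N z) + (y - N z')" by (simp add: N_add)
    then have "x + y - N (z + z') \<in> boundaries" using z z' by (metis boundaries_closed(2))
    then show ?thesis using z z' by (intro K_I[of "z + z'"]) simp_all
  qed
  have scl: "scl c x \<in> K \<and> pr n x \<in> K" if x: "x \<in> K" for x c n
  proof -
    obtain z where z: "z \<in> cocycles" "z \<in> E" "x - N z \<in> boundaries" using K_E[OF x] by blast
    have "scl c x - N (scl c z) \<in> boundaries" "pr n x - N (pr n z) \<in> boundaries"
      using z(3) by (simp_all add: N_scl N_pr scale_right_diff_distrib[symmetric] pr.diff[symmetric])
    moreover have "pr n z \<in> E" using z(2) by (rule E_pr)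
    ultimately show ?thesis using z K_I[of "scl c z"] K_I[of "pr n z"] by simp
  qed
  have "K \<subseteq> F" using K_subset_P P_subset_F by (rule subset_trans)
  moreover have "0 \<in> K" using boundaries_subset_K boundaries_closed(1) by (rule subsetD)
  ultimately show ?thesis using mul add scl by (rule graded_ideal_I)
qed

lemmas K_closed = graded_ideal_closed[OF graded_ideal_K]

lemma boundaries_K: "x \<in> boundaries \<Longrightarrow> x \<in> K"
  using boundaries_subset_K by blast

text \<open>If \<open>\<Delta> e = d y\<close>, the norm \<open>b\<close> of \<open>y\<close> is the obstruction to an invariant representative of the class of
  \<open>e\<close>. The element \<open>b m\<close> has the same norm, and \<open>d (b m) = - \<Delta> (s b \<cdot> h)\<close>, so \<open>e + s b \<cdot> h\<close> is unobstructed.\<close>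

theorem stable_decomposition:
  assumes c: "c \<in> F"
  shows "\<exists>a\<in>invariant_cocycles. \<exists>b\<in>invariant_cocycles. c - (a + b \<star> h) \<in> boundaries"
proof -
  obtain e where e: "e \<in> F" "e \<in> E" "c - e \<in> boundaries" using F_representative[OF c] by blast
  obtain y where y: "y \<in> E" "\<Delta> e = d y" using F_\<Delta>[OF e(1,2)] by blast
  define b where "b = N y"
  have "d b = N (\<Delta> e)" by (simp add: b_def N_d[symmetric] y)
  then have b: "b \<in> invariant_cocycles"
    using y(1) e by (intro invariant_cocycles_I) (simp_all add: N_\<Delta> \<Delta>_N b_def)
  have "N (y - b \<star> m) = 0" using b by (simp add: N_diff N_m_mul b_def[symmetric])
  then obtain v where v: "v \<in> E" "y - b \<star> m = \<Delta> v"
    using N_kernel[of "y - b \<star> m"] y b by auto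
  define a where "a = e + s b \<star> h - d v"
  have "\<sigma> (s b) = s b" using b by (simp add: invariants_\<sigma>)
  then have "\<Delta> (s b \<star> h) = - (s b \<star> d m)" using b by (simp add: \<Delta>_mul d_m mul_right.minus)
  moreover have "d y = s b \<star> d m + \<Delta> (d v)"
  proof -
    have "d y = d (b \<star> m + \<Delta> v)" using v(2) by (simp add: algebra_simps)
    then show ?thesis using b by (simp add: d_add d_mul \<Delta>_d)
  qed
  ultimately have "\<Delta> a = 0" by (simp add: a_def \<Delta>.add \<Delta>.diff y)
  then have "a \<in> invariant_cocycles"
    using e b v by (intro invariant_cocycles_I) (simp_all add: a_def d_add d.diff d_mul)
  moreover have eq: "c - (a + (- s b) \<star> h) = (c - e) + d v" by (simp add: a_def mul_left.minus)
  have "c - (a + (- s b) \<star> h) \<in> boundaries"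
    unfolding eq using e v by (simp add: mem_boundaries E_C)
  ultimately show ?thesis using b by (intro bexI[of _ a] bexI[of _ "- s b"]) auto
qed

lemma graded_stable_decomposition:
  assumes c: "c \<in> F"
  shows "\<exists>a\<in>P. \<exists>b. (case n of 0 \<Rightarrow> b = 0 | Suc k \<Rightarrow> \<exists>b'\<in>P. b = pr k b')
    \<and> pr n c - (pr n a + b \<star> h) \<in> boundaries"
proof -
  obtain a b where ab: "a \<in> invariant_cocycles" "b \<in> invariant_cocycles"
    "c - (a + b \<star> h) \<in> boundaries"
    using stable_decomposition[OF c] by blast
  have "pr n c - (pr n a + pr n (b \<star> h)) \<in> boundaries"
    using boundaries_closed(6)[OF ab(3), of n] by (simp add: pr.diff pr_add)
  then show ?thesis
    using ab P_I[of a a] P_I[of b b]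
    by (intro bexI[of _ a] exI[of _ "case n of 0 \<Rightarrow> 0 | Suc k \<Rightarrow> pr k b"])
      (auto simp: pr_h_0 pr_h_Suc split: nat.splits)
qed

text \<open>Write \<open>b h = N z - a + d e\<close> and apply \<open>\<Delta>\<close>. As \<open>\<Delta> (b h) = - b \<cdot> d m = - d (s b \<cdot> m)\<close>, the cochain
  \<open>\<Delta> e + s b \<cdot> m\<close> is a cocycle, and its norm is \<open>s b\<close>.\<close>

theorem decomposition_unique_modulo_norms:
  assumes "a \<in> P" "b \<in> P" and ab: "a + b \<star> h \<in> K"
  shows "a \<in> K" "b \<in> K"
proof -
  obtain a' b' where a': "a' \<in> invariant_cocycles" "a - a' \<in> boundaries"
    and b': "b' \<in> invariant_cocycles" "b - b' \<in> boundaries"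
    using assms(1,2) unfolding P_def by blast
  have "a' + b' \<star> h = (a + b \<star> h) - ((a - a') + (b - b') \<star> h)" by (simp add: mul_distribs)
  also have "\<dots> \<in> K"
    using ab a' b' boundaries_mul(1)[OF b'(2) h_cocycles]
    by (intro K_closed(9)[OF ab boundaries_K] boundaries_closed(2))
  finally obtain z where z: "z \<in> cocycles" "z \<in> E" "(a' + b' \<star> h) - N z \<in> boundaries"
    using K_E by blast
  moreover have "(a' + b' \<star> h) - N z \<in> E" using a' b' z by simp
  ultimately obtain e where e: "e \<in> E" "(a' + b' \<star> h) - N z = d e" using boundaries_E by blast
  have Nz: "\<Delta> (N z) = 0" using z by (simp add: \<Delta>_N)
  have "\<sigma> b' = b'" using b' by (simp add: invariants_\<sigma>)
  then have "\<Delta> (d e) = - (b' \<star> d m)"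
    using a' b' Nz by (simp add: e(2)[symmetric] \<Delta>.add \<Delta>.diff \<Delta>_mul d_m mul_right.minus)
  then have "d (\<Delta> e + s b' \<star> m) = 0" using b' by (simp add: d_add \<Delta>_d[symmetric] d_mul)
  moreover have w: "s (\<Delta> e + s b' \<star> m) \<in> E"
    by (rule E_closed(11), rule E_closed(5)) (use e(1) b'(1) in simp_all)
  ultimately have w': "s (\<Delta> e + s b' \<star> m) \<in> cocycles"
    by (intro cocycles_I E_C) (simp_all add: d_s)
  have "N (s (\<Delta> e + s b' \<star> m)) = b'"
    using e b' N_m_mul(2)[of "s b'"] by (simp add: N_s N_add N_\<Delta>)
  then have b'K: "b' \<in> K" using K_I[OF w' w, of b'] by simp
  show b: "b \<in> K" using K_closed(3)[OF boundaries_K[OF b'(2)] b'K] by simp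
  then have "b \<star> h \<in> K" by (simp add: K_closed(4))
  then show "a \<in> K" using K_closed(9)[OF ab] by fastforce
qed

end

section \<open>Presentations of graded algebras\<close>

context dg_algebra
begin

text \<open>\<open>R\<close> is the quotient of the graded subalgebra \<open>S\<close> of \<open>C\<close> by the graded ideal \<open>K\<close>, with projection \<open>k\<close>.
  Passing to a subalgebra of \<open>R\<close> shrinks \<open>S\<close> and passing to a quotient enlarges \<open>K\<close>
  (\<open>pres_graded_sub\<close>, \<open>pres_graded_quot\<close>).\<close>

definition presents ::
  "('k, 'v) graded_algebra \<Rightarrow> ('r \<Rightarrow> 'v) \<Rightarrow> 'r set \<Rightarrow> 'r set \<Rightarrow> bool" where
  "presents R k S K \<longleftrightarrow> graded_subalgebra S \<and> graded_ideal K S \<and> carrier R = k ` S \<and>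
     (\<forall>x\<in>S. \<forall>y\<in>S. k x \<oplus>\<^bsub>R\<^esub> k y = k (x + y) \<and> k x \<otimes>\<^bsub>R\<^esub> k y = k (x \<star> y) \<and>
        (k x = k y \<longleftrightarrow> x - y \<in> K)) \<and>
     \<one>\<^bsub>R\<^esub> = k u \<and> \<zero>\<^bsub>R\<^esub> = k 0 \<and> (\<forall>c. \<forall>x\<in>S. c \<odot>\<^bsub>R\<^esub> k x = k (scl c x)) \<and>
     (\<forall>n. component R n = k ` pr n ` S)"

lemma graded_subalgebra_s:
  assumes S: "graded_subalgebra S" and x: "x \<in> S" shows "s x \<in> S"
proof -
  obtain N where N: "x = (\<Sum>n<N. pr n x)"
    using pr_finite[OF graded_subalgebra_closed(1)[OF S x]] by blast
  have "s (\<Sum>n<k. pr n x) \<in> S" for k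
    by (induction k) (simp_all add: graded_subalgebra_closed[OF S] x s_add s_pr)
  then show ?thesis using N by metis
qed

end

locale presentation = dg_algebra +
  fixes R :: "('a, 'v) graded_algebra" (structure) and k :: "'b \<Rightarrow> 'v" and S K :: "'b set"
  assumes pres: "presents R k S K"
begin

lemma S: "graded_subalgebra S" and K: "graded_ideal K S"
  using pres by (auto simp: presents_def)

lemmas S_closed [simp] = graded_subalgebra_closed(2-)[OF S]
lemmas K_closed = graded_ideal_closed[OF K]

lemma pres_carrier: "carrier R = k ` S"
  and pres_add: "x \<in> S \<Longrightarrow> y \<in> S \<Longrightarrow> k x \<oplus> k y = k (x + y)"
  and pres_mult: "x \<in> S \<Longrightarrow> y \<in> S \<Longrightarrow> k x \<otimes> k y = k (x \<star> y)"
  and pres_eq: "x \<in> S \<Longrightarrow> y \<in> S \<Longrightarrow> k x = k y \<longleftrightarrow> x - y \<in> K"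
  and pres_one: "\<one> = k u" and pres_zero: "\<zero> = k 0"
  and pres_smult: "x \<in> S \<Longrightarrow> c \<odot>\<^bsub>R\<^esub> k x = k (scl c x)"
  and pres_component: "component R n = k ` pr n ` S"
  using pres by (simp_all add: presents_def)

lemma pres_ring: "ring R"
proof (rule ringI)
  show "abelian_group R"
  proof (rule abelian_groupI)
    fix X assume "X \<in> carrier R"
    then obtain x where "x \<in> S" "X = k x" by (auto simp: pres_carrier)
    then show "\<exists>Y\<in>carrier R. Y \<oplus> X = \<zero>"
      by (intro bexI[of _ "k (- x)"]) (simp_all add: pres_add pres_zero pres_carrier)
  qed (auto simp: pres_carrier pres_add pres_zero add_ac)
  show "Group.monoid R"
    by (rule monoidI) (auto simp: pres_carrier pres_mult pres_one mul_assoc)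
qed (auto simp: pres_carrier pres_mult pres_add mul_distribs)

lemma pres_uminus: "x \<in> S \<Longrightarrow> \<ominus> k x = k (- x)"
proof -
  interpret R: ring R by (rule pres_ring)
  assume x: "x \<in> S"
  then have "k (- x) \<oplus> k x = \<zero>" by (simp add: pres_add pres_zero)
  then show ?thesis using x R.minus_equality[of "k (- x)" "k x"] by (simp add: pres_carrier)
qed

lemma pres_minus: "x \<in> S \<Longrightarrow> y \<in> S \<Longrightarrow> k x \<ominus> k y = k (x - y)"
  by (simp add: a_minus_def pres_uminus pres_add)

lemma pres_finsum:
  fixes N :: nat
  assumes f: "\<And>n. f n \<in> S"
  shows "(\<Oplus>n\<in>{..<N}. k (f n)) = k (\<Sum>n<N. f n)" "(\<Sum>n<N. f n) \<in> S"
proof -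
  interpret R: ring R by (rule pres_ring)
  have sum: "(\<Sum>n<N. f n) \<in> S" for N by (induction N) (simp_all add: f)
  show "(\<Oplus>n\<in>{..<N}. k (f n)) = k (\<Sum>n<N. f n)"
  proof (induction N)
    case (Suc N)
    then show ?case
      by (simp add: lessThan_Suc R.finsum_insert Pi_def pres_carrier f sum pres_add)
  qed (simp add: pres_zero)
  show "(\<Sum>n<N. f n) \<in> S" by (rule sum)
qed

text \<open>Uniqueness of the decomposition into homogeneous parts holds because \<open>K\<close> is graded: apply the
  projections \<open>pr j\<close> to the difference of two decompositions.\<close>

lemma pres_homogeneous_part:
  assumes x: "x \<in> S"
  shows "homogeneous_part R (k x) = (\<lambda>n. k (pr n x))"
proof -
  interpret R: ring R by (rule pres_ring)
  have finsum: "(\<Oplus>n\<in>{n. D n \<noteq> \<zero>}. D n) = (\<Oplus>n\<in>{..<N}. D n)"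
    if "{n. D n \<noteq> \<zero>} \<subseteq> {..<N}" "\<And>n. D n \<in> carrier R" for D and N :: nat
    by (rule R.add.finprod_mono_neutral_cong_left) (use that in auto)
  show ?thesis unfolding homogeneous_part_def
  proof (rule the_equality, intro conjI allI)
    fix n
    show "k (pr n x) \<in> component R n" using x by (auto simp: pres_component)
    obtain N where N: "\<forall>n\<ge>N. pr n x = 0" "x = (\<Sum>n<N. pr n x)"
      using pr_finite[OF graded_subalgebra_closed(1)[OF S x]] by blast
    have sub: "{n. k (pr n x) \<noteq> \<zero>} \<subseteq> {..<N}"
      using N(1) by (auto simp: pres_zero not_less[symmetric])
    then show "finite {n. k (pr n x) \<noteq> \<zero>}" by (rule finite_subset) simp
    show "k x = (\<Oplus>n\<in>{n. k (pr n x) \<noteq> \<zero>}. k (pr n x))"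
      using finsum[OF sub] x pres_finsum(1)[of "\<lambda>n. pr n x" N] N(2) by (simp add: pres_carrier)
  next
    fix D assume D: "(\<forall>n. D n \<in> component R n) \<and> finite {n. D n \<noteq> \<zero>} \<and>
      k x = (\<Oplus>n\<in>{n. D n \<noteq> \<zero>}. D n)"
    have "\<forall>n. \<exists>y\<in>S. D n = k (pr n y)" using D by (simp add: pres_component) blast
    then obtain y where y: "\<And>n. y n \<in> S" "\<And>n. D n = k (pr n (y n))" by metis
    obtain N where N: "\<forall>n\<in>{n. D n \<noteq> \<zero>}. n < N"
      using D unfolding finite_nat_set_iff_bounded by blast
    then have sub: "{n. D n \<noteq> \<zero>} \<subseteq> {..<N}" by auto
    have "k x = (\<Oplus>n\<in>{..<N}. D n)"
      using D finsum[OF sub] y by (simp add: pres_carrier)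
    also have "\<dots> = k (\<Sum>n<N. pr n (y n))"
      unfolding y(2) by (rule pres_finsum) (simp add: y)
    finally have "x - (\<Sum>n<N. pr n (y n)) \<in> K"
      using x pres_finsum(2)[of "\<lambda>n. pr n (y n)" N] by (simp add: pres_eq y)
    then have "pr j (x - (\<Sum>n<N. pr n (y n))) \<in> K" for j by (rule K_closed)
    then have diff: "pr j x - (if j < N then pr j (y j) else 0) \<in> K" for j
      by (simp add: pr.diff pr.sum pr_pr sum.delta)
    show "D = (\<lambda>n. k (pr n x))"
    proof
      fix j
      show "D j = k (pr j x)"
      proof (cases "j < N")
        case True
        then show ?thesis
          using diff[of j] x y(1)[of j] by (simp add: y(2) pres_eq[symmetric])
      next
        case False
        then have "k (pr j x) = k 0" using diff[of j] x by (simp add: pres_eq)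
        then show ?thesis using False N by (auto simp: pres_zero)
      qed
    qed
  qed
qed

lemma pres_sign_map:
  assumes x: "x \<in> S"
  shows "sign_map R (k x) = k (s x)"
proof -
  interpret R: ring R by (rule pres_ring)
  obtain N where N: "\<forall>n\<ge>N. pr n x = 0" "x = (\<Sum>n<N. pr n x)"
    using pr_finite[OF graded_subalgebra_closed(1)[OF S x]] by blast
  have sm: "(- 1) ^ n \<odot>\<^bsub>R\<^esub> k (pr n x) = k (scl ((- 1) ^ n) (pr n x))" for n
    using x by (simp add: pres_smult)
  have sub: "{n. k (pr n x) \<noteq> \<zero>} \<subseteq> {..<N}"
    using N(1) by (auto simp: pres_zero not_less[symmetric])
  have "sign_map R (k x) = (\<Oplus>n\<in>{n. k (pr n x) \<noteq> \<zero>}. k (scl ((- 1) ^ n) (pr n x)))"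
    by (simp add: sign_map_def pres_homogeneous_part[OF x] sm)
  also have "\<dots> = (\<Oplus>n\<in>{..<N}. k (scl ((- 1) ^ n) (pr n x)))"
  proof (rule R.add.finprod_mono_neutral_cong_left)
    fix n assume "n \<in> {..<N} - {n. k (pr n x) \<noteq> \<zero>}"
    then have "pr n x \<in> K" using x pres_eq[of "pr n x" 0] by (simp add: pres_zero)
    then show "k (scl ((- 1) ^ n) (pr n x)) = \<zero>"
      using x pres_eq[of "scl ((- 1) ^ n) (pr n x)" 0] K_closed(6) by (simp add: pres_zero)
  qed (use sub x in \<open>auto simp: pres_carrier\<close>)
  also have "\<dots> = k (\<Sum>n<N. s (pr n x))"
    using x pres_finsum(1)[of "\<lambda>n. scl ((- 1) ^ n) (pr n x)" N] by (simp add: s_pr)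
  also have "(\<Sum>n<N. s (pr n x)) = s x"
    using N(2) by (metis s.sum)
  finally show ?thesis .
qed

lemma pres_graded_sub:
  assumes S': "graded_subalgebra S'" "S' \<subseteq> S" "K \<subseteq> S'"
  shows "presents (graded_sub R (k ` S')) k S' K"
proof -
  have K': "graded_ideal K S'" by (rule graded_ideal_subset[OF K S'(3,2)])
  have comp: "component R n \<inter> k ` S' = k ` pr n ` S'" for n
  proof (rule subset_antisym; rule subsetI)
    fix t assume "t \<in> component R n \<inter> k ` S'"
    then obtain x y where xy: "x \<in> S" "t = k (pr n x)" "y \<in> S'" "t = k y"
      by (auto simp: pres_component)
    have y: "y \<in> S" using xy S' by blast
    have "pr n x - y \<in> K" using xy y pres_eq[of "pr n x" y] by simp
    then have "pr n (pr n x - y) \<in> K" by (rule K_closed)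
    then have "k (pr n x) = k (pr n y)" using xy y by (simp add: pr.diff pr_pr pres_eq)
    then show "t \<in> k ` pr n ` S'" using xy by auto
  next
    fix t assume "t \<in> k ` pr n ` S'"
    then show "t \<in> component R n \<inter> k ` S'"
      using S' graded_subalgebra_closed(7)[OF S'(1)] by (auto simp: pres_component)
  qed
  show ?thesis
    unfolding presents_def graded_sub_def using S' K' comp
    by (auto simp: pres_add pres_mult pres_eq pres_one pres_zero pres_smult subset_iff)
qed

lemma pres_ideal:
  assumes K': "graded_ideal K' S"
  shows "ideal (k ` K') R"
proof -
  interpret R: ring R by (rule pres_ring)
  note K'_closed = graded_ideal_closed[OF K']
  show ?thesis
  proof (rule idealI[OF pres_ring])
    show "subgroup (k ` K') (add_monoid R)"
    proof (rule R.add.subgroupI)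
      fix X assume "X \<in> k ` K'"
      then obtain x where x: "x \<in> K'" "X = k x" by auto
      then have "\<ominus> X = k (- x)"
        using pres_uminus[of x] K'_closed(1) by simp
      then show "\<ominus> X \<in> k ` K'" using x K'_closed(8) by auto
    next
      fix X Y assume "X \<in> k ` K'" "Y \<in> k ` K'"
      then show "X \<oplus> Y \<in> k ` K'"
        using K'_closed(1,3) by (auto simp: pres_add)
    qed (use K'_closed(1,2) in \<open>auto simp: pres_carrier\<close>)
  qed (use K'_closed(1,4,5) in \<open>auto simp: pres_carrier pres_mult\<close>)
qed

lemma pres_graded_quot:
  assumes K': "graded_ideal K' S" "K \<subseteq> K'"
  shows "presents (graded_quot R (k ` K')) (\<lambda>x. k ` K' +>\<^bsub>R\<^esub> k x) S K'"
proof -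
  interpret R: ring R by (rule pres_ring)
  interpret I: ideal "k ` K'" R by (rule pres_ideal[OF K'(1)])
  note K'_closed = graded_ideal_closed[OF K'(1)]
  let ?cl = "\<lambda>x. k ` K' +>\<^bsub>R\<^esub> k x"
  have in_R: "k x \<in> carrier R" if "x \<in> S" for x using that by (auto simp: pres_carrier)
  have mem: "k x \<in> k ` K' \<longleftrightarrow> x \<in> K'" if "x \<in> S" for x
  proof
    assume "k x \<in> k ` K'"
    then obtain y where y: "y \<in> K'" "k x = k y" by auto
    then have "x - y \<in> K'" using that K'_closed(1) K'(2) pres_eq by blast
    then show "x \<in> K'" using K'_closed(3)[OF _ y(1), of "x - y"] by simp
  qed auto
  have eq: "?cl x = ?cl y \<longleftrightarrow> x - y \<in> K'" if x: "x \<in> S" and y: "y \<in> S" for x y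
    using R.quotient_eq_iff_same_a_r_cos[OF I.ideal_axioms in_R[OF x] in_R[OF y]] mem[of "x - y"] x y
    by (simp add: pres_minus)
  have smult: "(\<Union>X\<in>?cl x. k ` K' +>\<^bsub>R\<^esub> (c \<odot>\<^bsub>R\<^esub> X)) = ?cl (scl c x)" if x: "x \<in> S" for c x
  proof (rule SUP_eq_const)
    show "?cl x \<noteq> {}" using I.a_rcos_self[OF in_R[OF x]] by blast
    fix X assume X: "X \<in> ?cl x"
    have "X \<in> carrier R" by (rule I.a_elemrcos_carrier[OF in_R[OF x] X])
    then obtain y where y: "y \<in> S" "X = k y" by (auto simp: pres_carrier)
    have "?cl x = ?cl y" using I.a_repr_independence'[OF X in_R[OF x]] y by simp
    then have "x - y \<in> K'" using eq x y by simp
    then have "scl c x - scl c y \<in> K'"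
      using K'_closed(6)[of "x - y" c] by (simp add: scale_right_diff_distrib)
    then have "?cl (scl c x) = ?cl (scl c y)" using eq x y by simp
    then show "k ` K' +>\<^bsub>R\<^esub> (c \<odot>\<^bsub>R\<^esub> X) = ?cl (scl c x)" using y by (simp add: pres_smult)
  qed
  have zero: "?cl 0 = k ` K'"
    using I.a_rcos_const[of "k 0"] K'_closed(2) by simp
  have "carrier (R Quot k ` K') = (\<lambda>X. k ` K' +>\<^bsub>R\<^esub> X) ` carrier R"
    by (auto simp: FactRing_simps)
  then have carrier: "carrier (R Quot k ` K') = ?cl ` S" by (simp add: pres_carrier image_image)
  have ops: "monoid.mult (R Quot k ` K') = rcoset_mult R (k ` K')" "ring.add (R Quot k ` K') = set_add R"
    "monoid.one (R Quot k ` K') = ?cl u" "ring.zero (R Quot k ` K') = k ` K'"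
    by (simp_all add: FactRing_def pres_one)
  show ?thesis
    unfolding presents_def using S K'(1)
    by (simp add: graded_quot_def induced_def carrier ops eq smult zero I.a_rcos_sum in_R
        I.rcoset_mult_add pres_add pres_mult pres_component image_image)
qed

end

section \<open>Stable classes modulo norms\<close>

context degenerate_dg_algebra
begin

lemma commutator_closed:
  assumes a: "a \<in> P"
  shows "h \<star> a - s a \<star> h \<in> P"
proof -
  obtain b where b: "b \<in> invariant_cocycles" "a - b \<in> boundaries"
    using a unfolding P_def by blast
  have 1: "h \<star> b - s b \<star> h \<in> P" by (rule commutator_in_P[OF b(1)])
  have "h \<star> (a - b) - s (a - b) \<star> h \<in> boundaries"
    by (rule boundaries_closed(3)[OF boundaries_mul(2) boundaries_mul(1)]) (use b in simp_all)
  then have 2: "h \<star> (a - b) - s (a - b) \<star> h \<in> P"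
    using boundaries_subset_K K_subset_P by blast
  have "h \<star> a - s a \<star> h = (h \<star> b - s b \<star> h) + (h \<star> (a - b) - s (a - b) \<star> h)"
    by (simp add: mul_distribs s.diff)
  then show ?thesis
    using graded_subalgebra_closed(4)[OF graded_subalgebra_P 1 2] by simp
qed

lemma K_commutator:
  assumes a: "a \<in> K"
  shows "h \<star> a - s a \<star> h \<in> K"
proof -
  have "s a \<in> K"
  proof -
    obtain z where z: "z \<in> cocycles" "z \<in> E" "a - N z \<in> boundaries" using K_E[OF a] by blast
    have "s a - N (s z) \<in> boundaries"
      using boundaries_closed(7)[OF z(3)] by (simp add: s.diff N_s)
    then show ?thesis using z by (intro K_I[of "s z"]) simp_all
  qed
  then show ?thesis
    using a graded_ideal_closed(4,5,9)[OF graded_ideal_K] by simp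
qed

lemma P_in_F: "x \<in> P \<Longrightarrow> x \<in> F"
  using P_subset_F by blast

lemma decomposition_modulo_norms:
  assumes "c \<in> F"
  shows "\<exists>a\<in>P. \<exists>b\<in>P. c - (a + b \<star> h) \<in> K"
proof -
  obtain a b where ab: "a \<in> invariant_cocycles" "b \<in> invariant_cocycles"
    "c - (a + b \<star> h) \<in> boundaries" using stable_decomposition[OF assms] by blast
  have "a \<in> P" "b \<in> P" using ab P_I[of a a] P_I[of b b] by simp_all
  then show ?thesis using boundaries_K[OF ab(3)] by blast
qed

text \<open>Through the presentations, each assumption on a quadratic extension becomes a statement about
  cochains: span and freeness are the two decomposition theorems, closure of \<open>B\<close> under \<open>D\<close> is
  \<open>commutator_closed\<close>, and \<open>y\<^sup>2 \<in> B\<close> is \<open>square_in_P\<close>.\<close>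

theorem degenerate_structure:
  fixes T B :: "('a, 'v) graded_algebra" and k :: "'b \<Rightarrow> 'v" and D :: "'v \<Rightarrow> 'v"
  assumes T: "presents T k F K" and B: "presents B k P K"
    and ops: "monoid.mult B = monoid.mult T" "ring.add B = ring.add T" "monoid.one B = monoid.one T"
      "ring.zero B = ring.zero T" "smult B = smult T"
    and D: "\<And>a. a \<in> P \<Longrightarrow> D (k a) = k (h \<star> a - s a \<star> h)"
  shows "\<exists>f. f \<in> graded_algebra_iso T (graded_quot (skew_poly B D) (Idl\<^bsub>skew_poly B D\<^esub>
    {(skew_var B \<otimes>\<^bsub>skew_poly B D\<^esub> skew_var B) \<ominus>\<^bsub>skew_poly B D\<^esub> skew_const B (k (h \<star> h))}))"
proof -
  interpret T: presentation scl mul u C d s pr T k F K by unfold_locales (rule T)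
  interpret B: presentation scl mul u C d s pr B k P K by unfold_locales (rule B)
  interpret RT: ring T by (rule T.pres_ring)
  note PF = P_in_F
  note Fc = graded_subalgebra_closed[OF graded_subalgebra_F]
  note Pc = graded_subalgebra_closed[OF graded_subalgebra_P]
  have sP: "s x \<in> P" if "x \<in> P" for x by (rule graded_subalgebra_s[OF graded_subalgebra_P that])
  have "quadratic_extension T B (k h) (k (h \<star> h)) D"
  proof (intro quadratic_extension.intro quadratic_extension_axioms.intro)
    show "ring T" by (rule T.pres_ring)
    show "ring B" by (rule B.pres_ring)
    show "carrier B \<subseteq> carrier T" using PF by (auto simp: B.pres_carrier T.pres_carrier)
    show "k h \<in> carrier T" by (simp add: T.pres_carrier)
    show "k (h \<star> h) \<in> carrier B" using square_in_P by (simp add: B.pres_carrier)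
    show "sign_map B X \<in> carrier B" if "X \<in> carrier B" for X
      using that sP by (auto simp: B.pres_carrier B.pres_sign_map)
    show "D X \<in> carrier B" if "X \<in> carrier B" for X
      using that commutator_closed by (auto simp: B.pres_carrier D)
    show "k h \<otimes>\<^bsub>T\<^esub> X = sign_map B X \<otimes>\<^bsub>T\<^esub> k h \<oplus>\<^bsub>T\<^esub> D X" if X: "X \<in> carrier B" for X
    proof -
      obtain a where a: "a \<in> P" "X = k a" using X by (auto simp: B.pres_carrier)
      have "s a \<star> h + (h \<star> a - s a \<star> h) = h \<star> a" by simp
      then show ?thesis
        using a PF PF[OF sP[OF a(1)]] PF[OF commutator_closed[OF a(1)]]
        by (simp add: B.pres_sign_map D T.pres_mult T.pres_add Fc(5))
    qed
    show "k h \<otimes>\<^bsub>T\<^esub> k h = k (h \<star> h)" by (simp add: T.pres_mult)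
    show "\<exists>a\<in>carrier B. \<exists>b\<in>carrier B. t = a \<oplus>\<^bsub>T\<^esub> b \<otimes>\<^bsub>T\<^esub> k h" if t: "t \<in> carrier T" for t
    proof -
      obtain c where c: "c \<in> F" "t = k c" using t by (auto simp: T.pres_carrier)
      obtain a b where ab: "a \<in> P" "b \<in> P" "c - (a + b \<star> h) \<in> K"
        using decomposition_modulo_norms[OF c(1)] by blast
      then have "t = k (a + b \<star> h)" using c PF by (simp add: T.pres_eq Fc)
      then have "t = k a \<oplus>\<^bsub>T\<^esub> k b \<otimes>\<^bsub>T\<^esub> k h"
        using ab PF by (simp add: T.pres_mult T.pres_add Fc)
      then show ?thesis using ab by (auto simp: B.pres_carrier)
    qed
    show "X = \<zero>\<^bsub>T\<^esub> \<and> Y = \<zero>\<^bsub>T\<^esub>"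
      if X: "X \<in> carrier B" and Y: "Y \<in> carrier B" and XY: "X \<oplus>\<^bsub>T\<^esub> Y \<otimes>\<^bsub>T\<^esub> k h = \<zero>\<^bsub>T\<^esub>" for X Y
    proof -
      obtain a b where ab: "a \<in> P" "b \<in> P" "X = k a" "Y = k b"
        using X Y by (auto simp: B.pres_carrier)
      have F: "a \<in> F" "b \<in> F" using ab PF by simp_all
      have "k (a + b \<star> h) = k 0"
        using XY F by (simp add: ab T.pres_mult T.pres_add T.pres_zero Fc(5))
      then have "a + b \<star> h \<in> K" using F by (simp add: T.pres_eq Fc)
      from decomposition_unique_modulo_norms[OF ab(1,2) this]
      show ?thesis using F by (simp add: ab T.pres_zero T.pres_eq)
    qed
    show "c \<odot>\<^bsub>T\<^esub> X \<in> carrier T" if "X \<in> carrier T" for c X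
      using that by (auto simp: T.pres_carrier T.pres_smult Fc(6))
    show "c \<odot>\<^bsub>T\<^esub> X \<in> carrier B" if "X \<in> carrier B" for c X
      using that PF by (auto simp: B.pres_carrier T.pres_smult Pc(6))
    show "c \<odot>\<^bsub>T\<^esub> (X \<oplus>\<^bsub>T\<^esub> Y) = c \<odot>\<^bsub>T\<^esub> X \<oplus>\<^bsub>T\<^esub> c \<odot>\<^bsub>T\<^esub> Y"
      if "X \<in> carrier T" "Y \<in> carrier T" for c X Y
      using that by (auto simp: T.pres_carrier T.pres_smult T.pres_add Fc scale_right_distrib)
    show "c \<odot>\<^bsub>T\<^esub> (X \<otimes>\<^bsub>T\<^esub> Y) = (c \<odot>\<^bsub>T\<^esub> X) \<otimes>\<^bsub>T\<^esub> Y"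
      if "X \<in> carrier T" "Y \<in> carrier T" for c X Y
      using that by (auto simp: T.pres_carrier T.pres_smult T.pres_mult Fc scl_mul_left)
    show "component T n \<subseteq> carrier T" for n
      by (auto simp: T.pres_component T.pres_carrier)
    show "component B n \<subseteq> component T n \<inter> carrier B" for n
      using PF Pc(7) by (auto simp: T.pres_component B.pres_component B.pres_carrier)
    show "\<zero>\<^bsub>T\<^esub> \<in> component B n" for n
    proof -
      have "k (pr n 0) \<in> component B n" unfolding B.pres_component using Pc(3) by blast
      then show ?thesis by (simp add: T.pres_zero)
    qed
    show "X \<oplus>\<^bsub>T\<^esub> Y \<in> component T n" if X: "X \<in> component T n" and Y: "Y \<in> component T n" for X Y n
    proof -
      obtain x y where "x \<in> F" "y \<in> F" "X = k (pr n x)" "Y = k (pr n y)"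
        using X Y by (auto simp: T.pres_component)
      then have "X \<oplus>\<^bsub>T\<^esub> Y = k (pr n (x + y))" "x + y \<in> F"
        by (simp_all add: T.pres_add Fc pr_add)
      then show ?thesis by (simp add: T.pres_component)
    qed
    show "X \<otimes>\<^bsub>T\<^esub> k h \<in> component T (Suc n)" if X: "X \<in> component T n" for X n
    proof -
      obtain x where "x \<in> F" "X = k (pr n x)" using X by (auto simp: T.pres_component)
      then have "X \<otimes>\<^bsub>T\<^esub> k h = k (pr (Suc n) (x \<star> h))" "x \<star> h \<in> F"
        by (simp_all add: T.pres_mult Fc pr_h_Suc)
      then show ?thesis by (simp add: T.pres_component)
    qed
    show "\<exists>a\<in>component B n. \<exists>b. X = a \<oplus>\<^bsub>T\<^esub> b \<otimes>\<^bsub>T\<^esub> k h \<and>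
        (case n of 0 \<Rightarrow> b = \<zero>\<^bsub>T\<^esub> | Suc j \<Rightarrow> b \<in> component B j)" if X: "X \<in> component T n" for X n
    proof -
      obtain c where c: "c \<in> F" "X = k (pr n c)" using X by (auto simp: T.pres_component)
      obtain a b where a: "a \<in> P"
        and b: "case n of 0 \<Rightarrow> b = 0 | Suc j \<Rightarrow> \<exists>b'\<in>P. b = pr j b'"
        and ab: "pr n c - (pr n a + b \<star> h) \<in> boundaries"
        using graded_stable_decomposition[OF c(1)] by blast
      have bP: "b \<in> P" using b Pc(3,7) by (auto split: nat.splits)
      have "X = k (pr n a + b \<star> h)"
        using boundaries_K[OF ab] a bP c PF by (simp add: T.pres_eq Fc)
      then have "X = k (pr n a) \<oplus>\<^bsub>T\<^esub> k b \<otimes>\<^bsub>T\<^esub> k h"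
        using a bP PF by (simp add: T.pres_mult T.pres_add Fc)
      moreover have "k (pr n a) \<in> component B n" using a by (simp add: B.pres_component)
      moreover have "case n of 0 \<Rightarrow> k b = \<zero>\<^bsub>T\<^esub> | Suc j \<Rightarrow> k b \<in> component B j"
        using b by (auto simp: T.pres_zero B.pres_component split: nat.splits)
      ultimately show ?thesis by blast
    qed
  qed (simp_all add: ops)
  from quadratic_extension.quadratic_extension_iso[OF this]
  show ?thesis unfolding quadratic_extension.relation_def[OF \<open>quadratic_extension _ _ _ _ _\<close>] .
qed

end

section \<open>Operations on Hochschild cochains\<close>

definition cup :: "('a list \<Rightarrow> 'm::ring) \<Rightarrow> ('a list \<Rightarrow> 'm) \<Rightarrow> 'a list \<Rightarrow> 'm" where
  "cup f g xs = (\<Sum>i\<le>length xs. f (take i xs) * g (drop i xs))"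

definition sgn_cochain :: "('a list \<Rightarrow> 'm::ab_group_add) \<Rightarrow> 'a list \<Rightarrow> 'm" where
  "sgn_cochain f xs = (if even (length xs) then f xs else - f xs)"

definition proj_cochain :: "nat \<Rightarrow> ('a list \<Rightarrow> 'm::ab_group_add) \<Rightarrow> 'a list \<Rightarrow> 'm" where
  "proj_cochain n f xs = (if length xs = n then f xs else 0)"

definition unit_cochain :: "'a list \<Rightarrow> 'm::{zero,one}" where
  "unit_cochain xs = (if xs = [] then 1 else 0)"

text \<open>The part of the Hochschild differential that multiplies adjacent arguments. Peeling off
  the first argument makes all identities for it provable by induction on lists.\<close>

fun bar :: "('a::times list \<Rightarrow> 'm::ab_group_add) \<Rightarrow> 'a list \<Rightarrow> 'm" where
  "bar f [] = 0"
| "bar f [a] = 0"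
| "bar f (a # c # xs) = - f ((a * c) # xs) - bar (\<lambda>ys. f (a # ys)) (c # xs)"

lemma cup_Nil [simp]: "cup f g [] = f [] * g []"
  by (simp add: cup_def)

lemma cup_Cons [simp]: "cup f g (a # xs) = f [] * g (a # xs) + cup (\<lambda>ys. f (a # ys)) g xs"
  by (simp add: cup_def sum.atMost_Suc_shift del: sum.atMost_Suc)

lemma cup_linear:
  "cup (\<lambda>ys. f ys + f' ys) g xs = cup f g xs + cup f' g xs"
  "cup f (\<lambda>ys. g ys + g' ys) xs = cup f g xs + cup f g' xs"
  "cup (\<lambda>ys. - f ys) g xs = - cup f g xs"
  "cup f (\<lambda>ys. - g ys) xs = - cup f g xs"
  "cup (\<lambda>ys. f ys - f' ys) g xs = cup f g xs - cup f' g xs"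
  "cup (\<lambda>ys. c * f ys) g xs = c * cup f g xs"
  "cup (\<lambda>ys. 0) g xs = 0" "cup f (\<lambda>ys. 0) xs = 0"
  by (simp_all add: cup_def distrib_left distrib_right sum.distrib sum_negf sum_subtractf
      left_diff_distrib sum_distrib_left mult.assoc)

text \<open>Stripping the first argument from \<open>f\<close> gives the recursion \<open>cup_Cons\<close>; all identities below follow
  from it by induction on the list of arguments, with \<open>f\<close> arbitrary.\<close>

lemma cup_assoc: "cup (cup f g) k xs = cup f (cup g k) xs"
proof (induction xs arbitrary: f g)
  case (Cons a xs)
  have "cup (\<lambda>ys. cup f g (a # ys)) k xs
      = f [] * cup (\<lambda>ys. g (a # ys)) k xs + cup (cup (\<lambda>ys. f (a # ys)) g) k xs"
    by (simp add: cup_linear)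
  then show ?case by (simp add: Cons algebra_simps)
qed (simp add: mult.assoc)

lemma cup_unit [simp]:
  fixes f :: "'a list \<Rightarrow> 'm::{ring,monoid_mult}"
  shows "cup unit_cochain f xs = f xs" "cup f unit_cochain xs = f xs"
proof -
  show "cup unit_cochain f xs = f xs"
    by (cases xs) (simp_all add: unit_cochain_def cup_linear)
  show "cup f unit_cochain xs = f xs"
    by (induction xs arbitrary: f) (simp_all add: unit_cochain_def)
qed

lemma sgn_cup: "sgn_cochain (cup f g) xs = cup (sgn_cochain f) (sgn_cochain g) xs"
proof -
  have "sgn_cochain f (take i xs) * sgn_cochain g (drop i xs)
      = (if even (length xs) then f (take i xs) * g (drop i xs) else - (f (take i xs) * g (drop i xs)))"
    if "i \<le> length xs" for i
    using that by (auto simp: sgn_cochain_def min_def)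
  then show ?thesis by (simp add: sgn_cochain_def[of "cup f g"] cup_def sum_negf)
qed

lemma sgn_sgn: "sgn_cochain (sgn_cochain f) = f"
  by (auto simp: sgn_cochain_def)

lemma bar_linear:
  "bar (\<lambda>ys. f ys + g ys) xs = bar f xs + bar g xs"
  "bar (\<lambda>ys. - f ys) xs = - bar f xs"
  "bar (\<lambda>ys. 0) xs = 0"
proof -
  show "bar (\<lambda>ys. f ys + g ys) xs = bar f xs + bar g xs"
    by (induction f xs arbitrary: g rule: bar.induct) simp_all
  show "bar (\<lambda>ys. - f ys) xs = - bar f xs"
    by (induction f xs rule: bar.induct) simp_all
  show "bar (\<lambda>ys. 0) xs = 0"
    by (induction xs rule: induct_list012) simp_all
qed

lemma bar_diff: "bar (\<lambda>ys. f ys - g ys) xs = bar f xs - bar g xs"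
  using bar_linear(1)[of f "\<lambda>ys. - g ys" xs] by (simp add: bar_linear(2))

lemma bar_mult:
  fixes f :: "'a::times list \<Rightarrow> 'm::ring"
  shows "bar (\<lambda>ys. c * f ys) xs = c * bar f xs"
  by (induction f xs rule: bar.induct) (simp_all add: algebra_simps)

lemma sgn_shift: "(\<lambda>ys. sgn_cochain f (a # ys)) = (\<lambda>ys. - sgn_cochain (\<lambda>ys. f (a # ys)) ys)"
  by (auto simp: sgn_cochain_def)

lemma bar_sgn: "bar (sgn_cochain f) xs = - sgn_cochain (bar f) xs"
proof (induction f xs rule: bar.induct)
  case (3 f a c xs)
  then show ?case
    by (simp add: sgn_shift bar_linear) (simp add: sgn_cochain_def)
qed (simp_all add: sgn_cochain_def)

lemma bar_cup:
  fixes f g :: "'a::times list \<Rightarrow> 'm::ring"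
  shows "bar (cup f g) xs = cup (bar f) g xs + cup (sgn_cochain f) (bar g) xs"
proof (induction f xs rule: bar.induct)
  case (3 f a c xs)
  have "bar (\<lambda>ys. cup f g (a # ys)) (c # xs)
      = f [] * bar (\<lambda>ys. g (a # ys)) (c # xs) + bar (cup (\<lambda>ys. f (a # ys)) g) (c # xs)"
    by (simp only: cup_Cons bar_linear bar_mult)
  then show ?case
    using 3 by (simp add: sgn_shift cup_linear) (simp add: sgn_cochain_def algebra_simps)
qed (simp_all add: sgn_cochain_def)

text \<open>Multiplying the first argument \<open>a\<close> into the next one is the auxiliary cochain \<open>T\<close>, in terms of which
  stripping \<open>a\<close> anticommutes with \<open>bar\<close> up to \<open>T\<close>. The two terms that remain cancel by associativity.\<close>

lemma bar_bar:
  fixes f :: "'a::semigroup_mult list \<Rightarrow> 'm::ab_group_add"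
  shows "bar (bar f) xs = 0"
proof (induction f xs rule: bar.induct)
  case (3 f a c xs)
  show ?case
  proof (cases xs)
    case (Cons w ws)
    define T where "T = (\<lambda>ys. case ys of [] \<Rightarrow> 0 | y # ys' \<Rightarrow> f ((a * y) # ys'))"
    have "(\<lambda>ys. bar f (a # ys)) = (\<lambda>ys. - T ys - bar (\<lambda>zs. f (a # zs)) ys)"
      by (auto simp: T_def fun_eq_iff split: list.split)
    then have "bar (\<lambda>ys. bar f (a # ys)) (c # xs) = - bar T (c # xs)"
      using 3 by (simp only: bar_diff bar_linear) simp
    then show ?thesis by (simp add: Cons T_def mult.assoc)
  qed simp
qed simp_all

lemma bar_sum:
  fixes f :: "'a::times list \<Rightarrow> 'm::ab_group_add"
  shows "bar f xs = (\<Sum>i\<in>{1..<length xs}.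
    (if even i then id else uminus) (f (take (i - 1) xs @ (xs ! (i - 1) * xs ! i) # drop (i + 1) xs)))"
proof (induction f xs rule: bar.induct)
  case (3 f a c xs)
  let ?t = "\<lambda>zs i. take (i - 1) zs @ (zs ! (i - 1) * zs ! i) # drop (i + 1) zs"
  define F where "F i = (if even i then id else uminus) (f (?t (a # c # xs) i))" for i
  have "(\<Sum>i\<in>{1..<length (a # c # xs)}. F i) = F 1 + (\<Sum>i\<in>{1..<length (c # xs)}. F (Suc i))"
    using sum.atLeast_Suc_lessThan[of 1 "length (a # c # xs)" F]
      sum.shift_bounds_Suc_ivl[of F 1 "length (c # xs)"] by simp
  then have "(\<Sum>i\<in>{1..<length (a # c # xs)}. (if even i then id else uminus) (f (?t (a # c # xs) i)))
      = - f ((a * c) # xs)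
        + (\<Sum>i\<in>{1..<length (c # xs)}. (if even (Suc i) then id else uminus) (f (?t (a # c # xs) (Suc i))))"
    unfolding F_def by simp
  also have "(\<Sum>i\<in>{1..<length (c # xs)}. (if even (Suc i) then id else uminus) (f (?t (a # c # xs) (Suc i))))
      = - (\<Sum>i\<in>{1..<length (c # xs)}. (if even i then id else uminus) (f (a # ?t (c # xs) i)))"
    unfolding sum_negf[symmetric]
  proof (rule sum.cong[OF refl])
    fix i assume "i \<in> {1..<length (c # xs)}"
    then obtain j where "i = Suc j" by (cases i) auto
    then show "(if even (Suc i) then id else uminus) (f (?t (a # c # xs) (Suc i)))
      = - (if even i then id else uminus) (f (a # ?t (c # xs) i))" by simp
  qed
  finally show ?case using 3 by simp
qed simp_all

locale hochschild =
  fixes G :: "('g, 'u) monoid_scheme"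
    and A :: "('k::field, 'g, 'a::{ring,monoid_mult}) module_algebra_data"
    and M :: "('k, 'g, 'm::{ring,monoid_mult}, 'a) bimodule_data"
  assumes group_G: "group G" and module_algebra_A: "kG_module_algebra G A"
    and module_algebra_M: "AeG_module_algebra G A M"
begin

sublocale M: vector_space "scal M"
  using module_algebra_M by (simp add: AeG_module_algebra_def AeG_module_def)

sublocale A: vector_space "scal A"
  using module_algebra_A by (simp add: kG_module_algebra_def unital_algebra_def)

abbreviation "lin \<equiv> Vector_Spaces.linear (scal A) (scal M)"

definition \<eta> :: "'a \<Rightarrow> 'm" where "\<eta> a = lact M a 1"

lemma scal_mult: "scal M c x * y = scal M c (x * y)" "x * scal M c y = scal M c (x * y)"
  using module_algebra_M
  by (simp_all add: AeG_module_algebra_def kG_module_algebra_def unital_algebra_def)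

text \<open>Since \<open>M\<close> is a unital algebra with \<open>A\<close>-balanced multiplication, both actions of \<open>A\<close> are
  multiplications with the image of \<open>A\<close> under the algebra homomorphism \<open>a \<mapsto> a 1\<close>.\<close>

lemma lact_eq: "lact M a x = \<eta> a * x" and ract_eq: "ract M x a = x * \<eta> a"
proof -
  have *: "\<forall>x a y. ract M x a * y = x * lact M a y" "\<forall>a x y. lact M a x * y = lact M a (x * y)"
    using module_algebra_M unfolding AeG_module_algebra_def by blast+
  show "lact M a x = \<eta> a * x" using *(2) by (simp add: \<eta>_def)
  show "ract M x a = x * \<eta> a"
    using *(1)[rule_format, of x a 1] by (simp add: \<eta>_def)
qed

lemma \<eta>_mult: "\<eta> (a * b) = \<eta> a * \<eta> b"
proof -
  have "lact M (a * b) 1 = lact M a (lact M b 1)"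
    using module_algebra_M by (simp add: AeG_module_algebra_def AeG_module_def)
  then show ?thesis by (simp add: lact_eq)
qed

lemma \<eta>_linear: "lin \<eta>"
proof -
  have "\<eta> = (\<lambda>a. lact M a 1)" by (simp add: fun_eq_iff \<eta>_def)
  moreover have "lin (\<lambda>a. lact M a 1)"
    using module_algebra_M by (simp add: AeG_module_algebra_def AeG_module_def)
  ultimately show ?thesis by simp
qed

lemma act_M:
  assumes "g \<in> carrier G"
  shows "act M g (x + y) = act M g x + act M g y" "act M g (scal M c x) = scal M c (act M g x)"
    "act M g (x * y) = act M g x * act M g y" "act M g 1 = 1"
    "act M g (lact M a x) = lact M (act A g a) (act M g x)"
proof -
  have 1: "Vector_Spaces.linear (scal M) (scal M) (act M g)"
    "act M g 1 = 1 \<and> (\<forall>x y. act M g (x * y) = act M g x * act M g y)"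
    using module_algebra_M assms unfolding AeG_module_algebra_def kG_module_algebra_def by blast+
  then show "act M g (x + y) = act M g x + act M g y" "act M g (scal M c x) = scal M c (act M g x)"
    "act M g (x * y) = act M g x * act M g y" "act M g 1 = 1"
    by (simp_all add: Vector_Spaces.linear_iff)
  show "act M g (lact M a x) = lact M (act A g a) (act M g x)"
    using module_algebra_M assms unfolding AeG_module_algebra_def AeG_module_def by blast
qed

lemma act_A:
  assumes "g \<in> carrier G"
  shows "Vector_Spaces.linear (scal A) (scal A) (act A g)" "act A g (a * b) = act A g a * act A g b"
  using module_algebra_A assms unfolding kG_module_algebra_def by blast+

lemma act_composition:
  assumes "g \<in> carrier G" "g' \<in> carrier G"
  shows "act M (g \<otimes>\<^bsub>G\<^esub> g') x = act M g (act M g' x)" "act A (g \<otimes>\<^bsub>G\<^esub> g') a = act A g (act A g' a)"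
    "act M \<one>\<^bsub>G\<^esub> x = x" "act A \<one>\<^bsub>G\<^esub> a = a"
proof -
  interpret M: group_action G UNIV "act M"
    using module_algebra_M by (simp add: AeG_module_algebra_def AeG_module_def)
  interpret A: group_action G UNIV "act A"
    using module_algebra_A by (simp add: kG_module_algebra_def)
  show "act M (g \<otimes>\<^bsub>G\<^esub> g') x = act M g (act M g' x)" "act A (g \<otimes>\<^bsub>G\<^esub> g') a = act A g (act A g' a)"
    using M.composition_rule[of x g g'] A.composition_rule[of a g g'] assms by simp_all
  show "act M \<one>\<^bsub>G\<^esub> x = x" "act A \<one>\<^bsub>G\<^esub> a = a"
    using M.id_eq_one A.id_eq_one by (simp_all add: fun_eq_iff)
qed

lemma act_M_zero: "g \<in> carrier G \<Longrightarrow> act M g 0 = 0"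
  using act_M(1)[of g 0 0] by simp

lemma act_M_minus: "g \<in> carrier G \<Longrightarrow> act M g (- x) = - act M g x"
  using act_M(1)[of g x "- x"] by (simp add: act_M_zero eq_neg_iff_add_eq_0 add.commute)

lemma act_M_sum: "g \<in> carrier G \<Longrightarrow> act M g (sum f I) = (\<Sum>i\<in>I. act M g (f i))"
  by (induction I rule: infinite_finite_induct) (simp_all add: act_M act_M_zero)

lemma act_\<eta>: "g \<in> carrier G \<Longrightarrow> act M g (\<eta> (act A (inv\<^bsub>G\<^esub> g) a)) = \<eta> a"
proof -
  interpret G: group G by (rule group_G)
  assume g: "g \<in> carrier G"
  then have "act A g (act A (inv\<^bsub>G\<^esub> g) a) = a"
    using act_composition(2)[of g "inv\<^bsub>G\<^esub> g" a] act_composition(4)[of g g a] by simp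
  then show ?thesis using g by (simp add: \<eta>_def act_M)
qed

subsection \<open>The differential\<close>

text \<open>With the cochain \<open>\<epsilon>\<close> of degree \<open>1\<close>, the outer terms of the Hochschild differential form the
  graded commutator with \<open>\<epsilon>\<close> (\<open>diff_eq\<close>). Together with \<open>bar \<epsilon> = - \<epsilon> \<smile> \<epsilon>\<close>, which is the
  multiplicativity of \<open>\<eta>\<close>, this reduces \<open>d d = 0\<close> and the Leibniz rule to the corresponding identities
  for \<open>bar\<close>.\<close>

definition \<epsilon> :: "'a list \<Rightarrow> 'm" where "\<epsilon> xs = (case xs of [a] \<Rightarrow> \<eta> a | _ \<Rightarrow> 0)"

lemma \<epsilon>_simps [simp]: "\<epsilon> [] = 0" "\<epsilon> [a] = \<eta> a" "\<epsilon> (a # c # xs) = 0"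
  by (simp_all add: \<epsilon>_def)

lemma cup_\<epsilon>_left: "cup \<epsilon> f xs = (if xs = [] then 0 else \<eta> (hd xs) * f (tl xs))"
proof (cases xs)
  case (Cons a ys)
  have "cup (\<lambda>zs. \<epsilon> (a # zs)) f ys = \<eta> a * f ys"
    by (cases ys) (simp_all add: cup_linear)
  then show ?thesis by (simp add: Cons)
qed simp

lemma cup_\<epsilon>_right: "cup f \<epsilon> xs = (if xs = [] then 0 else f (butlast xs) * \<eta> (last xs))"
proof (induction xs arbitrary: f)
  case (Cons a xs)
  then show ?case by (cases xs) auto
qed simp

lemma diff_eq: "hochschild_diff M f xs = cup \<epsilon> f xs - cup (sgn_cochain f) \<epsilon> xs + bar f xs"
proof -
  have sign: "scal M ((- 1) ^ i) x = (if even i then id else uminus) x" for i x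
    by (cases "even i") simp_all
  show ?thesis
  proof (cases "xs = []")
    case False
    then have "scal M ((- 1) ^ length xs) (ract M (f (butlast xs)) (last xs)) = - cup (sgn_cochain f) \<epsilon> xs"
      by (cases "even (length xs)") (auto simp: sign ract_eq cup_\<epsilon>_right sgn_cochain_def)
    then show ?thesis
      using False unfolding hochschild_diff_def bar_sum[of f xs] sign by (simp add: cup_\<epsilon>_left lact_eq)
  qed (simp add: hochschild_diff_def)
qed

lemma bar_\<epsilon>: "bar \<epsilon> xs = - cup \<epsilon> \<epsilon> xs"
proof (cases xs rule: remdups_adj.cases)
  case (3 a c ys)
  have aux: "bar (\<lambda>zs. \<epsilon> (a # zs)) (c # ys) = 0" for ys
  proof (cases ys)
    case (Cons w ws)
    have "(\<lambda>zs. \<epsilon> (a # c # zs)) = (\<lambda>zs. 0)" by simp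
    then show ?thesis by (simp add: Cons bar_linear)
  qed simp
  then show ?thesis by (cases ys) (simp_all add: 3 \<eta>_mult bar_linear cup_linear)
qed simp_all

abbreviation "d \<equiv> hochschild_diff M"

lemma diff_fun: "d f = (\<lambda>xs. cup \<epsilon> f xs - cup (sgn_cochain f) \<epsilon> xs + bar f xs)"
  by (rule ext) (rule diff_eq)

lemma cup_plus: "cup (f + f') g = cup f g + cup f' g" "cup f (g + g') = cup f g + cup f g'"
  and cup_minus: "cup (- f) g = - cup f g" "cup f (- g) = - cup f g"
  by (simp_all add: fun_eq_iff cup_linear plus_fun_def fun_Compl_def)

lemma cup_diff: "cup (f - f') g = cup f g - cup f' g" "cup f (g - g') = cup f g - cup f g'"
  using cup_plus(1)[of f "- f'" g] cup_plus(2)[of f g "- g'"] by (simp_all add: cup_minus)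

lemma bar_plus: "bar (f + g) = bar f + bar g" and bar_minus: "bar (- f) = - bar f"
  by (simp_all add: fun_eq_iff bar_linear plus_fun_def fun_Compl_def)

lemma bar_diff_fun: "bar (f - g) = bar f - bar g"
  using bar_plus[of f "- g"] by (simp add: bar_minus)

lemma sgn_plus: "sgn_cochain (f + g) = sgn_cochain f + sgn_cochain g"
  and sgn_minus: "sgn_cochain (- f) = - sgn_cochain f"
  and sgn_diff: "sgn_cochain (f - g) = sgn_cochain f - sgn_cochain g"
  by (simp_all add: fun_eq_iff sgn_cochain_def)

lemma cup_assoc_fun: "cup (cup f g) k = cup f (cup g k)" for f :: "'a list \<Rightarrow> 'm"
  by (rule ext) (rule cup_assoc)

lemma sgn_cup_fun: "sgn_cochain (cup f g) = cup (sgn_cochain f) (sgn_cochain g)" for f :: "'a list \<Rightarrow> 'm"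
  by (rule ext) (rule sgn_cup)

lemma bar_sgn_fun: "bar (sgn_cochain f) = - sgn_cochain (bar f)" for f :: "'a list \<Rightarrow> 'm"
  by (rule ext) (simp add: bar_sgn)

lemma bar_cup_fun: "bar (cup f g) = cup (bar f) g + cup (sgn_cochain f) (bar g)"
  for f :: "'a list \<Rightarrow> 'm"
  by (rule ext) (simp add: bar_cup)

lemma bar_bar_fun: "bar (bar f) = 0" for f :: "'a list \<Rightarrow> 'm"
  by (rule ext) (simp add: bar_bar)

lemma bar_\<epsilon>_fun: "bar \<epsilon> = - cup \<epsilon> \<epsilon>"
  by (rule ext) (simp add: bar_\<epsilon>)

lemma sgn_\<epsilon>: "sgn_cochain \<epsilon> = - \<epsilon>"
  by (auto simp: fun_eq_iff sgn_cochain_def \<epsilon>_def split: list.splits)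

lemma d_eq: "d f = cup \<epsilon> f - cup (sgn_cochain f) \<epsilon> + bar f"
  by (simp add: diff_fun fun_eq_iff)

lemmas cochain_simps = d_eq cup_plus cup_minus cup_diff bar_plus bar_minus bar_diff_fun sgn_plus
  sgn_minus sgn_diff cup_assoc_fun sgn_cup_fun bar_sgn_fun bar_cup_fun bar_bar_fun bar_\<epsilon>_fun sgn_\<epsilon> sgn_sgn

lemma d_plus: "d (f + g) = d f + d g"
  by (simp add: cochain_simps)

lemma d_d: "d (d f) = 0"
  by (simp add: cochain_simps)

lemma d_cup: "d (cup f g) = cup (d f) g + cup (sgn_cochain f) (d g)"
  by (simp add: cochain_simps)

lemma d_sgn: "d (sgn_cochain f) = - sgn_cochain (d f)"
  by (simp add: cochain_simps)

definition scl :: "'k \<Rightarrow> ('a list \<Rightarrow> 'm) \<Rightarrow> 'a list \<Rightarrow> 'm" where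
  "scl c f = (\<lambda>xs. scal M c (f xs))"

lemma vector_space_scl: "vector_space scl"
  by unfold_locales
    (simp_all add: scl_def fun_eq_iff M.scale_right_distrib M.scale_left_distrib)

lemma cup_scl: "cup (scl c f) g = scl c (cup f g)" "cup f (scl c g) = scl c (cup f g)"
  by (simp_all add: fun_eq_iff cup_def scl_def scal_mult M.scale_sum_right)

lemma sgn_scl: "sgn_cochain (scl c f) = scl c (sgn_cochain f)"
  by (auto simp: fun_eq_iff sgn_cochain_def scl_def)

lemma bar_scl: "bar (scl c f) = scl c (bar f)"
proof
  fix xs show "bar (scl c f) xs = scl c (bar f) xs"
    by (induction f xs rule: bar.induct)
      (simp_all add: scl_def M.scale_right_diff_distrib)
qed

lemma scl_distrib: "scl c (f + g) = scl c f + scl c g" "scl c (f - g) = scl c f - scl c g"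
  by (simp_all add: scl_def fun_eq_iff M.scale_right_distrib M.scale_right_diff_distrib)

lemma d_scl: "d (scl c f) = scl c (d f)"
  by (simp add: d_eq cup_scl sgn_scl bar_scl scl_distrib)

lemma d_vanishes: "d f xs = 0" if "\<And>ys. length ys = length xs - 1 \<Longrightarrow> f ys = 0"
proof -
  have "bar f xs = 0" unfolding bar_sum by (rule sum.neutral) (auto intro!: that)
  then show ?thesis using that
    by (simp add: diff_eq cup_\<epsilon>_left cup_\<epsilon>_right sgn_cochain_def)
qed

text \<open>Every term of the differential evaluates \<open>f\<close> on a list that is shorter by one; this makes \<open>d\<close>
  homogeneous of degree \<open>1\<close>.\<close>

lemma d_cong: "d f xs = d g xs" if "\<And>ys. length ys = length xs - 1 \<Longrightarrow> f ys = g ys"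
proof -
  have "d (f - g) xs = 0" by (rule d_vanishes) (simp add: that)
  moreover have "d f = d (f - g) + d g" by (simp add: d_plus[symmetric])
  ultimately show ?thesis by simp
qed

lemma d_Nil: "d f [] = 0"
  by (simp add: hochschild_diff_def)

lemma proj_d_Suc: "proj_cochain (Suc n) (d f) = d (proj_cochain n f)"
proof
  fix xs show "proj_cochain (Suc n) (d f) xs = d (proj_cochain n f) xs"
  proof (cases "length xs = Suc n")
    case True
    then show ?thesis by (auto simp: proj_cochain_def intro!: d_cong)
  next
    case False
    then show ?thesis
      by (cases xs) (auto simp: proj_cochain_def d_Nil d_vanishes)
  qed
qed

lemma proj_d_0: "proj_cochain 0 (d f) = 0"
  by (auto simp: fun_eq_iff proj_cochain_def d_Nil)

subsection \<open>The group action\<close>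

abbreviation "cact \<equiv> cochain_act G A M"

lemma cact_linear:
  assumes "g \<in> carrier G"
  shows "cact g (f + f') = cact g f + cact g f'" "cact g (scl c f) = scl c (cact g f)"
    "cact g (- f) = - cact g f" "cact g (f - f') = cact g f - cact g f'"
proof -
  show "cact g (f + f') = cact g f + cact g f'" for f f'
    using assms by (simp add: fun_eq_iff cochain_act_def act_M)
  moreover show "cact g (- f) = - cact g f" for f
    using assms by (simp add: fun_eq_iff cochain_act_def act_M_minus)
  ultimately show "cact g (f - f') = cact g f - cact g f'"
    by (metis add_uminus_conv_diff)
  show "cact g (scl c f) = scl c (cact g f)"
    using assms by (simp add: fun_eq_iff cochain_act_def act_M scl_def)
qed

lemma cact_cup: "g \<in> carrier G \<Longrightarrow> cact g (cup f f') = cup (cact g f) (cact g f')"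
  by (simp add: fun_eq_iff cochain_act_def cup_def act_M_sum act_M take_map drop_map)

lemma cact_sgn: "g \<in> carrier G \<Longrightarrow> cact g (sgn_cochain f) = sgn_cochain (cact g f)"
  by (auto simp: fun_eq_iff cochain_act_def sgn_cochain_def act_M_minus)

lemma cact_proj: "g \<in> carrier G \<Longrightarrow> cact g (proj_cochain n f) = proj_cochain n (cact g f)"
  by (auto simp: fun_eq_iff cochain_act_def proj_cochain_def act_M_zero)

lemma cact_unit: "g \<in> carrier G \<Longrightarrow> cact g unit_cochain = unit_cochain"
  by (auto simp: fun_eq_iff cochain_act_def unit_cochain_def act_M act_M_zero)

lemma cact_\<epsilon>: "g \<in> carrier G \<Longrightarrow> cact g \<epsilon> = \<epsilon>"
  by (auto simp: fun_eq_iff cochain_act_def \<epsilon>_def act_M_zero act_\<eta> split: list.splits)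

lemma inv_G: "g \<in> carrier G \<Longrightarrow> inv\<^bsub>G\<^esub> g \<in> carrier G"
  using group_G by (rule group.inv_closed)

lemma cact_bar:
  assumes g: "g \<in> carrier G" shows "cact g (bar f) = bar (cact g f)"
proof
  fix xs
  show "cact g (bar f) xs = bar (cact g f) xs"
  proof (induction xs arbitrary: f rule: induct_list012)
    case (3 a c xs)
    let ?g = "act A (inv\<^bsub>G\<^esub> g)"
    have "(\<lambda>ys. cact g f (a # ys)) = cact g (\<lambda>ys. f (?g a # ys))"
      by (simp add: cochain_act_def)
    moreover have "cact g (bar f) (a # c # xs)
        = - cact g f ((a * c) # xs) - cact g (bar (\<lambda>ys. f (?g a # ys))) (c # xs)"
      using g by (simp add: cochain_act_def act_A inv_G)
        (metis act_M(1) act_M_minus add_uminus_conv_diff g)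
    ultimately show ?case using 3 by simp
  qed (use g in \<open>simp_all add: cochain_act_def act_M_zero\<close>)
qed

lemma cact_d: "g \<in> carrier G \<Longrightarrow> cact g (d f) = d (cact g f)"
  by (simp add: d_eq cact_linear cact_cup cact_sgn cact_bar cact_\<epsilon>)

lemma cact_id: "cact \<one>\<^bsub>G\<^esub> f = f"
proof -
  interpret G: group G by (rule group_G)
  have "map (act A \<one>\<^bsub>G\<^esub>) xs = xs" for xs
    by (rule map_idI) (rule act_composition(4)[OF G.one_closed G.one_closed])
  then show ?thesis
    using act_composition(3)[OF G.one_closed G.one_closed] by (simp add: cochain_act_def)
qed

lemma cact_cact:
  assumes "g \<in> carrier G" "g' \<in> carrier G"
  shows "cact (g \<otimes>\<^bsub>G\<^esub> g') f = cact g (cact g' f)"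
proof -
  interpret G: group G by (rule group_G)
  have "map (act A (inv\<^bsub>G\<^esub> (g \<otimes>\<^bsub>G\<^esub> g'))) xs = map (act A (inv\<^bsub>G\<^esub> g')) (map (act A (inv\<^bsub>G\<^esub> g)) xs)" for xs
    using assms by (simp add: G.inv_mult_group act_composition(2))
  then show ?thesis using assms unfolding cochain_act_def by (simp only: act_composition(1))
qed

subsection \<open>Closure of the cochain space\<close>

abbreviation "C \<equiv> cochain_set A M"

lemma lin_iff: "lin f \<longleftrightarrow> (\<forall>x y. f (x + y) = f x + f y) \<and> (\<forall>c x. f (scal A c x) = scal M c (f x))"
  using M.vector_space_axioms A.vector_space_axioms by (simp add: Vector_Spaces.linear_iff)

lemma lin_closed:
  "lin (\<lambda>a. 0)" "lin f \<Longrightarrow> lin g \<Longrightarrow> lin (\<lambda>a. f a + g a)" "lin f \<Longrightarrow> lin (\<lambda>a. - f a)"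
  "lin f \<Longrightarrow> lin g \<Longrightarrow> lin (\<lambda>a. f a - g a)" "lin f \<Longrightarrow> lin (\<lambda>a. scal M c (f a))"
  "lin f \<Longrightarrow> lin (\<lambda>a. x * f a)" "lin f \<Longrightarrow> lin (\<lambda>a. f a * x)"
  by (simp_all add: lin_iff M.scale_right_distrib M.scale_right_diff_distrib distrib_left
      distrib_right scal_mult M.scale_left_commute)

lemma lin_sum: "(\<And>i. i \<in> I \<Longrightarrow> lin (f i)) \<Longrightarrow> lin (\<lambda>a. \<Sum>i\<in>I. f i a)"
  by (induction I rule: infinite_finite_induct) (simp_all add: lin_closed)

abbreviation "multi \<equiv> multilinear (scal A) (scal M)"

lemma multi_D: "multi f \<Longrightarrow> lin (\<lambda>a. f (us @ a # vs))"
  by (simp add: multilinear_def)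

lemma multi_head: "multi f \<Longrightarrow> lin (\<lambda>a. f (a # vs))"
  using multi_D[of f "[]" vs] by simp

lemma multi_shift: "multi f \<Longrightarrow> multi (\<lambda>ys. f (a # ys))"
proof -
  assume f: "multi f"
  have "lin (\<lambda>b. f (a # us @ b # vs))" for us vs
    using multi_D[OF f, of "a # us" vs] by simp
  then show ?thesis by (simp add: multilinear_def)
qed

lemma lin_cup: "(\<And>ys. lin (\<lambda>a. f a ys)) \<Longrightarrow> lin (\<lambda>a. cup (f a) g xs)"
  unfolding cup_def by (intro lin_sum lin_closed(7))

lemma multi_cup:
  assumes "multi f" "multi g" shows "multi (cup f g)"
proof -
  have "lin (\<lambda>a. cup f g (us @ a # vs))" for us vs
    using assms(1)
  proof (induction us arbitrary: f)
    case Nil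
    show ?case
      using multi_head[OF Nil] multi_head[OF assms(2)] by (simp add: lin_closed lin_cup)
  next
    case (Cons b us)
    show ?case
      using Cons.IH[OF multi_shift[OF Cons.prems]] multi_D[OF assms(2), of "b # us" vs]
      by (simp add: lin_closed)
  qed
  then show ?thesis by (simp add: multilinear_def)
qed

lemma lin_bar: "(\<And>ys. lin (\<lambda>a. f a ys)) \<Longrightarrow> lin (\<lambda>a. bar (f a) xs)"
  by (induction xs arbitrary: f rule: induct_list012) (simp_all add: lin_closed)

lemma lin_mult_arg: "lin f \<Longrightarrow> lin (\<lambda>a. f (a * c))" "lin f \<Longrightarrow> lin (\<lambda>a. f (c * a))"
proof -
  have "scal A r x * y = scal A r (x * y) \<and> x * scal A r y = scal A r (x * y)" for r x y
    using module_algebra_A by (simp add: kG_module_algebra_def unital_algebra_def)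
  then show "lin f \<Longrightarrow> lin (\<lambda>a. f (a * c))" "lin f \<Longrightarrow> lin (\<lambda>a. f (c * a))"
    by (simp_all add: lin_iff distrib_left distrib_right)
qed

text \<open>An argument in the first position is either multiplied into its right neighbour or kept in front of
  the remaining list; other positions reduce to shorter lists by stripping the first argument.\<close>

lemma multi_bar:
  assumes "multi f" shows "multi (bar f)"
proof -
  have head: "lin (\<lambda>a. bar f (a # vs))" if "multi f" for f vs
  proof (cases vs)
    case (Cons c ys)
    have "lin (\<lambda>a. f ((a * c) # ys))" by (rule lin_mult_arg[OF multi_head[OF \<open>multi f\<close>]])
    moreover have "lin (\<lambda>a. bar (\<lambda>zs. f (a # zs)) vs)"
      by (rule lin_bar) (rule multi_head[OF \<open>multi f\<close>])
    ultimately show ?thesis by (simp add: Cons lin_closed)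
  qed (simp add: lin_closed)
  have "lin (\<lambda>a. bar f (us @ a # vs))" for us vs
    using assms
  proof (induction us arbitrary: f rule: induct_list012)
    case 1
    then show ?case using head by simp
  next
    case (2 b)
    have "lin (\<lambda>a. f ((b * a) # vs))" by (rule lin_mult_arg[OF multi_head[OF 2]])
    then show ?case using head[OF multi_shift[OF 2], of b vs] by (simp add: lin_closed)
  next
    case (3 b c us)
    show ?case
      using 3(2)[OF multi_shift[OF 3(3)]] multi_D[OF 3(3), of "(b * c) # us" vs]
      by (simp add: lin_closed)
  qed
  then show ?thesis by (simp add: multilinear_def)
qed

lemma C_iff: "f \<in> C \<longleftrightarrow> multi f \<and> (\<exists>N. \<forall>xs. length xs > N \<longrightarrow> f xs = 0)"
  by (simp add: cochain_set_def)

lemma C_E: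
  assumes "f \<in> C"
  obtains N where "multi f" "\<And>xs. length xs > N \<Longrightarrow> f xs = 0"
  using assms C_iff by blast

lemma C_I: "multi f \<Longrightarrow> (\<And>xs. length xs > N \<Longrightarrow> f xs = 0) \<Longrightarrow> f \<in> C"
  using C_iff by blast

lemma C_plus: "f \<in> C \<Longrightarrow> g \<in> C \<Longrightarrow> f + g \<in> C"
proof -
  assume f: "f \<in> C" and g: "g \<in> C"
  obtain N where N: "multi f" "\<And>xs. length xs > N \<Longrightarrow> f xs = 0" using f by (rule C_E) blast
  obtain N' where N': "multi g" "\<And>xs. length xs > N' \<Longrightarrow> g xs = 0" using g by (rule C_E) blast
  show ?thesis
    by (rule C_I[of _ "max N N'"]) (use N N' in \<open>simp_all add: multilinear_def lin_closed\<close>)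
qed

lemma C_scl: "f \<in> C \<Longrightarrow> scl c f \<in> C"
proof -
  assume f: "f \<in> C"
  obtain N where N: "multi f" "\<And>xs. length xs > N \<Longrightarrow> f xs = 0" using f by (rule C_E) blast
  show ?thesis
    by (rule C_I[of _ N]) (use N in \<open>simp_all add: multilinear_def lin_closed scl_def\<close>)
qed

lemma C_cup: "f \<in> C \<Longrightarrow> g \<in> C \<Longrightarrow> cup f g \<in> C"
proof -
  assume f: "f \<in> C" and g: "g \<in> C"
  obtain N where N: "multi f" "\<And>xs. length xs > N \<Longrightarrow> f xs = 0" using f by (rule C_E) blast
  obtain N' where N': "multi g" "\<And>xs. length xs > N' \<Longrightarrow> g xs = 0" using g by (rule C_E) blast
  have "cup f g xs = 0" if l: "length xs > N + N'" for xs
    unfolding cup_def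
  proof (rule sum.neutral, rule ballI)
    fix i assume i: "i \<in> {..length xs}"
    have "length (take i xs) > N \<or> length (drop i xs) > N'" using l i by auto
    then show "f (take i xs) * g (drop i xs) = 0" using N(2) N'(2) by fastforce
  qed
  then show ?thesis using multi_cup[OF N(1) N'(1)] by (rule C_I[rotated])
qed

lemma C_unit: "unit_cochain \<in> C"
  by (rule C_I[of _ 0]) (simp_all add: multilinear_def unit_cochain_def lin_closed)

lemma C_sgn: "f \<in> C \<Longrightarrow> sgn_cochain f \<in> C"
proof -
  assume f: "f \<in> C"
  obtain N where N: "multi f" "\<And>xs. length xs > N \<Longrightarrow> f xs = 0" using f by (rule C_E) blast
  have "lin (\<lambda>a. sgn_cochain f (us @ a # vs))" for us vs
    using multi_D[OF N(1), of us vs] by (cases "even (length us + length vs)") (simp_all add: sgn_cochain_def lin_closed)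
  then show ?thesis using N
    by (intro C_I[of _ N]) (simp_all add: multilinear_def sgn_cochain_def)
qed

lemma C_proj: "f \<in> C \<Longrightarrow> proj_cochain n f \<in> C"
proof -
  assume f: "f \<in> C"
  obtain N where N: "multi f" "\<And>xs. length xs > N \<Longrightarrow> f xs = 0" using f by (rule C_E) blast
  have "lin (\<lambda>a. proj_cochain n f (us @ a # vs))" for us vs
    using multi_D[OF N(1), of us vs]
    by (cases "Suc (length us + length vs) = n") (simp_all add: proj_cochain_def lin_closed)
  then show ?thesis using N
    by (intro C_I[of _ N]) (simp_all add: multilinear_def proj_cochain_def)
qed

lemma C_\<epsilon>: "\<epsilon> \<in> C"
proof (rule C_I[of _ 1])
  have "lin (\<lambda>a. \<epsilon> (us @ a # vs))" for us vs
  proof (cases "us = [] \<and> vs = []")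
    case True
    then show ?thesis using \<eta>_linear by simp
  next
    case False
    then have "\<epsilon> (us @ a # vs) = 0" for a
      by (cases "us @ a # vs" rule: remdups_adj.cases) (auto simp: append_eq_Cons_conv)
    then show ?thesis by (simp add: lin_closed)
  qed
  then show "multi \<epsilon>" by (simp add: multilinear_def)
qed (auto simp: \<epsilon>_def split: list.splits)

lemma C_bar: "f \<in> C \<Longrightarrow> bar f \<in> C"
proof -
  assume f: "f \<in> C"
  obtain N where N: "multi f" "\<And>xs. length xs > N \<Longrightarrow> f xs = 0" using f by (rule C_E) blast
  have "bar f xs = 0" if "length xs > Suc N" for xs
    unfolding bar_sum by (rule sum.neutral) (use that in \<open>auto simp: N(2)\<close>)
  then show ?thesis using multi_bar[OF N(1)] by (rule C_I[rotated])
qed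

lemma C_minus: "f \<in> C \<Longrightarrow> - f \<in> C"
  using C_scl[of f "- 1"] by (simp add: scl_def fun_Compl_def)

lemma C_d: "f \<in> C \<Longrightarrow> d f \<in> C"
proof -
  assume f: "f \<in> C"
  have eq: "d f = (cup \<epsilon> f + - cup (sgn_cochain f) \<epsilon>) + bar f" by (simp add: d_eq)
  show ?thesis unfolding eq using f by (intro C_plus C_minus C_cup C_sgn C_bar C_\<epsilon>)
qed

lemma C_act:
  assumes g: "g \<in> carrier G" and f: "f \<in> C" shows "cact g f \<in> C"
proof -
  obtain N where N: "multi f" "\<And>xs. length xs > N \<Longrightarrow> f xs = 0" using f by (rule C_E) blast
  let ?g = "act A (inv\<^bsub>G\<^esub> g)"
  have "lin (\<lambda>a. act M g (f (map ?g us @ ?g a # map ?g vs)))" for us vs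
    using multi_D[OF N(1), of "map ?g us" "map ?g vs"] act_A(1)[OF inv_G[OF g]] g
    by (simp add: lin_iff act_M Vector_Spaces.linear_iff)
  then have "multi (cact g f)" by (simp add: multilinear_def cochain_act_def)
  then show ?thesis using N g by (intro C_I[of _ N]) (simp_all add: cochain_act_def act_M_zero)
qed

lemma proj_finite:
  assumes f: "f \<in> C" shows "\<exists>N. (\<forall>n\<ge>N. proj_cochain n f = 0) \<and> f = (\<Sum>n<N. proj_cochain n f)"
proof -
  obtain N where N: "\<And>xs. length xs > N \<Longrightarrow> f xs = 0" using f by (rule C_E) blast
  have "(\<Sum>n<K. proj_cochain n f) xs = (if length xs < K then f xs else 0)" for K xs
    by (induction K) (auto simp: proj_cochain_def less_Suc_eq)
  then have "f = (\<Sum>n<Suc N. proj_cochain n f)"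
    using N by (auto simp: fun_eq_iff not_less_eq simp del: sum.lessThan_Suc)
  moreover have "\<forall>n\<ge>Suc N. proj_cochain n f = 0" using N by (auto simp: fun_eq_iff proj_cochain_def)
  ultimately show ?thesis by blast
qed

sublocale dg_algebra scl cup unit_cochain C d sgn_cochain proj_cochain
proof (intro dg_algebra.intro dg_algebra_axioms.intro vector_space_scl)
  fix i j n :: nat and x y z :: "'a list \<Rightarrow> 'm" and c :: 'k
  show "cup (cup x y) z = cup x (cup y z)" by (rule cup_assoc_fun)
  show "cup unit_cochain x = x" "cup x unit_cochain = x" by (simp_all add: fun_eq_iff)
  show "proj_cochain n (x + y) = proj_cochain n x + proj_cochain n y"
    by (auto simp: fun_eq_iff proj_cochain_def)
  show "proj_cochain n (scl c x) = scl c (proj_cochain n x)"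
    by (auto simp: fun_eq_iff proj_cochain_def scl_def)
  show "proj_cochain n (unit_cochain :: 'a list \<Rightarrow> 'm) \<in> {0, unit_cochain}"
    by (cases n) (auto simp: fun_eq_iff proj_cochain_def unit_cochain_def)
  show "proj_cochain i (proj_cochain j x) = (if i = j then proj_cochain j x else 0)"
    by (auto simp: fun_eq_iff proj_cochain_def)
  show "sgn_cochain (proj_cochain n x) = scl ((- 1) ^ n) (proj_cochain n x)"
    by (cases "even n") (auto simp: fun_eq_iff proj_cochain_def scl_def sgn_cochain_def)
qed (simp_all add: cup_plus cup_scl C_plus C_cup C_unit C_scl C_d C_sgn C_proj d_plus d_scl d_d
    d_cup sgn_plus sgn_scl sgn_sgn sgn_cup_fun d_sgn proj_d_Suc proj_d_0 proj_finite)

end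

section \<open>Degenerated module algebras\<close>

text \<open>For \<open>a \<in> H\<close> normality gives \<open>a g0 = g0 b\<close> with \<open>b \<in> H\<close>, and \<open>b\<close> fixes \<open>v\<close>.\<close>

lemma coset_act_eq:
  assumes "group G" "H \<lhd> G" and g0: "g0 \<in> carrier G"
    and comp: "\<And>a b. a \<in> carrier G \<Longrightarrow> b \<in> carrier G \<Longrightarrow> \<alpha> (a \<otimes>\<^bsub>G\<^esub> b) v = \<alpha> a (\<alpha> b v)"
    and v: "\<And>a. a \<in> H \<Longrightarrow> \<alpha> a v = v"
  shows "coset_act \<alpha> (H #>\<^bsub>G\<^esub> g0) v = \<alpha> g0 v" "a \<in> H \<Longrightarrow> \<alpha> a (\<alpha> g0 v) = \<alpha> g0 v"
proof -
  interpret group G by fact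
  interpret H: normal H G by fact
  show fixed: "\<alpha> a (\<alpha> g0 v) = \<alpha> g0 v" if a: "a \<in> H" for a
  proof -
    have aG: "a \<in> carrier G" using a by (rule H.mem_carrier)
    let ?b = "inv\<^bsub>G\<^esub> g0 \<otimes>\<^bsub>G\<^esub> a \<otimes>\<^bsub>G\<^esub> g0"
    have b: "?b \<in> H" by (rule H.inv_op_closed1[OF g0 a])
    have bG: "?b \<in> carrier G" using aG g0 by simp
    have "\<alpha> a (\<alpha> g0 v) = \<alpha> (a \<otimes>\<^bsub>G\<^esub> g0) v" using comp[OF aG g0] by simp
    also have "a \<otimes>\<^bsub>G\<^esub> g0 = g0 \<otimes>\<^bsub>G\<^esub> ?b" using aG g0 by (simp add: m_assoc[symmetric])
    also have "\<alpha> \<dots> v = \<alpha> g0 v" using comp[OF g0 bG] v[OF b] by simp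
    finally show ?thesis .
  qed
  have "(\<lambda>g. \<alpha> g v) ` (H #>\<^bsub>G\<^esub> g0) = {\<alpha> g0 v}"
  proof -
    have "\<alpha> (a \<otimes>\<^bsub>G\<^esub> g0) v = \<alpha> g0 v" if "a \<in> H" for a
      using comp[OF H.mem_carrier[OF that] g0] fixed[OF that] by simp
    then have "(\<lambda>a. \<alpha> (a \<otimes>\<^bsub>G\<^esub> g0) v) ` H = (\<lambda>a. \<alpha> g0 v) ` H" by (rule image_cong[OF refl])
    moreover have "(\<lambda>g. \<alpha> g v) ` (H #>\<^bsub>G\<^esub> g0) = (\<lambda>a. \<alpha> (a \<otimes>\<^bsub>G\<^esub> g0) v) ` H"
      by (auto simp: r_coset_def)
    ultimately have "(\<lambda>g. \<alpha> g v) ` (H #>\<^bsub>G\<^esub> g0) = (\<lambda>a. \<alpha> g0 v) ` H" by simp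
    moreover have "H \<noteq> {}" using H.one_closed by blast
    ultimately show ?thesis by (simp add: image_constant_conv)
  qed
  then show "coset_act \<alpha> (H #>\<^bsub>G\<^esub> g0) v = \<alpha> g0 v" by (simp add: coset_act_def)
qed

lemma a_r_coset_graded_sub: "I +>\<^bsub>graded_sub R S\<^esub> x = I +>\<^bsub>R\<^esub> x"
  by (simp add: a_r_coset_def r_coset_def graded_sub_def)

text \<open>The operations on cosets depend on the ambient algebra only through its operations, not through its
  carrier. Hence \<open>\<A>/W\<close> is literally a subset of the algebra of \<open>G\<close>-invariant classes modulo \<open>W\<close>, with the same
  operations.\<close>

lemma graded_quot_ops_graded_sub:
  "monoid.mult (graded_quot (graded_sub R S) I) = monoid.mult (graded_quot R I)"
  "ring.add (graded_quot (graded_sub R S) I) = ring.add (graded_quot R I)"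
  "monoid.one (graded_quot (graded_sub R S) I) = monoid.one (graded_quot R I)"
  "ring.zero (graded_quot (graded_sub R S) I) = ring.zero (graded_quot R I)"
  "smult (graded_quot (graded_sub R S) I) = smult (graded_quot R I)"
  by (simp_all add: graded_quot_def FactRing_def rcoset_mult_def a_r_coset_graded_sub
      set_add_def set_mult_def induced_def fun_eq_iff)
    (simp_all add: graded_sub_def)

context dg_algebra
begin

lemma presents_sub:
  "presents R k S K \<Longrightarrow> graded_subalgebra S' \<Longrightarrow> S' \<subseteq> S \<Longrightarrow> K \<subseteq> S' \<Longrightarrow>
   presents (graded_sub R (k ` S')) k S' K"
  by (rule presentation.pres_graded_sub[OF presentation.intro[OF dg_algebra_axioms presentation_axioms.intro]])

lemma presents_quot:
  "presents R k S K \<Longrightarrow> graded_ideal K' S \<Longrightarrow> K \<subseteq> K' \<Longrightarrow>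
   presents (graded_quot R (k ` K')) (\<lambda>x. k ` K' +>\<^bsub>R\<^esub> k x) S K'"
  by (rule presentation.pres_graded_quot[OF presentation.intro[OF dg_algebra_axioms presentation_axioms.intro]])

end

locale degenerate_hochschild = hochschild G A M
  for G :: "('g, 'u) monoid_scheme"
    and A :: "('k::field, 'g, 'a::{ring,monoid_mult}) module_algebra_data"
    and M :: "('k, 'g, 'm::{ring,monoid_mult}, 'a) bimodule_data" +
  fixes H :: "'g set" and \<rho> :: "'g set" and p q r :: nat and m :: 'm and h :: "'a \<Rightarrow> 'm"
  assumes char_p: "CHAR('k) = p" "p > 0" and q: "q = p ^ r"
    and finite_G: "finite (carrier G)" and normal: "H \<lhd> G" and p_H: "\<not> p dvd card H"
    and order_q: "order (G Mod H) = q"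
    and \<rho>: "\<rho> \<in> carrier (G Mod H)" and generate_\<rho>: "generate (G Mod H) {\<rho>} = carrier (G Mod H)"
    and degenerated: "degenerated G H \<rho> q A M m h"
begin

definition g0 :: 'g where "g0 = (SOME g. g \<in> \<rho>)"

definition m_cochain :: "'a list \<Rightarrow> 'm" where "m_cochain xs = (if xs = [] then m else 0)"

definition h_cochain :: "'a list \<Rightarrow> 'm" where
  "h_cochain xs = (if length xs = 1 then h (hd xs) else 0)"

lemma g0_\<rho>: "g0 \<in> \<rho>"
proof -
  interpret group G by (rule group_G)
  interpret H: normal H G by (rule normal)
  obtain a where "a \<in> carrier G" "\<rho> = H #>\<^bsub>G\<^esub> a"
    using \<rho> by (auto simp: FactGroup_def RCOSETS_def)
  then have "a \<in> \<rho>" using rcos_self[OF _ H.subgroup_axioms] by simp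
  then show ?thesis unfolding g0_def by (rule someI)
qed

lemmas quotient = cyclic_quotient_decomposition[OF group_G finite_G normal \<rho> generate_\<rho> g0_\<rho>]

lemma coset_act_\<rho>:
  assumes "\<And>a b. a \<in> carrier G \<Longrightarrow> b \<in> carrier G \<Longrightarrow> \<alpha> (a \<otimes>\<^bsub>G\<^esub> b) v = \<alpha> a (\<alpha> b v)"
    and "\<And>a. a \<in> H \<Longrightarrow> \<alpha> a v = v"
  shows "coset_act \<alpha> \<rho> v = \<alpha> g0 v"
  using coset_act_eq(1)[OF group_G normal quotient(1), of \<alpha> v] assms
  by (simp add: quotient(2)[symmetric])

lemma prime_p: "prime p"
  using prime_CHAR_semidom[where ?'a = 'k] char_p by simp

lemma m_fixed: "a \<in> H \<Longrightarrow> act M a m = m"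
  using degenerated by (simp add: degenerated_def fixed_pts_def)

lemma h_fixed: "a \<in> H \<Longrightarrow> map_act G A M a h = h"
  using degenerated by (simp add: degenerated_def fixed_pts_def)

lemma h_linear: "lin h" and h_derivation: "h (a * b) = lact M a (h b) + ract M (h a) b"
  using degenerated by (simp_all add: degenerated_def fixed_pts_def derivations_def)

lemma H_G: "a \<in> H \<Longrightarrow> a \<in> carrier G"
  using normal by (meson normal.axioms(1) subgroup.mem_carrier)

lemma Delta_m: "(Delta (-) (act M) \<rho> ^^ n) m = ((\<lambda>y. y - act M g0 y) ^^ n) m
  \<and> (\<forall>a\<in>H. act M a (((\<lambda>y. y - act M g0 y) ^^ n) m) = ((\<lambda>y. y - act M g0 y) ^^ n) m)"
proof (induction n)
  case (Suc n)
  define y where "y = ((\<lambda>y. y - act M g0 y) ^^ n) m"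
  have y: "act M a y = y" if "a \<in> H" for a using Suc that by (simp add: y_def)
  note c = coset_act_eq[OF group_G normal quotient(1), of "act M" y, OF act_composition(1) y]
  have "act M a (y - act M g0 y) = y - act M g0 y" if a: "a \<in> H" for a
    using act_M(1)[OF H_G[OF a], of y "- act M g0 y"] y[OF a] c(2)[OF _ _ _ a]
    by (simp add: act_M_minus H_G[OF a])
  moreover have "Delta (-) (act M) \<rho> y = y - act M g0 y"
    using c(1) by (simp add: Delta_def quotient(2)[symmetric])
  ultimately show ?case using Suc by (simp add: y_def[symmetric])
qed (simp add: m_fixed)

text \<open>The iterates of \<open>\<Delta>\<close> on \<open>M\<close> and on cochains of degree \<open>0\<close> agree, as \<open>G\<close> acts on the latter through \<open>M\<close>.\<close>

lemma norm_m: "((\<lambda>x. x - cact g0 x) ^^ (q - 1)) m_cochain = unit_cochain"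
proof -
  have "((\<lambda>x. x - cact g0 x) ^^ n) m_cochain
      = (\<lambda>xs. if xs = [] then ((\<lambda>y. y - act M g0 y) ^^ n) m else 0)" for n
    using quotient(1)
    by (induction n) (auto simp: fun_eq_iff m_cochain_def cochain_act_def act_M_zero)
  moreover have "((\<lambda>y. y - act M g0 y) ^^ (q - 1)) m = 1"
    using degenerated Delta_m[of "q - 1"] by (simp add: degenerated_def)
  ultimately show ?thesis by (simp add: unit_cochain_def fun_eq_iff)
qed

lemma map_act_comp:
  assumes "a \<in> carrier G" "b \<in> carrier G"
  shows "map_act G A M (a \<otimes>\<^bsub>G\<^esub> b) f = map_act G A M a (map_act G A M b f)"
proof -
  interpret group G by (rule group_G)
  show ?thesis
    using assms by (simp add: map_act_def fun_eq_iff inv_mult_group act_composition(1,2))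
qed

lemma cact_h: "a \<in> carrier G \<Longrightarrow> cact a h_cochain = (\<lambda>xs. if length xs = 1 then map_act G A M a h (hd xs) else 0)"
  by (auto simp: fun_eq_iff h_cochain_def cochain_act_def map_act_def act_M_zero length_Suc_conv)

lemma d_m: "d m_cochain = (\<lambda>xs. if length xs = 1 then inner_derivation M m (hd xs) else 0)"
proof
  fix xs :: "'a list"
  show "d m_cochain xs = (if length xs = 1 then inner_derivation M m (hd xs) else 0)"
  proof (cases "length xs = 1")
    case True
    then obtain a where "xs = [a]" by (auto simp: length_Suc_conv)
    then show ?thesis
      by (simp add: hochschild_diff_def inner_derivation_def m_cochain_def)
  next
    case False
    then show ?thesis
      by (cases xs) (auto simp: d_Nil m_cochain_def intro!: d_vanishes)
  qed
qed

lemma d_h: "d h_cochain = 0"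
proof
  fix xs :: "'a list"
  show "d h_cochain xs = 0 xs"
  proof (cases "length xs = 2")
    case True
    then obtain a b where "xs = [a, b]" by (auto simp: length_Suc_conv numeral_2_eq_2)
    then show ?thesis
      by (simp add: hochschild_diff_def h_cochain_def h_derivation)
  next
    case False
    have "h_cochain ys = 0" if "length ys = length xs - 1" "xs \<noteq> []" for ys
      using that False by (auto simp: h_cochain_def)
    then show ?thesis
      by (cases "xs = []") (simp_all add: d_Nil d_vanishes)
  qed
qed

lemma C_of_degree_zero: "(\<And>xs. xs \<noteq> [] \<Longrightarrow> f xs = 0) \<Longrightarrow> f \<in> C"
  by (rule C_I[of _ 0]) (simp_all add: multilinear_def lin_closed)

lemma h_C: "h_cochain \<in> C"
proof (rule C_I[of _ 1])
  have "lin (\<lambda>a. h_cochain (us @ a # vs))" for us vs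
    using h_linear by (cases "us = [] \<and> vs = []") (auto simp: h_cochain_def lin_closed)
  then show "multi h_cochain" by (simp add: multilinear_def)
qed (simp add: h_cochain_def)

lemma h_m: "h_cochain - cact g0 h_cochain + d m_cochain = 0"
proof -
  have "coset_act (map_act G A M) \<rho> h = map_act G A M g0 h"
    by (rule coset_act_\<rho>[OF map_act_comp h_fixed])
  moreover have "\<forall>a. Delta (-) (map_act G A M) \<rho> h a + inner_derivation M m a = 0"
    using degenerated unfolding degenerated_def by blast
  ultimately have "h a - map_act G A M g0 h a + inner_derivation M m a = 0" for a
    by (simp add: Delta_def)
  then show ?thesis
    using quotient(1) by (simp add: fun_eq_iff cact_h d_m) (simp add: h_cochain_def)
qed

lemma cup_h: "cup x h_cochain xs = (if xs = [] then 0 else x (butlast xs) * h (last xs))"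
proof (induction xs arbitrary: x)
  case (Cons a xs)
  then show ?case by (cases xs) (auto simp: h_cochain_def)
qed (simp add: h_cochain_def)

sublocale degenerate_dg_algebra scl cup unit_cochain C d sgn_cochain proj_cochain G H g0 p q r
  cact m_cochain h_cochain
proof (intro degenerate_dg_algebra.intro degenerate_dg_algebra_axioms.intro dg_algebra_axioms)
  show "group G" by (rule group_G)
  show "cact a m_cochain = m_cochain" if "a \<in> H" for a
    using H_G[OF that] m_fixed[OF that]
    by (simp add: fun_eq_iff cochain_act_def m_cochain_def act_M_zero)
  show "cact a h_cochain = h_cochain" if "a \<in> H" for a
    using H_G[OF that] h_fixed[OF that] by (simp only: cact_h) (simp add: h_cochain_def fun_eq_iff)
  show "q = p ^ r" by (rule q)
  show "((\<lambda>x. x - cact g0 x) ^^ (q - 1)) m_cochain = unit_cochain" by (rule norm_m)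
  show "g0 [^]\<^bsub>G\<^esub> q \<in> H" using quotient(3) order_q by simp
  show "\<exists>i::nat. \<exists>x\<in>H. g = x \<otimes>\<^bsub>G\<^esub> g0 [^]\<^bsub>G\<^esub> i" if "g \<in> carrier G" for g
    by (rule quotient(4)[OF that])
  show "m_cochain \<in> C" by (rule C_of_degree_zero) (simp add: m_cochain_def)
  show "sgn_cochain m_cochain = m_cochain" "sgn_cochain h_cochain = - h_cochain"
    by (auto simp: fun_eq_iff sgn_cochain_def m_cochain_def h_cochain_def)
  show "proj_cochain (Suc n) (cup x h_cochain) = cup (proj_cochain n x) h_cochain"
    and "proj_cochain 0 (cup x h_cochain) = 0" for n x
    by (auto simp: fun_eq_iff proj_cochain_def cup_h h_cochain_def[of "[]"])
qed (simp_all add: finite_G normal prime_p char_p p_H quotient(1) cact_id cact_cact C_act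
    cact_linear cact_cup cact_unit cact_d cact_sgn cact_proj h_C d_h h_m)

section \<open>Hochschild cohomology\<close>

abbreviation "cl x \<equiv> boundaries +>\<^bsub>cochains A M\<^esub> x"

lemma cochains_simps:
  "carrier (cochains A M) = C" "monoid.mult (cochains A M) = cup" "ring.add (cochains A M) = (+)"
  "monoid.one (cochains A M) = unit_cochain" "ring.zero (cochains A M) = 0"
  "smult (cochains A M) = scl"
  "component (cochains A M) n = {f \<in> C. \<forall>xs. length xs \<noteq> n \<longrightarrow> f xs = 0}"
  by (simp_all add: cochains_def cup_def fun_eq_iff unit_cochain_def scl_def)

lemma presents_cochains: "presents (cochains A M) (\<lambda>x. x) C {0}"
proof -
  have "{f \<in> C. \<forall>xs. length xs \<noteq> n \<longrightarrow> f xs = 0} = proj_cochain n ` C" for n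
  proof (rule subset_antisym; rule subsetI)
    fix f assume f: "f \<in> {f \<in> C. \<forall>xs. length xs \<noteq> n \<longrightarrow> f xs = 0}"
    then have "f = proj_cochain n f" by (auto simp: proj_cochain_def fun_eq_iff)
    then show "f \<in> proj_cochain n ` C" using f by blast
  qed (auto simp: C_proj, simp add: proj_cochain_def)
  moreover have scl_zero: "scl c 0 = 0" for c by (simp add: scl_def fun_eq_iff)
  moreover have "graded_subalgebra C" by (rule graded_subalgebra_I) simp_all
  moreover have "graded_ideal {0} C" by (rule graded_ideal_I) (auto simp: scl_zero)
  ultimately show ?thesis
    unfolding presents_def by (simp add: cochains_simps)
qed

lemma HH_eq: "HH A M = graded_quot (graded_sub (cochains A M) cocycles) boundaries"
  by (simp only: HH_def cohomology_def cochains_simps cocycles_def boundaries_def)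

lemma presents_HH: "presents (HH A M) (\<lambda>x. cl x) cocycles boundaries"
proof -
  have "presents (graded_sub (cochains A M) ((\<lambda>x. x) ` cocycles)) (\<lambda>x. x) cocycles {0}"
    by (rule presents_sub[OF presents_cochains graded_subalgebra_cocycles]) auto
  from presents_quot[OF this graded_ideal_boundaries]
  show ?thesis by (simp add: HH_eq a_r_coset_graded_sub)
qed

sublocale HH: presentation scl cup unit_cochain C d sgn_cochain proj_cochain "HH A M" "\<lambda>x. cl x"
  cocycles boundaries
  by unfold_locales (rule presents_HH)

lemma HH_act_cl: 
  assumes g: "g \<in> carrier G" and x: "x \<in> C"
  shows "HH_act G A M g (cl x) = cl (cact g x)"
proof -
  interpret G: group G by (rule group_G)
  have coset: "cl y = (\<lambda>b. b + y) ` boundaries" for y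
    by (auto simp: a_r_coset_def r_coset_def cochains_simps)
  have "cact g ` boundaries = boundaries"
  proof (rule subset_antisym; rule subsetI)
    fix b assume b: "b \<in> boundaries"
    have "cact g (cact (inv\<^bsub>G\<^esub> g) b) = b"
      using cact_cact[OF g G.inv_closed[OF g], of b] g by (simp add: cact_id)
    then show "b \<in> cact g ` boundaries" using boundaries_act[OF G.inv_closed[OF g] b] by force
  qed (use g boundaries_act in auto)
  then have "HH_act G A M g (cl x) = (\<lambda>b. b + cact g x) ` boundaries"
    using g by (simp add: HH_act_def coset image_image cact_linear)
      (metis (no_types, lifting) image_cong image_image)
  then show ?thesis by (simp add: coset)
qed

text \<open>A class is fixed by \<open>g\<close> exactly if \<open>g\<close> moves a representative by a boundary, whatever the
  representative.\<close>

lemma fixed_classes: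
  assumes "B \<subseteq> carrier G"
  shows "fixed_pts (HH_act G A M) B (carrier (HH A M)) = (\<lambda>x. cl x) ` stable_cocycles B"
proof -
  have "HH_act G A M g (cl x) = cl x \<longleftrightarrow> cact g x - x \<in> boundaries"
    if "g \<in> B" "x \<in> cocycles" for g x
    using that assms HH.pres_eq[of "cact g x" x] by (auto simp: HH_act_cl cocycles_act)
  then show ?thesis
    unfolding fixed_pts_def HH.pres_carrier stable_cocycles_def by auto
qed

abbreviation "HH_G \<equiv> HH_inv G (carrier G) A M"
abbreviation "W \<equiv> W_ideal G H \<rho> q A M"

lemma F_subset: "F \<subseteq> cocycles" using F_cocycles by blast
lemma boundaries_F: "boundaries \<subseteq> F" using boundaries_subset_K K_subset_P P_subset_F by blast
lemma boundaries_P: "boundaries \<subseteq> P" using boundaries_subset_K K_subset_P by blast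

lemma presents_HH_inv: "presents HH_G (\<lambda>x. cl x) F boundaries"
  unfolding HH_inv_def fixed_classes[OF subset_refl]
  by (rule HH.pres_graded_sub[OF graded_subalgebra_F F_subset boundaries_F])

text \<open>Every \<open>H\<close>-invariant class has an \<open>H\<close>-invariant representative, its average, and on such
  representatives the operator \<open>\<Delta>\<close> on classes is induced by the operator \<open>\<Delta>\<close> on cochains.\<close>

lemma W_eq: "W = (\<lambda>x. cl x) ` K"
proof -
  have step: "Delta (a_minus (HH A M)) (HH_act G A M) \<rho> (cl z) = cl (\<Delta> z)"
    if z: "z \<in> cocycles" "z \<in> E" for z
  proof -
    have "coset_act (HH_act G A M) \<rho> (cl z) = HH_act G A M g0 (cl z)"
    proof (rule coset_act_\<rho>)
      interpret G: group G by (rule group_G)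
      show "HH_act G A M (a \<otimes>\<^bsub>G\<^esub> b) (cl z) = HH_act G A M a (HH_act G A M b (cl z))"
        if "a \<in> carrier G" "b \<in> carrier G" for a b
        using that z by (simp add: HH_act_cl cact_cact C_act)
      show "HH_act G A M a (cl z) = cl z" if "a \<in> H" for a
        using that z H_G by (simp add: HH_act_cl) (simp add: E_def)
    qed
    then show ?thesis
      using z quotient(1) cocycles_\<sigma>[OF z(1)]
      by (simp add: Delta_def HH_act_cl HH.pres_minus \<Delta>_def)
  qed
  have "(Delta (a_minus (HH A M)) (HH_act G A M) \<rho> ^^ n) (cl z) = cl ((\<Delta> ^^ n) z)"
    if z: "z \<in> cocycles" "z \<in> E" for z n
    by (induction n) (simp_all add: step z)
  then have norm: "(Delta (a_minus (HH A M)) (HH_act G A M) \<rho> ^^ (q - 1)) (cl z) = cl (N z)"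
    if "z \<in> cocycles" "z \<in> E" for z
    using that by (simp add: N_def)
  have H_sub: "H \<subseteq> carrier G" using H_G by blast
  have carrier: "carrier (HH_inv G H A M) = (\<lambda>x. cl x) ` stable_cocycles H"
    by (simp add: HH_inv_def graded_sub_def fixed_classes[OF H_sub])
  show ?thesis
  proof (rule subset_antisym; rule subsetI)
    fix t assume "t \<in> W"
    then obtain x where x: "x \<in> stable_cocycles H"
      "t = (Delta (a_minus (HH A M)) (HH_act G A M) \<rho> ^^ (q - 1)) (cl x)"
      unfolding W_ideal_def carrier by blast
    have e: "average x \<in> cocycles" "average x \<in> E" "average x - x \<in> boundaries"
      using average_class[OF x(1)] by auto
    have xc: "x \<in> cocycles" using x(1) unfolding stable_cocycles_def by blast
    have "cl x = cl (average x)" using HH.pres_eq[OF e(1) xc] e(3) by simp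
    then have "t = cl (N (average x))" using x(2) norm[OF e(1,2)] by simp
    moreover have "N (average x) \<in> K" using K_I[OF e(1,2), of "N (average x)"] by simp
    ultimately show "t \<in> (\<lambda>x. cl x) ` K" by blast
  next
    fix t assume "t \<in> (\<lambda>x. cl x) ` K"
    then obtain y where y: "y \<in> K" "t = cl y" by blast
    obtain z where z: "z \<in> cocycles" "z \<in> E" "y - N z \<in> boundaries" using K_E[OF y(1)] by blast
    have yc: "y \<in> cocycles" using y(1) K_subset_P P_cocycles by blast
    have Nz: "N z \<in> cocycles" using z(1) by (simp add: N_def)
    have "t = cl (N z)" using y(2) HH.pres_eq[OF yc Nz] z(3) by simp
    moreover have "z \<in> stable_cocycles H"
      using z(1,2) unfolding stable_cocycles_def E_def by simp
    ultimately show "t \<in> W" unfolding W_ideal_def carrier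
      using norm[OF z(1,2)] by (metis image_eqI)
  qed
qed

lemma Theta_image: "Theta A M ` carrier (HH_up G A M) = (\<lambda>x. cl x) ` P"
proof -
  let ?dI = "d ` invariants"
  have inv: "fixed_pts (cochain_act G A M) (carrier G) C = invariants"
    by (simp only: fixed_pts_def invariants_def)
  have ic: "{f \<in> invariants. d f = 0} = invariant_cocycles"
    unfolding invariant_cocycles_def invariants_def cocycles_def by blast
  have coset: "?dI +>\<^bsub>graded_sub (graded_sub (cochains A M) invariants) invariant_cocycles\<^esub> x
      = (\<lambda>b. b + x) ` ?dI" for x
    unfolding a_r_coset_graded_sub by (auto simp: a_r_coset_def r_coset_def cochains_simps)
  have "carrier (HH_up G A M) = (\<lambda>x. (\<lambda>b. b + x) ` ?dI) ` invariant_cocycles"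
  proof -
    have "cochains_inv G A M = graded_sub (cochains A M) invariants"
      by (simp add: cochains_inv_def cochains_simps inv)
    then have "HH_up G A M = graded_quot (graded_sub (graded_sub (cochains A M) invariants) invariant_cocycles) ?dI"
      by (simp add: HH_up_def cohomology_def graded_sub_def cochains_simps ic)
    then have "carrier (HH_up G A M) = (\<lambda>x. ?dI +>\<^bsub>graded_sub (graded_sub (cochains A M) invariants) invariant_cocycles\<^esub> x)
        ` invariant_cocycles"
      by (auto simp: graded_quot_def FactRing_def A_RCOSETS_def RCOSETS_def a_r_coset_def graded_sub_def)
    then show ?thesis by (simp add: coset)
  qed
  moreover have "Theta A M ((\<lambda>b. b + x) ` ?dI) = cl x" if x: "x \<in> invariant_cocycles" for x
  proof -
    have bd: "d ` carrier (cochains A M) = boundaries" by (simp only: boundaries_def cochains_simps)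
    have zero: "0 \<in> ?dI" using invariants_closed(9) by (metis d.zero image_eqI)
    have "cl y = cl x" if y: "y \<in> (\<lambda>b. b + x) ` ?dI" for y
    proof -
      obtain b where b: "b \<in> invariants" "y = d b + x" using y by blast
      have "d b \<in> boundaries" using b(1) by (simp add: mem_boundaries E_C)
      then show ?thesis using x b HH.pres_eq[of y x] by simp
    qed
    then show ?thesis
      unfolding Theta_def induced_def bd using zero by (intro SUP_eq_const) blast+
  qed
  ultimately have "Theta A M ` carrier (HH_up G A M) = (\<lambda>x. cl x) ` invariant_cocycles"
    by (simp add: image_image)
  also have "\<dots> = (\<lambda>x. cl x) ` P"
  proof (rule subset_antisym; rule subsetI)
    fix t assume "t \<in> (\<lambda>x. cl x) ` P"
    then obtain y where y: "y \<in> P" "t = cl y" by blast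
    then obtain a where a: "a \<in> invariant_cocycles" "y - a \<in> boundaries" unfolding P_def by blast
    then have "t = cl a" using y HH.pres_eq[of y a] by simp
    then show "t \<in> (\<lambda>x. cl x) ` invariant_cocycles" using a by blast
  next
    fix t assume "t \<in> (\<lambda>x. cl x) ` invariant_cocycles"
    then obtain a where a: "a \<in> invariant_cocycles" "t = cl a" by blast
    have "a \<in> P" by (rule P_I[OF a(1)]) simp
    then show "t \<in> (\<lambda>x. cl x) ` P" using a by blast
  qed
  finally show ?thesis .
qed

lemma A_alg_eq: "A_alg G A M = graded_sub HH_G ((\<lambda>x. cl x) ` P)"
  by (simp add: A_alg_def Theta_image)

lemma presents_A: "presents (A_alg G A M) (\<lambda>x. cl x) P boundaries"
  unfolding A_alg_eq
  by (rule presents_sub[OF presents_HH_inv graded_subalgebra_P P_subset_F boundaries_P])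

abbreviation "cl2 x \<equiv> W +>\<^bsub>HH_G\<^esub> (cl x)"

lemma presents_T: "presents (graded_quot HH_G W) (\<lambda>x. cl2 x) F K"
  unfolding W_eq by (rule presents_quot[OF presents_HH_inv graded_ideal_K boundaries_subset_K])

lemma coset_A: "W +>\<^bsub>A_alg G A M\<^esub> X = W +>\<^bsub>HH_G\<^esub> X"
  unfolding A_alg_eq by (rule a_r_coset_graded_sub)

lemma presents_A_bar: "presents (A_bar G H \<rho> q A M) (\<lambda>x. cl2 x) P K"
proof -
  have "graded_ideal K P" by (rule graded_ideal_subset[OF graded_ideal_K K_subset_P P_subset_F])
  from presents_quot[OF presents_A this boundaries_subset_K]
  show ?thesis unfolding A_bar_def W_eq[symmetric] coset_A .
qed

lemma presentation_A:
  "presentation scl cup unit_cochain C d sgn_cochain proj_cochain (A_alg G A M) (\<lambda>x. cl x) P boundaries"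
  by (intro presentation.intro presentation_axioms.intro dg_algebra_axioms presents_A)

lemma presentation_T:
  "presentation scl cup unit_cochain C d sgn_cochain proj_cochain (graded_quot HH_G W)
    (\<lambda>x. cl2 x) F K"
  by (intro presentation.intro presentation_axioms.intro dg_algebra_axioms presents_T)

lemma deriv_class_eq: "deriv_class A M h = cl h_cochain"
  by (simp only: deriv_class_def HH_class_def h_cochain_def[abs_def] boundaries_def cochains_simps)

lemma D_map_cl:
  assumes a: "a \<in> P"
  shows "D_map G A M h (cl a) = cl (cup h_cochain a - cup (sgn_cochain a) h_cochain)"
proof -
  have "sgn_cochain a \<in> P" by (rule graded_subalgebra_s[OF graded_subalgebra_P a])
  then show ?thesis
    using a by (simp add: D_map_def deriv_class_eq presentation.pres_sign_map[OF presentation_A] HH.pres_mult HH.pres_minus)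
qed

text \<open>The commutator with \<open>h\<close> preserves \<open>K\<close>, so the induced map on cosets may be computed on any
  representative.\<close>

lemma D_bar_cl2:
  assumes a: "a \<in> P"
  shows "D_bar G H \<rho> q A M h (cl2 a) = cl2 (cup h_cochain a - cup (sgn_cochain a) h_cochain)"
proof -
  let ?D = "\<lambda>a. cup h_cochain a - cup (sgn_cochain a) h_cochain"
  note T_eq = presentation.pres_eq[OF presentation_T]
  interpret RA: ring "A_alg G A M" by (rule presentation.pres_ring[OF presentation_A])
  have ideal: "ideal W (A_alg G A M)"
    unfolding W_eq
    by (rule presentation.pres_ideal[OF presentation_A]) (rule graded_ideal_subset[OF graded_ideal_K K_subset_P P_subset_F])
  interpret W: ideal W "A_alg G A M" by (rule ideal)
  have clA: "cl a \<in> carrier (A_alg G A M)" using a by (simp add: presentation.pres_carrier[OF presentation_A])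
  have "W +>\<^bsub>A_alg G A M\<^esub> D_map G A M h X = cl2 (?D a)" if X: "X \<in> W +>\<^bsub>A_alg G A M\<^esub> cl a" for X
  proof -
    have "X \<in> carrier (A_alg G A M)" by (rule W.a_elemrcos_carrier[OF clA X])
    then obtain b where b: "b \<in> P" "X = cl b" unfolding presentation.pres_carrier[OF presentation_A] by blast
    have "W +>\<^bsub>A_alg G A M\<^esub> cl a = W +>\<^bsub>A_alg G A M\<^esub> cl b"
      using W.a_repr_independence'[OF X clA] b by simp
    then have "b - a \<in> K"
      using T_eq[OF P_in_F[OF b(1)] P_in_F[OF a]] by (simp add: coset_A)
    then have "?D (b - a) \<in> K" by (rule K_commutator)
    moreover have "?D (b - a) = ?D b - ?D a" by (simp add: mul_distribs s.diff)
    ultimately have "cl2 (?D b) = cl2 (?D a)"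
      using T_eq[OF P_in_F[OF commutator_closed[OF b(1)]] P_in_F[OF commutator_closed[OF a]]]
      by simp
    then show ?thesis by (simp add: b D_map_cl coset_A)
  qed
  moreover have "W +>\<^bsub>A_alg G A M\<^esub> cl a \<noteq> {}" using W.a_rcos_self[OF clA] by blast
  ultimately show ?thesis
    unfolding D_bar_def induced_def coset_A[of "cl a", symmetric] by (intro SUP_eq_const)
qed

lemma h_square_eq: "h_square G H \<rho> q A M h = cl2 (cup h_cochain h_cochain)"
  by (simp add: h_square_def coset_A deriv_class_eq HH.pres_mult)

theorem structure_of_stable_cohomology:
  "\<exists>f. f \<in> graded_algebra_iso (graded_quot HH_G W)
     (graded_quot (skew_A G H \<rho> q A M h)
        (Idl\<^bsub>skew_A G H \<rho> q A M h\<^esub> {skew_relation G H \<rho> q A M h}))"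
proof -
  let ?B = "A_bar G H \<rho> q A M"
  have "monoid.mult ?B = monoid.mult (graded_quot HH_G W)"
    "ring.add ?B = ring.add (graded_quot HH_G W)" "monoid.one ?B = monoid.one (graded_quot HH_G W)"
    "ring.zero ?B = ring.zero (graded_quot HH_G W)" "smult ?B = smult (graded_quot HH_G W)"
    by (simp_all only: A_bar_def A_alg_eq graded_quot_ops_graded_sub)
  from degenerate_structure[where k = "\<lambda>x. cl2 x" and D = "D_bar G H \<rho> q A M h",
      OF presents_T presents_A_bar this D_bar_cl2]
  show ?thesis unfolding skew_relation_def skew_A_def h_square_eq .
qed

end

theorem theorem12p3:
  fixes G :: "('g, 'u) monoid_scheme" and H :: "'g set" and \<rho> :: "'g set"
    and p q r :: nat
    and A :: "('k::field, 'g, 'a::{ring,monoid_mult}) module_algebra_data"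
    and M :: "('k, 'g, 'm::{ring,monoid_mult}, 'a) bimodule_data"
    and m :: 'm and h :: "'a \<Rightarrow> 'm"
  assumes "CHAR('k) = p" and "p > 0" and "q = p ^ r"
    and "group G" and "finite (carrier G)" and "H \<lhd> G" and "\<not> p dvd card H"
    and "order (G Mod H) = q"
    and "\<rho> \<in> carrier (G Mod H)" and "generate (G Mod H) {\<rho>} = carrier (G Mod H)"
    and "kG_module_algebra G A"
    and "AeG_module_algebra G A M"
    and "degenerated G H \<rho> q A M m h"
  shows "\<exists>f. f \<in> graded_algebra_iso
     (graded_quot (HH_inv G (carrier G) A M) (W_ideal G H \<rho> q A M))
     (graded_quot (skew_A G H \<rho> q A M h)
        (Idl\<^bsub>skew_A G H \<rho> q A M h\<^esub> {skew_relation G H \<rho> q A M h}))"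
proof -
  have "degenerate_hochschild G A M H \<rho> p q r m h"
    by (intro degenerate_hochschild.intro hochschild.intro degenerate_hochschild_axioms.intro assms)
  then show ?thesis by (rule degenerate_hochschild.structure_of_stable_cohomology)
qed

end
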